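(* Let $F$ be an $\omega$-bounded surface with a Nyikos decomposition $F=K\cup\bigcup_{i=1}^nP_i$, where each $P_i=\bigcup_{\alpha<\omega_1}U_{i,\alpha}$ as in the definition of closed long pipe, and let $h:F\to F$ be a homeomorphism. Then there is an isotopy of homeomorphisms $h_t:F\to F$, $t\in[0,1]$, with $h_0=h$ and $h_1(K)=K$.
   Context: A surface is a connected Hausdorff space locally homeomorphic to $\mathbb{R}^2$ (possibly with boundary where indicated). A space is $\omega$-bounded if every countable subset has compact closure. A (closed) long pipe is a surface $P$ with boundary homeomorphic to $\mathbb{S}^1$ such that $P=\bigcup_{\alpha<\omega_1}U_\alpha$, where each $U_\alpha$ is an open subset of $P$ containing $\partial P$ and homeomorphic to $\mathbb{S}^1\times[0,\infty)$, and whenever $\alpha<\beta$ we have $\overline{U_\alpha}\subset U_\beta$ and the boundary of $U_\alpha$ in $U_\beta$ is homeomorphic to $\mathbb{S}^1$. A Nyikos decomposition of an $\omega$-bounded surface $F$ is an expression $F=K\cup\bigcup_{i=1}^nP_i$ where $K$ is a compact surface with $n$ boundary circles, $P_1,\dots,P_n$ are pairwise disjoint closed long pipes, and each $P_i$ meets $K$ exactly in $\partial P_i$, which is a boundary component of $K$ (distinct pipes attached along distinct boundary components). An isotopy of homeomorphisms is a continuous $H:F\times[0,1]\to F$ with each $h_t=H(\cdot,t)$ a homeomorphism. *)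

theory Defs
  imports "HOL-Analysis.Analysis"
begin

definition half_plane :: "(real \<times> real) set" where
  "half_plane = {z. snd z \<ge> 0}"

definition circle_top :: "(real \<times> real) topology" where
  "circle_top = top_of_set (sphere (0::real \<times> real) 1)"

definition half_cylinder_top :: "((real \<times> real) \<times> real) topology" where
  "half_cylinder_top = top_of_set (sphere (0::real \<times> real) 1 \<times> {0..})"

definition surface :: "'a topology \<Rightarrow> bool" where
  "surface X \<longleftrightarrow> Hausdorff_space X \<and> connected_space X \<and>
     (\<forall>x\<in>topspace X. \<exists>U V. openin X U \<and> x \<in> U \<and> open (V :: (real \<times> real) set) \<and>
        subtopology X U homeomorphic_space top_of_set V)"

definition surface_wb :: "'a topology \<Rightarrow> bool" where
  "surface_wb X \<longleftrightarrow> Hausdorff_space X \<and> connected_space X \<and>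
     (\<forall>x\<in>topspace X. \<exists>U V. openin X U \<and> x \<in> U \<and> openin (top_of_set half_plane) V \<and>
        subtopology X U homeomorphic_space top_of_set V)"

definition mboundary :: "'a topology \<Rightarrow> 'a set" where
  "mboundary X = {x \<in> topspace X. \<exists>U V f. openin X U \<and> x \<in> U \<and>
       openin (top_of_set half_plane) V \<and>
       homeomorphic_map (subtopology X U) (top_of_set V) f \<and> snd (f x) = 0}"

definition omega_bounded :: "'a topology \<Rightarrow> bool" where
  "omega_bounded X \<longleftrightarrow> (\<forall>C. C \<subseteq> topspace X \<and> countable C \<longrightarrow> compactin X (X closure_of C))"

definition omega1_order :: "'i rel \<Rightarrow> bool" where
  "omega1_order r \<longleftrightarrow> Well_order r \<and> \<not> countable (Field r) \<and>
     (\<forall>a\<in>Field r. countable {b. (b, a) \<in> r \<and> b \<noteq> a})"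

text \<open>Closed long pipe. The index set is an omega_1-ordered subset of nat set
  (which is large enough to carry such an order).\<close>
definition long_pipe :: "'a topology \<Rightarrow> bool" where
  "long_pipe X \<longleftrightarrow> surface_wb X \<and>
     subtopology X (mboundary X) homeomorphic_space circle_top \<and>
     (\<exists>(r :: nat set rel) U. omega1_order r \<and>
        topspace X = (\<Union>\<alpha>\<in>Field r. U \<alpha>) \<and>
        (\<forall>\<alpha>\<in>Field r. openin X (U \<alpha>) \<and> mboundary X \<subseteq> U \<alpha> \<and>
            subtopology X (U \<alpha>) homeomorphic_space half_cylinder_top) \<and>
        (\<forall>\<alpha> \<beta>. (\<alpha>, \<beta>) \<in> r \<and> \<alpha> \<noteq> \<beta> \<longrightarrow>
            X closure_of (U \<alpha>) \<subseteq> U \<beta> \<and>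
            subtopology X (subtopology X (U \<beta>) frontier_of (U \<alpha>)) homeomorphic_space circle_top))"

definition nyikos_decomposition :: "'a topology \<Rightarrow> 'a set \<Rightarrow> nat \<Rightarrow> (nat \<Rightarrow> 'a set) \<Rightarrow> bool" where
  "nyikos_decomposition F K n P \<longleftrightarrow>
     K \<subseteq> topspace F \<and> compactin F K \<and> surface_wb (subtopology F K) \<and>
     card (connected_components_of (subtopology F (mboundary (subtopology F K)))) = n \<and>
     (\<forall>C\<in>connected_components_of (subtopology F (mboundary (subtopology F K))).
         subtopology F C homeomorphic_space circle_top) \<and>
     topspace F = K \<union> (\<Union>i<n. P i) \<and>
     (\<forall>i<n. P i \<subseteq> topspace F \<and> long_pipe (subtopology F (P i)) \<and>
        P i \<inter> K = mboundary (subtopology F (P i)) \<and>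
        mboundary (subtopology F (P i)) \<in>
          connected_components_of (subtopology F (mboundary (subtopology F K)))) \<and>
     (\<forall>i<n. \<forall>j<n. i \<noteq> j \<longrightarrow> P i \<inter> P j = {})"

end

theory Submission
  imports Defs "HOL-Complex_Analysis.Complex_Analysis"
begin

text \<open>
  Push \<open>K\<close> outwards along collars of its boundary circles to a compact \<open>K'\<close> so large that the interior
  of \<open>h K'\<close> contains \<open>K\<close>. Then \<open>h\<close> permutes the ends of \<open>F\<close>, and inside a pipe \<open>P i\<close> the set \<open>h K'\<close> is
  bounded by a single Jordan curve winding once around an open annulus. By Caratheodory's theorem such a
  curve can be moved to a round circle by a compactly supported isotopy: the Riemann map, extended to the
  curve, carries concentric circles to nearby curves, and close to its centre it is almost linear. So
  \<open>h K'\<close> can be moved to \<open>K\<close> together with round collars, and hence to \<open>K\<close>. Consequently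
  \<open>h K\<close>, \<open>h K'\<close> and \<open>K\<close> are ambient isotopic.

  The boundary extension of the Riemann map follows from Koebe's lemma (a zero-free bounded holomorphic
  function on the disc cannot be small along curves ending at separated boundary points) together with
  Janiszewski's theorem, which makes Jordan domains locally connected at the boundary.
\<close>

section \<open>Compactly supported ambient isotopies\<close>

text \<open>Isotopies are constructed in charts and extended by the identity, so all of them carry
  compact support. The image of \<open>K\<close> itself resists this: its frontier may run through
  \<open>K\<close> and through several pipes at once. After the enlargement the frontier lies in the
  open pipes, which are read as the plane without 0 with the core at 0; support away from 0 leaves
  \<open>K\<close> alone. A long pipe is no cylinder as a whole, but each compact part of it lies in
  a single \<open>U \<alpha>\<close>, so cylinder coordinates suffice. Each pipe gets two charts,
  because the image of the enlarged core may leave the chart in which the enlargement was made.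
  Moving a Jordan curve with support on both of its sides needs a chart of both sides: the outside
  is inverted, mapped conformally as well, and glued to the inside radially, which embeds the whole
  plane. Near the centre a cut-off turns the nonlinear part of the Riemann map into a contraction.
  Pushing \<open>K\<close> outwards requires charts across its boundary circles; these exist only
  locally, so the collar is raised by finitely many small bumps.\<close>

definition ambient_isotopic :: "'a topology \<Rightarrow> 'a set \<Rightarrow> 'a set \<Rightarrow> bool" where
  "ambient_isotopic X A B \<longleftrightarrow> (\<exists>H C. compactin X C \<and>
     continuous_map (prod_topology X (top_of_set {0..1::real})) X H \<and>
     (\<forall>t\<in>{0..1}. homeomorphic_map X X (\<lambda>x. H (x, t))) \<and>
     (\<forall>x\<in>topspace X. H (x, 0) = x) \<and>
     (\<forall>t\<in>{0..1}. \<forall>x\<in>topspace X - C. H (x, t) = x) \<and>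
     (\<lambda>x. H (x, 1)) ` A = B)"

lemma ambient_isotopicE:
  assumes "ambient_isotopic X A B"
  obtains H C where "compactin X C"
    "continuous_map (prod_topology X (top_of_set {0..1::real})) X H"
    "\<And>t. t \<in> {0..1} \<Longrightarrow> homeomorphic_map X X (\<lambda>x. H (x, t))"
    "\<And>x. x \<in> topspace X \<Longrightarrow> H (x, 0) = x"
    "\<And>x t. t \<in> {0..1} \<Longrightarrow> x \<in> topspace X - C \<Longrightarrow> H (x, t) = x"
    "(\<lambda>x. H (x, 1)) ` A = B"
  using assms unfolding ambient_isotopic_def by blast

lemma ambient_isotopic_refl: "ambient_isotopic X A A"
  unfolding ambient_isotopic_def
proof (intro exI conjI)
  show "continuous_map (prod_topology X (top_of_set {0..1::real})) X fst"
    by (rule continuous_map_fst)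
  show "\<forall>t\<in>{0..1::real}. homeomorphic_map X X (\<lambda>x. fst (x, t))"
    by (simp add: homeomorphic_map_id[unfolded id_def])
  show "compactin X {}" by simp
qed auto

text \<open>Both isotopies run at the same time, \<open>H'\<close> after \<open>H\<close>, so
  nothing has to be pasted in the time variable and the supports simply unite.\<close>

lemma ambient_isotopic_trans:
  assumes "ambient_isotopic X A B" "ambient_isotopic X B D"
  shows "ambient_isotopic X A D"
proof -
  obtain H C where C: "compactin X C" and
    cH: "continuous_map (prod_topology X (top_of_set {0..1::real})) X H"
    and hH: "\<And>t. t \<in> {0..1} \<Longrightarrow> homeomorphic_map X X (\<lambda>x. H (x, t))"
    and H0: "\<And>x. x \<in> topspace X \<Longrightarrow> H (x, 0) = x"
    and HC: "\<And>x t. t \<in> {0..1} \<Longrightarrow> x \<in> topspace X - C \<Longrightarrow> H (x, t) = x"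
    and H1: "(\<lambda>x. H (x, 1)) ` A = B"
    using assms(1) by (rule ambient_isotopicE) (rule that)
  obtain H' C' where C': "compactin X C'" and
    cH': "continuous_map (prod_topology X (top_of_set {0..1::real})) X H'"
    and hH': "\<And>t. t \<in> {0..1} \<Longrightarrow> homeomorphic_map X X (\<lambda>x. H' (x, t))"
    and H0': "\<And>x. x \<in> topspace X \<Longrightarrow> H' (x, 0) = x"
    and HC': "\<And>x t. t \<in> {0..1} \<Longrightarrow> x \<in> topspace X - C' \<Longrightarrow> H' (x, t) = x"
    and H1': "(\<lambda>x. H' (x, 1)) ` B = D"
    using assms(2) by (rule ambient_isotopicE) (rule that)
  let ?G = "\<lambda>p. H' (H p, snd p)"
  show ?thesis
    unfolding ambient_isotopic_def
  proof (intro exI[of _ ?G] exI[of _ "C \<union> C'"] conjI ballI)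
    show "compactin X (C \<union> C')" by (simp add: C C' compactin_Un)
    have "continuous_map (prod_topology X (top_of_set {0..1::real})) (prod_topology X (top_of_set {0..1::real})) (\<lambda>p. (H p, snd p))"
      by (intro continuous_map_pairedI cH continuous_map_snd)
    from continuous_map_compose[OF this cH']
    show "continuous_map (prod_topology X (top_of_set {0..1::real})) X ?G" by (simp add: o_def)
    show "homeomorphic_map X X (\<lambda>x. ?G (x, t))" if "t \<in> {0..1}" for t
      using homeomorphic_map_compose[OF hH[OF that] hH'[OF that]] by (simp add: o_def)
    show "?G (x, 0) = x" if "x \<in> topspace X" for x
      using that by (simp add: H0 H0')
    show "?G (x, t) = x" if "t \<in> {0..1}" "x \<in> topspace X - (C \<union> C')" for x t
      using that by (simp add: HC HC')
    show "(\<lambda>x. ?G (x, 1)) ` A = D"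
      unfolding H1'[symmetric] H1[symmetric] image_image by simp
  qed
qed

text \<open>Time is reversed after composing with the inverse \<open>k\<close> of the final map.
  Joint continuity then rests on \<open>H\<close> and on the single map \<open>k\<close>; the
  inverses of the other time slices never enter as a family.\<close>

lemma ambient_isotopic_sym:
  assumes "ambient_isotopic X A B" "A \<subseteq> topspace X"
  shows "ambient_isotopic X B A"
proof -
  obtain H C where C: "compactin X C" and
    cH: "continuous_map (prod_topology X (top_of_set {0..1::real})) X H"
    and hH: "\<And>t. t \<in> {0..1} \<Longrightarrow> homeomorphic_map X X (\<lambda>x. H (x, t))"
    and H0: "\<And>x. x \<in> topspace X \<Longrightarrow> H (x, 0) = x"
    and HC: "\<And>x t. t \<in> {0..1} \<Longrightarrow> x \<in> topspace X - C \<Longrightarrow> H (x, t) = x"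
    and H1: "(\<lambda>x. H (x, 1)) ` A = B"
    using assms(1) by (rule ambient_isotopicE) (rule that)
  have "homeomorphic_map X X (\<lambda>x. H (x, 1))" using hH by simp
  then obtain k where k: "homeomorphic_maps X X (\<lambda>x. H (x, 1)) k"
    by (auto simp: homeomorphic_map_maps)
  then have ck: "continuous_map X X k" and kH: "\<And>x. x \<in> topspace X \<Longrightarrow> k (H (x, 1)) = x"
    and Hk: "\<And>x. x \<in> topspace X \<Longrightarrow> H (k x, 1) = x"
    by (auto simp: homeomorphic_maps_def)
  have hk: "homeomorphic_map X X k"
    using k homeomorphic_map_maps homeomorphic_maps_sym by blast
  let ?G = "\<lambda>p. H (k (fst p), 1 - snd p)"
  show ?thesis
    unfolding ambient_isotopic_def
  proof (intro exI[of _ ?G] exI[of _ C] conjI ballI)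
    have 1: "continuous_map (prod_topology X (top_of_set {0..1::real})) X (\<lambda>p. k (fst p))"
      using continuous_map_compose[OF continuous_map_fst ck] by (simp add: o_def)
    have c: "continuous_map (top_of_set {0..1::real}) (top_of_set {0..1::real}) (\<lambda>t. 1 - t)"
      by (auto intro!: continuous_intros)
    have 2: "continuous_map (prod_topology X (top_of_set {0..1::real})) (top_of_set {0..1::real}) (\<lambda>p. 1 - snd p)"
      using continuous_map_compose[OF continuous_map_snd c] by (simp add: o_def)
    from continuous_map_compose[OF continuous_map_pairedI[OF 1 2] cH]
    show "continuous_map (prod_topology X (top_of_set {0..1::real})) X ?G" by (simp add: o_def)
    show "homeomorphic_map X X (\<lambda>x. ?G (x, t))" if "t \<in> {0..1}" for t
    proof -
      have "1 - t \<in> {0..1}" using that by auto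
      from homeomorphic_map_compose[OF hk hH[OF this]] show ?thesis by (simp add: o_def)
    qed
    show "?G (x, 0) = x" if "x \<in> topspace X" for x
      using that by (simp add: Hk)
    show "?G (x, t) = x" if "t \<in> {0..1}" "x \<in> topspace X - C" for x t
    proof -
      have "H (x, 1) = x" using HC that by simp
      then have "k x = x" using kH that by force
      then show ?thesis using HC[of "1 - t" x] that by simp
    qed
    have "(\<lambda>x. ?G (x, 1)) ` B = k ` B"
    proof (rule image_cong)
      fix x assume "x \<in> B"
      then have "x \<in> topspace X"
        using H1 assms(2) homeomorphic_imp_surjective_map[OF hH[of 1]] by auto
      then have "k x \<in> topspace X" using ck by (auto simp: continuous_map_def)
      then show "?G (x, 1) = k x" by (simp add: H0)
    qed simp
    also have "\<dots> = A"
      using H1 kH assms(2) by (auto simp: image_iff subset_eq)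
    finally show "(\<lambda>x. ?G (x, 1)) ` B = A" .
  qed (rule C)
qed

text \<open>The two formulas are pasted over an open cover: \<open>N\<close>, and the complement of
  the image of \<open>C\<close>, which is compact and so closed in a Hausdorff space. On the overlap
  \<open>G\<close> moves nothing. The parameter space \<open>T\<close> is arbitrary so that whole
  isotopies and single maps are both covered.\<close>

lemma continuous_map_extend_id:
  assumes X: "Hausdorff_space X" and N: "openin X N"
    and w: "homeomorphic_maps (subtopology X N) Y w w'"
    and C: "compactin Y C"
    and G: "continuous_map (prod_topology Y T) Y G"
    and GC: "\<And>y t. t \<in> topspace T \<Longrightarrow> y \<in> topspace Y - C \<Longrightarrow> G (y, t) = y"
  shows "continuous_map (prod_topology X T) X (\<lambda>p. if fst p \<in> N then w' (G (w (fst p), snd p)) else fst p)"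
proof -
  have NX: "N \<subseteq> topspace X" using N openin_subset by blast
  have cw: "continuous_map (subtopology X N) Y w" and cw': "continuous_map Y (subtopology X N) w'"
    and w'w: "\<And>x. x \<in> N \<Longrightarrow> w' (w x) = x"
    using w NX by (auto simp: homeomorphic_maps_def)
  have wN: "w x \<in> topspace Y" if "x \<in> N" for x
    using cw that NX by (auto simp: continuous_map_def)
  have "compactin X (w' ` C)"
    using image_compactin[OF C continuous_map_into_fulltopology[OF cw']] .
  then have clo: "closedin X (w' ` C)" using X compactin_imp_closedin by blast
  define S where "S = (\<lambda>b::bool. (if b then N else topspace X - w' ` C) \<times> topspace T)"
  define f where "f = (\<lambda>b p. if b then w' (G (w (fst p), snd p)) else fst p)"
  have st: "subtopology (prod_topology X T) (N \<times> topspace T) = prod_topology (subtopology X N) T"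
    by (simp add: prod_topology_subtopology)
  show ?thesis
  proof (rule pasting_lemma[where I = UNIV and T = S and f = f])
    show "openin (prod_topology X T) (S b)" for b
      using N clo by (auto simp: S_def openin_prod_Times_iff)
    show "continuous_map (subtopology (prod_topology X T) (S b)) X (f b)" for b
    proof (cases b)
      case True
      have 1: "continuous_map (prod_topology (subtopology X N) T) Y (\<lambda>p. w (fst p))"
        using continuous_map_compose[OF continuous_map_fst cw] by (simp add: o_def)
      have "continuous_map (prod_topology (subtopology X N) T) (subtopology X N) (w' \<circ> (G \<circ> (\<lambda>p. (w (fst p), snd p))))"
        by (intro continuous_map_compose[OF _ cw'] continuous_map_compose[OF _ G] continuous_map_pairedI 1 continuous_map_snd)
      then show ?thesis
        using True by (simp add: S_def f_def o_def st continuous_map_in_subtopology)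
    next
      case False
      then show ?thesis
        by (simp add: f_def continuous_map_from_subtopology continuous_map_fst)
    qed
    show "f i x = f j x" if "x \<in> topspace (prod_topology X T) \<inter> S i \<inter> S j" for i j x
    proof -
      have *: "w' (G (w (fst p), snd p)) = fst p" if "fst p \<in> N" "fst p \<notin> w' ` C" "snd p \<in> topspace T" for p
      proof -
        have "w (fst p) \<notin> C" using that w'w by force
        then show ?thesis using GC wN that w'w by auto
      qed
      show ?thesis using that *[of x] by (cases i; cases j) (auto simp: f_def S_def)
    qed
    show "\<exists>j. j \<in> UNIV \<and> x \<in> S j \<and> (if fst x \<in> N then w' (G (w (fst x), snd x)) else fst x) = f j x"
      if "x \<in> topspace (prod_topology X T)" for x
    proof (cases "fst x \<in> N")
      case True
      then show ?thesis using that by (intro exI[of _ True]) (auto simp: S_def f_def)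
    next
      case False
      have "w' ` C \<subseteq> N"
        using cw' compactin_subset_topspace[OF C] by (fastforce simp: continuous_map_def Pi_iff)
      then show ?thesis using that False by (intro exI[of _ False]) (auto simp: S_def f_def)
    qed
  qed
qed

text \<open>The passage from charts to the surface: compact support inside the chart lets the
  isotopy be continued by the identity, and the inverse of an extended time slice is the extension
  of the inverse slice.\<close>

lemma ambient_isotopic_local:
  assumes X: "Hausdorff_space X" and N: "openin X N"
    and w: "homeomorphic_maps (subtopology X N) Y w w'"
    and AB: "A - N = B - N"
    and iso: "ambient_isotopic Y (w ` (A \<inter> N)) (w ` (B \<inter> N))"
  shows "ambient_isotopic X A B"
proof -
  obtain H C where C: "compactin Y C" and
    cH: "continuous_map (prod_topology Y (top_of_set {0..1::real})) Y H"
    and hH: "\<And>t. t \<in> {0..1} \<Longrightarrow> homeomorphic_map Y Y (\<lambda>x. H (x, t))"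
    and H0: "\<And>x. x \<in> topspace Y \<Longrightarrow> H (x, 0) = x"
    and HC: "\<And>x t. t \<in> {0..1} \<Longrightarrow> x \<in> topspace Y - C \<Longrightarrow> H (x, t) = x"
    and H1: "(\<lambda>x. H (x, 1)) ` (w ` (A \<inter> N)) = w ` (B \<inter> N)"
    using iso by (rule ambient_isotopicE) (rule that)
  have NX: "N \<subseteq> topspace X" using N openin_subset by blast
  have cw: "continuous_map (subtopology X N) Y w" and cw': "continuous_map Y (subtopology X N) w'"
    and w'w: "\<And>x. x \<in> N \<Longrightarrow> w' (w x) = x" and ww': "\<And>y. y \<in> topspace Y \<Longrightarrow> w (w' y) = y"
    using w NX by (auto simp: homeomorphic_maps_def)
  have wN: "w x \<in> topspace Y" if "x \<in> N" for x
    using cw that NX by (auto simp: continuous_map_def)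
  have w'N: "w' y \<in> N" if "y \<in> topspace Y" for y
    using cw' that NX by (auto simp: continuous_map_def)
  let ?E = "\<lambda>G p. if fst p \<in> N then w' (G (w (fst p), snd p)) else fst p"
  show ?thesis
    unfolding ambient_isotopic_def
  proof (intro exI[of _ "?E H"] exI[of _ "w' ` C"] conjI ballI)
    show "compactin X (w' ` C)"
      using image_compactin[OF C continuous_map_into_fulltopology[OF cw']] .
    show "continuous_map (prod_topology X (top_of_set {0..1::real})) X (?E H)"
      by (rule continuous_map_extend_id[OF X N w C cH]) (use HC in auto)
    show "homeomorphic_map X X (\<lambda>x. ?E H (x, t))" if t: "t \<in> {0..1}" for t
    proof -
      obtain k where k: "homeomorphic_maps Y Y (\<lambda>x. H (x, t)) k"
        using hH[OF t] by (auto simp: homeomorphic_map_maps)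
      then have ck: "continuous_map Y Y k" and kH: "\<And>x. x \<in> topspace Y \<Longrightarrow> k (H (x, t)) = x"
        and Hk: "\<And>x. x \<in> topspace Y \<Longrightarrow> H (k x, t) = x" and cHt: "continuous_map Y Y (\<lambda>x. H (x, t))"
        by (auto simp: homeomorphic_maps_def)
      have kC: "k y = y" if "y \<in> topspace Y - C" for y
        using kH[of y] HC[OF t that] that by simp
      \<comment> \<open>A one-point parameter space turns the pasting lemma into a statement about a
        single map, applied below to the time slice and to its inverse.\<close>
      have cE: "continuous_map X X (\<lambda>x. if x \<in> N then w' (g (w x)) else x)"
        if g: "continuous_map Y Y g" "\<And>y. y \<in> topspace Y - C \<Longrightarrow> g y = y" for g
      proof -
        have *: "continuous_map (prod_topology X (top_of_set {0::real})) X (?E (g \<circ> fst))"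
          by (rule continuous_map_extend_id[OF X N w C])
            (use g continuous_map_compose[OF continuous_map_fst g(1)] in \<open>auto simp: o_def\<close>)
        have "continuous_map X (prod_topology X (top_of_set {0::real})) (\<lambda>x. (x, 0))"
          by (auto intro!: continuous_map_pairedI simp: continuous_map_id[unfolded id_def])
        from continuous_map_compose[OF this *] show ?thesis
          unfolding o_def fst_conv snd_conv .
      qed
      have HY: "H (y, t) \<in> topspace Y" "k y \<in> topspace Y" if "y \<in> topspace Y" for y
        using cHt ck that by (auto simp: continuous_map_def)
      have "homeomorphic_maps X X (\<lambda>x. ?E H (x, t)) (\<lambda>x. if x \<in> N then w' (k (w x)) else x)"
        unfolding homeomorphic_maps_def
      proof (intro conjI ballI)
        show "continuous_map X X (\<lambda>x. ?E H (x, t))"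
          unfolding fst_conv snd_conv by (rule cE[OF cHt HC[OF t]])
        show "continuous_map X X (\<lambda>x. if x \<in> N then w' (k (w x)) else x)"
          by (rule cE[OF ck kC])
        show "(if ?E H (x, t) \<in> N then w' (k (w (?E H (x, t)))) else ?E H (x, t)) = x" for x
          using w'N[OF HY(1)[OF wN]] by (cases "x \<in> N") (simp_all add: ww' HY wN kH w'w)
        show "?E H ((if x \<in> N then w' (k (w x)) else x), t) = x" for x
          using w'N[OF HY(2)[OF wN]] by (cases "x \<in> N") (simp_all add: ww' HY wN Hk w'w)
      qed
      then show ?thesis using homeomorphic_map_maps by blast
    qed
    show "?E H (x, 0) = x" if "x \<in> topspace X" for x
      using that by (cases "x \<in> N") (simp_all add: H0 wN w'w)
    show "?E H (x, t) = x" if "t \<in> {0..1}" "x \<in> topspace X - w' ` C" for x t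
    proof (cases "x \<in> N")
      case True
      then have "w x \<notin> C" using that(2) w'w[OF True] by (metis DiffE imageI)
      then have "H (w x, t) = w x" using HC[OF that(1)] wN[OF True] by blast
      then show ?thesis using True w'w by simp
    qed simp
    have "(\<lambda>x. ?E H (x, 1)) ` A = (\<lambda>x. ?E H (x, 1)) ` (A - N) \<union> (\<lambda>x. ?E H (x, 1)) ` (A \<inter> N)"
      by blast
    also have "(\<lambda>x. ?E H (x, 1)) ` (A - N) = A - N"
      by simp
    also have "(\<lambda>x. ?E H (x, 1)) ` (A \<inter> N) = w' ` ((\<lambda>x. H (x, 1)) ` (w ` (A \<inter> N)))"
      unfolding image_image by (rule image_cong) auto
    also have "\<dots> = B \<inter> N" unfolding H1 using w'w by (simp add: image_image)
    also have "A - N \<union> (B \<inter> N) = B" using AB by blast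
    finally show "(\<lambda>x. ?E H (x, 1)) ` A = B" .
  qed
qed

text \<open>Conjugation by \<open>h\<close>, obtained from the local lemma with the whole space as
  domain and the inverse of \<open>h\<close> as chart.\<close>

lemma ambient_isotopic_homeomorphic_image:
  assumes X: "Hausdorff_space X" and h: "homeomorphic_map X X h"
    and AB: "A \<subseteq> topspace X" "B \<subseteq> topspace X" "ambient_isotopic X A B"
  shows "ambient_isotopic X (h ` A) (h ` B)"
proof -
  obtain k where k: "homeomorphic_maps X X h k"
    using h by (auto simp: homeomorphic_map_maps)
  have hX: "h ` topspace X = topspace X" using h homeomorphic_imp_surjective_map by blast
  have kh: "k ` (h ` S \<inter> topspace X) = S" if "S \<subseteq> topspace X" for S
  proof -
    have "h ` S \<inter> topspace X = h ` S" using that hX by blast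
    moreover have "k (h x) = x" if "x \<in> S" for x
      using k \<open>S \<subseteq> topspace X\<close> that by (auto simp: homeomorphic_maps_def)
    ultimately show ?thesis by (simp add: image_image)
  qed
  have k': "homeomorphic_maps (subtopology X (topspace X)) X k h"
    using k homeomorphic_maps_sym by auto
  have "h ` A - topspace X = h ` B - topspace X" using AB hX by blast
  from ambient_isotopic_local[OF X openin_topspace k' this] show ?thesis
    using AB by (simp add: kh)
qed

lemma ambient_isotopic_euclideanI:
  fixes S :: "'a::metric_space set" and H :: "'a \<times> real \<Rightarrow> 'a"
  assumes C: "compact C" "C \<subseteq> S"
    and cH: "continuous_on (S \<times> {0..1}) H"
    and HS: "\<And>x t. x \<in> S \<Longrightarrow> t \<in> {0..1} \<Longrightarrow> H (x, t) \<in> S"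
    and ck: "\<And>t. t \<in> {0..1} \<Longrightarrow> continuous_on S (k t)"
    and kS: "\<And>x t. x \<in> S \<Longrightarrow> t \<in> {0..1} \<Longrightarrow> k t x \<in> S"
    and kH: "\<And>x t. x \<in> S \<Longrightarrow> t \<in> {0..1} \<Longrightarrow> k t (H (x, t)) = x"
    and Hk: "\<And>x t. x \<in> S \<Longrightarrow> t \<in> {0..1} \<Longrightarrow> H (k t x, t) = x"
    and H0: "\<And>x. x \<in> S \<Longrightarrow> H (x, 0) = x"
    and HC: "\<And>x t. x \<in> S - C \<Longrightarrow> t \<in> {0..1} \<Longrightarrow> H (x, t) = x"
    and H1: "(\<lambda>x. H (x, 1)) ` A = B"
  shows "ambient_isotopic (top_of_set S) A B"
  unfolding ambient_isotopic_def
proof (intro exI[of _ H] exI[of _ C] conjI ballI)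
  show "compactin (top_of_set S) C" using C by (simp add: compactin_subtopology)
  show "continuous_map (prod_topology (top_of_set S) (top_of_set {0..1})) (top_of_set S) H"
    unfolding prod_topology_subtopology_eu continuous_map_subtopology_eu using cH HS by auto
  show "homeomorphic_map (top_of_set S) (top_of_set S) (\<lambda>x. H (x, t))" if t: "t \<in> {0..1}" for t
  proof -
    have "continuous_on S (\<lambda>x. H (x, t))"
      by (rule continuous_on_compose2[OF cH]) (use t in \<open>auto intro!: continuous_intros\<close>)
    then have "homeomorphic_maps (top_of_set S) (top_of_set S) (\<lambda>x. H (x, t)) (k t)"
      unfolding homeomorphic_maps_def continuous_map_subtopology_eu
      using t ck HS kS kH Hk by auto
    then show ?thesis using homeomorphic_map_maps by blast
  qed
qed (use H0 HC H1 in auto)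

lemma ambient_isotopic_homeomorphic_maps:
  assumes X: "Hausdorff_space X" and w: "homeomorphic_maps X Y w w'"
    and AB: "A \<subseteq> topspace X" "B \<subseteq> topspace X" and iso: "ambient_isotopic Y (w ` A) (w ` B)"
  shows "ambient_isotopic X A B"
proof (rule ambient_isotopic_local[OF X openin_topspace])
  show "homeomorphic_maps (subtopology X (topspace X)) Y w w'" using w by simp
  have "A \<inter> topspace X = A" "B \<inter> topspace X = B" using AB by auto
  then show "ambient_isotopic Y (w ` (A \<inter> topspace X)) (w ` (B \<inter> topspace X))" using iso by simp
qed (use AB in auto)

text \<open>For \<open>l < a, b < m\<close> this is the piecewise linear homeomorphism of the line that fixes
  everything outside \<open>(l, m)\<close> and moves \<open>a\<close> to \<open>b\<close>.\<close>
definition push :: "real \<Rightarrow> real \<Rightarrow> real \<Rightarrow> real \<Rightarrow> real \<Rightarrow> real" where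
  "push l m a b x = x + (b - a) * max 0 (min ((x - l) / (a - l)) ((m - x) / (m - a)))"

lemma push_outside:
  assumes "l < a" "a < m" "x \<le> l \<or> m \<le> x"
  shows "push l m a b x = x"
proof -
  have "(x - l) / (a - l) \<le> 0 \<or> (m - x) / (m - a) \<le> 0"
    using assms by (auto simp: divide_le_0_iff)
  then have "max 0 (min ((x - l) / (a - l)) ((m - x) / (m - a))) = 0" by auto
  then show ?thesis unfolding push_def by simp
qed

lemma push_below:
  assumes "l < a" "a < m" "l \<le> x" "x \<le> a"
  shows "push l m a b x = l + (x - l) * ((b - l) / (a - l))"
proof -
  have 1: "0 \<le> (x - l) / (a - l)" "(x - l) / (a - l) \<le> 1" "1 \<le> (m - x) / (m - a)"
    using assms by (auto simp: field_simps)
  then have "max 0 (min ((x - l) / (a - l)) ((m - x) / (m - a))) = (x - l) / (a - l)" by auto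
  then have "push l m a b x = x + (b - a) * ((x - l) / (a - l))" unfolding push_def by simp
  also have "\<dots> = l + (x - l) * ((b - l) / (a - l))"
    using assms by (simp add: divide_simps) (simp add: algebra_simps)
  finally show ?thesis .
qed

lemma push_above:
  assumes "l < a" "a < m" "a \<le> x" "x \<le> m"
  shows "push l m a b x = m - (m - x) * ((m - b) / (m - a))"
proof -
  have 1: "0 \<le> (m - x) / (m - a)" "(m - x) / (m - a) \<le> 1" "1 \<le> (x - l) / (a - l)"
    using assms by (auto simp: field_simps)
  then have "max 0 (min ((x - l) / (a - l)) ((m - x) / (m - a))) = (m - x) / (m - a)" by auto
  then have "push l m a b x = x + (b - a) * ((m - x) / (m - a))" unfolding push_def by simp
  also have "\<dots> = m - (m - x) * ((m - b) / (m - a))"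
    using assms by (simp add: divide_simps) (simp add: algebra_simps)
  finally show ?thesis .
qed

text \<open>The map is affine on both sides of \<open>a\<close>, with slopes (b-l)/(a-l) and
  (m-b)/(m-a). Exchanging \<open>a\<close> and \<open>b\<close> makes the slopes reciprocal, so it
  inverts the map.\<close>

lemma push_inside:
  assumes ab: "l < a" "a < m" "l < b" "b < m"
  shows "push l m b a (push l m a b x) = x" "push l m a b x \<le> b \<longleftrightarrow> x \<le> a"
    "x \<in> {l..m} \<Longrightarrow> push l m a b x \<in> {l..m}"
proof -
  consider "x \<le> l" | "l < x" "x \<le> a" | "a < x" "x < m" | "m \<le> x" by linarith
  then have *: "push l m b a (push l m a b x) = x \<and> (push l m a b x \<le> b \<longleftrightarrow> x \<le> a) \<and>
    (x \<in> {l..m} \<longrightarrow> push l m a b x \<in> {l..m})"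
  proof cases
    case 1
    then show ?thesis using ab by (simp add: push_outside)
  next
    case 2
    have e: "push l m a b x = l + (x - l) * ((b - l) / (a - l))" using push_below ab 2 by simp
    have p: "(b - l) / (a - l) > 0" using ab by simp
    have "(x - l) * ((b - l) / (a - l)) \<le> (a - l) * ((b - l) / (a - l))"
      using 2 p by (intro mult_right_mono) auto
    also have "\<dots> = b - l" using ab by simp
    finally have u: "push l m a b x \<le> b" using e by simp
    have lo: "l \<le> push l m a b x" unfolding e using 2 p by (simp del: times_divide_eq_right)
    have "push l m b a (push l m a b x) = l + (push l m a b x - l) * ((a - l) / (b - l))"
      using push_below[of l b m "push l m a b x" a] ab lo u by simp
    also have "\<dots> = l + (x - l) * ((b - l) / (a - l) * ((a - l) / (b - l)))" unfolding e by simp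
    also have "\<dots> = x" using ab by simp
    finally show ?thesis using u lo 2 ab by simp
  next
    case 3
    have e: "push l m a b x = m - (m - x) * ((m - b) / (m - a))" using push_above ab 3 by simp
    have p: "(m - b) / (m - a) > 0" using ab by simp
    have "(m - x) * ((m - b) / (m - a)) < (m - a) * ((m - b) / (m - a))"
      using 3 p by (intro mult_strict_right_mono) auto
    also have "\<dots> = m - b" using ab by simp
    finally have u: "b < push l m a b x" using e by simp
    have "0 \<le> (m - x) * ((m - b) / (m - a))" using 3 p by (intro mult_nonneg_nonneg) auto
    then have hi: "push l m a b x \<le> m" unfolding e by linarith
    have "push l m b a (push l m a b x) = m - (m - push l m a b x) * ((m - a) / (m - b))"
      using push_above[of l b m "push l m a b x" a] ab hi u by simp
    also have "\<dots> = m - (m - x) * ((m - b) / (m - a) * ((m - a) / (m - b)))" unfolding e by simp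
    also have "\<dots> = x" using ab by simp
    finally show ?thesis using u hi 3 ab by simp
  next
    case 4
    then show ?thesis using ab by (simp add: push_outside)
  qed
  then show "push l m b a (push l m a b x) = x" "push l m a b x \<le> b \<longleftrightarrow> x \<le> a"
    "x \<in> {l..m} \<Longrightarrow> push l m a b x \<in> {l..m}" by auto
qed

lemma continuous_on_push:
  assumes "continuous_on D a" "continuous_on D b" "continuous_on D x"
    and "\<And>d. d \<in> D \<Longrightarrow> l < a d \<and> a d < m"
  shows "continuous_on D (\<lambda>d. push l m (a d) (b d) (x d))"
  unfolding push_def
  by (intro continuous_intros assms) (use assms(4) in fastforce)+

text \<open>Each fibre is moved by \<open>push\<close> from the height \<open>\<tau>\<close> towards
  \<open>\<tau>'\<close>. Where the two heights agree nothing moves, so the support lies over the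
  compact set \<open>B0\<close> and between \<open>l\<close> and \<open>m\<close>.\<close>

lemma ambient_isotopic_subgraph:
  fixes B B0 :: "'a::metric_space set" and \<tau> \<tau>' :: "'a \<Rightarrow> real" and J :: "real set"
  assumes B0: "compact B0" "B0 \<subseteq> B" and J: "{l..m} \<subseteq> J"
    and c: "continuous_on B \<tau>" "continuous_on B \<tau>'"
    and lm: "\<And>x. x \<in> B \<Longrightarrow> l < \<tau> x \<and> \<tau> x < m \<and> l < \<tau>' x \<and> \<tau>' x < m"
    and eq: "\<And>x. x \<in> B - B0 \<Longrightarrow> \<tau> x = \<tau>' x"
  shows "ambient_isotopic (top_of_set (B \<times> J)) {p \<in> B \<times> J. snd p \<le> \<tau> (fst p)} {p \<in> B \<times> J. snd p \<le> \<tau>' (fst p)}"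
proof -
  \<comment> \<open>The straight line between the two heights stays strictly between
    \<open>l\<close> and \<open>m\<close> by convexity, so every intermediate \<open>push\<close> is
    a homeomorphism.\<close>
  define \<sigma> where "\<sigma> = (\<lambda>t x. (1 - t) * \<tau> x + t * \<tau>' x)"
  have \<sigma>: "l < \<sigma> t x \<and> \<sigma> t x < m" if "x \<in> B" "t \<in> {0..1}" for x t
    unfolding \<sigma>_def using lm[OF that(1)] that(2)
    using convex_bound_lt[of "- \<tau> x" "- l" "- \<tau>' x" "1 - t" t] convex_bound_lt[of "\<tau> x" m "\<tau>' x" "1 - t" t]
    by auto
  have \<sigma>01: "\<sigma> 0 x = \<tau> x" "\<sigma> 1 x = \<tau>' x" for x by (simp_all add: \<sigma>_def)
  define H where "H = (\<lambda>(p, t). (fst p, push l m (\<tau> (fst p)) (\<sigma> t (fst p)) (snd p)))"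
  define k where "k = (\<lambda>t p. (fst p, push l m (\<sigma> t (fst p)) (\<tau> (fst p)) (snd p)))"
  have inJ: "push l m a b y \<in> J" if "l < a" "a < m" "l < b" "b < m" "y \<in> J" for a b y
    using push_inside(3)[of l a m b y] push_outside[of l a m y b] J that by (cases "y \<in> {l..m}") auto
  show ?thesis
  proof (rule ambient_isotopic_euclideanI[where C = "B0 \<times> {l..m}" and H = H and k = k])
    show "compact (B0 \<times> {l..m})" using B0 by (intro compact_Times) auto
    show "B0 \<times> {l..m} \<subseteq> B \<times> J" using B0 J by auto
    show "continuous_on ((B \<times> J) \<times> {0..1}) H"
      unfolding H_def case_prod_unfold \<sigma>_def
      by (intro continuous_intros continuous_on_push continuous_on_compose2[OF c(1)] continuous_on_compose2[OF c(2)])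
        (use lm in auto)
    show "H (p, t) \<in> B \<times> J" if "p \<in> B \<times> J" "t \<in> {0..1}" for p t
      using that lm \<sigma> inJ by (auto simp: H_def)
    show "continuous_on (B \<times> J) (k t)" if "t \<in> {0..1}" for t
      unfolding k_def using \<sigma>[OF _ that] unfolding \<sigma>_def
      by (intro continuous_intros continuous_on_push continuous_on_compose2[OF c(1)] continuous_on_compose2[OF c(2)])
        auto
    show "k t p \<in> B \<times> J" if "p \<in> B \<times> J" "t \<in> {0..1}" for p t
      using that lm \<sigma> inJ by (auto simp: k_def)
    show "k t (H (p, t)) = p" if "p \<in> B \<times> J" "t \<in> {0..1}" for p t
      using that lm \<sigma> push_inside(1) by (auto simp: k_def H_def)
    show "H (k t p, t) = p" if "p \<in> B \<times> J" "t \<in> {0..1}" for p t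
      using that lm \<sigma> push_inside(1) by (auto simp: k_def H_def)
    show "H (p, 0) = p" if "p \<in> B \<times> J" for p
      by (simp add: H_def \<sigma>01 push_def)
    show "H (p, t) = p" if "p \<in> B \<times> J - B0 \<times> {l..m}" "t \<in> {0..1}" for p t
    proof (cases "fst p \<in> B0")
      case True
      then have "snd p \<le> l \<or> m \<le> snd p" using that by (cases p) auto
      then show ?thesis using lm[of "fst p"] that push_outside by (cases p) (auto simp: H_def)
    next
      case False
      then have "\<tau> (fst p) = \<tau>' (fst p)" using eq that by auto
      then have "\<sigma> t (fst p) = \<tau> (fst p)" by (simp add: \<sigma>_def algebra_simps)
      then show ?thesis by (simp add: H_def push_def)
    qed
    show "(\<lambda>p. H (p, 1)) ` {p \<in> B \<times> J. snd p \<le> \<tau> (fst p)} = {p \<in> B \<times> J. snd p \<le> \<tau>' (fst p)}"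
    proof (intro equalityI subsetI)
      fix q assume "q \<in> (\<lambda>p. H (p, 1)) ` {p \<in> B \<times> J. snd p \<le> \<tau> (fst p)}"
      then obtain p where p: "p \<in> B \<times> J" "snd p \<le> \<tau> (fst p)" "q = H (p, 1)" by blast
      then have "fst p \<in> B" "snd p \<in> J" by auto
      with p lm[of "fst p"] show "q \<in> {p \<in> B \<times> J. snd p \<le> \<tau>' (fst p)}"
        using push_inside(2) inJ by (auto simp: H_def \<sigma>01)
    next
      fix q assume "q \<in> {p \<in> B \<times> J. snd p \<le> \<tau>' (fst p)}"
      then have q: "fst q \<in> B" "snd q \<in> J" "snd q \<le> \<tau>' (fst q)" by auto
      define p where "p = (fst q, push l m (\<tau>' (fst q)) (\<tau> (fst q)) (snd q))"
      have "H (p, 1) = q" "p \<in> B \<times> J" "snd p \<le> \<tau> (fst p)"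
        using q lm[of "fst q"] push_inside(1,2) inJ by (auto simp: p_def H_def \<sigma>01)
      then show "q \<in> (\<lambda>p. H (p, 1)) ` {p \<in> B \<times> J. snd p \<le> \<tau> (fst p)}" by force
    qed
  qed
qed

section \<open>Koebe's lemma\<close>

text \<open>The exponential of \<open>q\<close> is a loop of winding number 1 about 0, not
  necessarily simple. The maximum modulus principle on the component of 0 in its complement carries
  the bound from the loop to 0.\<close>

lemma norm_le_on_loop_around_0:
  assumes holf: "f holomorphic_on ball 0 1"
    and q: "path q" "pathfinish q = pathstart q + 2 * of_real pi * \<i>"
    and qe: "\<And>\<zeta>. \<zeta> \<in> path_image q \<Longrightarrow> Re \<zeta> < 0 \<and> norm (f (exp \<zeta>)) \<le> e"
  shows "norm (f 0) \<le> e"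
proof -
  define \<Gamma> where "\<Gamma> = exp \<circ> q"
  have p: "path \<Gamma>" unfolding \<Gamma>_def
    by (intro path_continuous_image q continuous_intros)
  have im: "path_image \<Gamma> = exp ` path_image q"
    by (simp add: \<Gamma>_def path_image_compose)
  have loop: "pathfinish \<Gamma> = pathstart \<Gamma>"
    using q(2) by (simp add: \<Gamma>_def pathfinish_compose pathstart_compose exp_add)
  have w1: "winding_number \<Gamma> 0 = 1"
    unfolding \<Gamma>_def winding_number_compose_exp[OF q(1)] using q(2) by simp
  have imb: "path_image \<Gamma> \<subseteq> ball 0 1"
    using qe unfolding im by auto
  have 0: "0 \<notin> path_image \<Gamma>" unfolding im by auto
  define U where "U = connected_component_set (- path_image \<Gamma>) 0"
  have U0: "0 \<in> U" using 0 by (simp add: U_def)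
  have Usub: "U \<subseteq> - path_image \<Gamma>" by (simp add: U_def connected_component_subset)
  \<comment> \<open>The winding number is 1 throughout \<open>U\<close> but 0 outside the unit disc,
    which confines \<open>U\<close> to the disc.\<close>
  have Ub: "U \<subseteq> ball 0 1"
  proof
    fix z assume z: "z \<in> U"
    have "winding_number \<Gamma> constant_on U"
      by (rule winding_number_constant[OF p loop]) (use Usub in \<open>auto simp: U_def\<close>)
    then have "winding_number \<Gamma> z = 1" using z U0 w1 by (auto simp: constant_on_def)
    then show "z \<in> ball 0 1"
      using winding_number_zero_outside[OF p convex_ball loop _ imb] by fastforce
  qed
  have fr: "frontier U \<subseteq> path_image \<Gamma>"
  proof -
    have "frontier U \<subseteq> frontier (- path_image \<Gamma>)"
      unfolding U_def by (rule frontier_of_connected_component_subset)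
    also have "\<dots> \<subseteq> path_image \<Gamma>"
      by (simp add: closed_path_image frontier_complement frontier_subset_eq p)
    finally show ?thesis .
  qed
  have cl: "closure U \<subseteq> ball 0 1"
    using closure_Un_frontier[of U] Ub fr imb by blast
  show ?thesis
  proof (rule maximum_modulus_frontier[of f U])
    show "f holomorphic_on interior U"
      using holf Ub interior_subset by (metis holomorphic_on_subset subset_trans)
    show "continuous_on (closure U) f"
      using holf cl continuous_on_subset holomorphic_on_imp_continuous_on by blast
    show "bounded U" using Ub bounded_subset bounded_ball by blast
    show "norm (f z) \<le> e" if "z \<in> frontier U" for z
      using fr that qe unfolding im by auto
  qed (rule U0)
qed

text \<open>Koebe's reflection trick: reflecting in a line through the origin squares the value at the
  origin and doubles the angle swept by the curve.\<close>
lemma koebe_angle: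
  assumes "f holomorphic_on ball 0 1"
    and "\<And>z. z \<in> ball 0 1 \<Longrightarrow> norm (f z) \<le> M"
    and "path q" "Im (pathfinish q) = Im (pathstart q) + 2 * pi / 2 ^ k"
    and "k = 0 \<Longrightarrow> Re (pathfinish q) = Re (pathstart q)"
    and "\<And>\<zeta>. \<zeta> \<in> path_image q \<Longrightarrow> Re \<zeta> < 0 \<and> norm (f (exp \<zeta>)) \<le> e"
  shows "norm (f 0) ^ (2 ^ k) \<le> e * M ^ (2 ^ k - 1)"
  using assms
proof (induction k arbitrary: f M q e)
  case 0
  have "pathfinish q = pathstart q + 2 * of_real pi * \<i>"
    using 0 by (simp add: complex_eq_iff)
  from norm_le_on_loop_around_0[OF 0(1,3) this 0(6)] show ?case by simp
next
  case (Suc k)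
  define b where "b = Im (pathfinish q)"
  \<comment> \<open>In logarithmic coordinates the reflection is in the horizontal line through the
    endpoint of \<open>q\<close>. Following \<open>q\<close> by its reflected reverse doubles the
    angle and makes the real parts of the two ends equal; hence equality of real parts has to be
    assumed only for \<open>k = 0\<close>.\<close>
  define r where "r = (\<lambda>\<zeta>. cnj \<zeta> + 2 * of_real b * \<i>)"
  define u where "u = exp (2 * of_real b * \<i>)"
  \<comment> \<open>The two conjugations cancel, so the reflected factor is holomorphic. On either
    half of \<open>Q\<close> one factor is at most \<open>e\<close> and the other at most
    \<open>M\<close>; on the disc the product is at most \<open>M * M\<close>.\<close>
  define f1 where "f1 = (\<lambda>z. f z * cnj (f (u * cnj z)))"
  define Q where "Q = q +++ reversepath (r \<circ> q)"
  have nu: "norm u = 1" by (simp add: u_def)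
  have expr: "exp (r \<zeta>) = u * cnj (exp \<zeta>)" for \<zeta>
    by (simp add: r_def u_def exp_add exp_cnj)
  have rr: "r (r \<zeta>) = \<zeta>" for \<zeta> by (simp add: r_def)
  have Rer: "Re (r \<zeta>) = Re \<zeta>" for \<zeta> by (simp add: r_def)
  have rf: "r (pathfinish q) = pathfinish q"
    by (simp add: r_def b_def complex_eq_iff)
  have pr: "path (r \<circ> q)"
    unfolding r_def by (intro path_continuous_image Suc.prems continuous_intros)
  have jn: "pathfinish q = pathstart (reversepath (r \<circ> q))"
    by (simp add: pathfinish_compose rf)
  have Mball: "norm (f z) \<le> M" if "norm z < 1" for z using Suc.prems(2) that by simp
  have M0: "M \<ge> 0" using order_trans[OF norm_ge_zero Mball[of 0]] by simp
  have "q 0 \<in> path_image q" by (metis pathstart_def pathstart_in_path_image)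
  then have e0: "e \<ge> 0" using order_trans[OF norm_ge_zero conjunct2[OF Suc.prems(6)]] by blast
  have "norm (f1 0) ^ (2 ^ k) \<le> (e * M) * (M * M) ^ (2 ^ k - 1)"
  proof (rule Suc.IH[where q = Q])
    have "(cnj \<circ> (\<lambda>z. f (u * z)) \<circ> cnj) holomorphic_on ball 0 1"
    proof (rule holomorphic_on_compose_cnj_cnj)
      have "cnj ` ball 0 1 = ball 0 1"
        by (auto intro: image_eqI[of _ cnj "cnj _"])
      moreover have "(\<lambda>z. f (u * z)) holomorphic_on ball 0 1"
        by (rule holomorphic_on_compose_gen[OF _ Suc.prems(1), unfolded o_def])
          (auto intro!: holomorphic_intros simp: norm_mult nu)
      ultimately show "(\<lambda>z. f (u * z)) holomorphic_on cnj ` ball 0 1" by simp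
    qed simp
    then have "(\<lambda>z. cnj (f (u * cnj z))) holomorphic_on ball 0 1"
      by (simp add: o_def)
    with Suc.prems(1) show "f1 holomorphic_on ball 0 1"
      unfolding f1_def by (intro holomorphic_intros)
    show "norm (f1 z) \<le> M * M" if "z \<in> ball 0 1" for z
      unfolding f1_def norm_mult complex_mod_cnj using that M0
      by (intro mult_mono Mball) (auto simp: norm_mult nu)
    show "path Q" unfolding Q_def using Suc.prems(3) pr jn by simp
    show "Im (pathfinish Q) = Im (pathstart Q) + 2 * pi / 2 ^ k"
      using Suc.prems(4) by (simp add: Q_def pathstart_compose r_def b_def field_simps)
    show "Re (pathfinish Q) = Re (pathstart Q)"
      by (simp add: Q_def pathstart_compose Rer)
    show "Re \<zeta> < 0 \<and> norm (f1 (exp \<zeta>)) \<le> e * M" if "\<zeta> \<in> path_image Q" for \<zeta>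
    proof -
      have "\<zeta> \<in> path_image q \<or> \<zeta> \<in> r ` path_image q"
        using that jn by (auto simp: Q_def path_image_join path_image_compose)
      then show ?thesis
      proof
        assume z: "\<zeta> \<in> path_image q"
        then have "norm (f1 (exp \<zeta>)) \<le> e * M"
          unfolding f1_def norm_mult complex_mod_cnj expr[symmetric] using Suc.prems(6)[OF z] e0
          by (intro mult_mono Mball) (auto simp: Rer)
        then show ?thesis using Suc.prems(6)[OF z] by simp
      next
        assume "\<zeta> \<in> r ` path_image q"
        then obtain x where x: "x \<in> path_image q" "\<zeta> = r x" by auto
        have "norm (f1 (exp \<zeta>)) \<le> M * e"
          unfolding f1_def norm_mult complex_mod_cnj expr[symmetric] using Suc.prems(6)[OF x(1)] e0 M0
          by (intro mult_mono Mball) (auto simp: Rer x rr)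
        then show ?thesis using Suc.prems(6)[OF x(1)] x by (simp add: Rer mult.commute)
      qed
    qed
  qed
  moreover have "norm (f1 0) = norm (f 0) ^ 2"
    by (simp add: f1_def norm_mult power2_eq_square)
  moreover have "(e * M) * (M * M) ^ (2 ^ k - 1) = e * M ^ (2 ^ Suc k - 1)"
  proof -
    obtain j :: nat where j: "2 ^ k = Suc j"
      by (metis not0_implies_Suc power_not_zero zero_neq_numeral)
    have "M * (M * M) ^ j = M ^ Suc (2 * j)"
      by (simp add: power_mult power2_eq_square)
    then show ?thesis by (simp add: j)
  qed
  moreover have "norm (f 0) ^ 2 ^ Suc k = (norm (f 0) ^ 2) ^ 2 ^ k"
    by (simp add: power_mult)
  ultimately show ?case by (simp only:)
qed

lemma norm_exp_i_diff_le:
  fixes a b :: real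
  shows "norm (exp (\<i> * of_real a) - exp (\<i> * of_real b)) \<le> \<bar>a - b\<bar>"
proof -
  have "exp (\<i> * of_real a) - exp (\<i> * of_real b) = exp (\<i> * of_real b) * (exp (\<i> * of_real (a - b)) - 1)"
    by (simp add: algebra_simps flip: exp_add)
  then have "norm (exp (\<i> * of_real a) - exp (\<i> * of_real b)) = 2 * \<bar>sin ((a - b) / 2)\<bar>"
    by (simp only: norm_mult dist_exp_i_1 norm_exp_i_times)
  also have "\<dots> \<le> \<bar>a - b\<bar>"
    using abs_sin_x_le_abs_x[of "(a - b) / 2"] by simp
  finally show ?thesis .
qed

text \<open>A curve on which \<open>f\<close> is small avoids 0 and has a continuous argument. If
  the argument changed too much, a subpath would sweep exactly 2 pi / 2^K, against
  \<open>koebe_angle\<close>.\<close>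

lemma koebe:
  fixes d :: real
  assumes holf: "f holomorphic_on ball 0 1"
    and M: "\<And>z. z \<in> ball 0 1 \<Longrightarrow> norm (f z) \<le> M"
    and f0: "f 0 \<noteq> 0" and d: "d > 0"
  shows "\<exists>e>0. \<forall>\<gamma>. path \<gamma> \<longrightarrow> path_image \<gamma> \<subseteq> ball 0 1 \<longrightarrow> (\<forall>z\<in>path_image \<gamma>. norm (f z) \<le> e)
       \<longrightarrow> norm (sgn (pathfinish \<gamma>) - sgn (pathstart \<gamma>)) < d"
proof -
  have M0: "M > 0" using M[of 0] f0 by (auto intro: less_le_trans[of 0 "norm (f 0)"])
  obtain k where k: "2 * pi / d < 2 ^ k"
    using real_arch_pow[of 2 "2 * pi / d"] by auto
  define K where "K = Suc k"
  have K: "2 * pi / 2 ^ K < d"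
  proof -
    have "2 * pi / 2 ^ K \<le> 2 * pi / 2 ^ k" by (simp add: K_def field_simps)
    also have "\<dots> < d" using k d by (simp add: field_simps)
    finally show ?thesis .
  qed
  \<comment> \<open>The first bound keeps the curve away from 0, where \<open>f\<close> is larger;
    the second makes the inequality of \<open>koebe_angle\<close> fail.\<close>
  define e where "e = min (norm (f 0) / 2) (norm (f 0) ^ (2 ^ K) / (2 * M ^ (2 ^ K - 1)))"
  have e0: "e > 0" using f0 M0 by (simp add: e_def)
  have "e * M ^ (2 ^ K - 1) \<le> norm (f 0) ^ (2 ^ K) / (2 * M ^ (2 ^ K - 1)) * M ^ (2 ^ K - 1)"
    using M0 by (intro mult_right_mono) (auto simp: e_def)
  also have "\<dots> = norm (f 0) ^ (2 ^ K) / 2" using M0 by (simp add: field_simps)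
  also have "\<dots> < norm (f 0) ^ (2 ^ K)" using f0 by simp
  finally have eM: "e * M ^ (2 ^ K - 1) < norm (f 0) ^ (2 ^ K)" .
  have ef: "e < norm (f 0)" using f0 by (simp add: e_def min_less_iff_disj)
  show ?thesis
  proof (intro exI[of _ e] conjI allI impI e0)
    fix \<gamma> assume p: "path \<gamma>" and pb: "path_image \<gamma> \<subseteq> ball 0 1"
      and pe: "\<forall>z\<in>path_image \<gamma>. norm (f z) \<le> e"
    have n0: "0 \<notin> path_image \<gamma>" using pe ef by fastforce
    have "continuous_on {0..1} \<gamma>" using p by (simp add: path_def)
    moreover have "contractible {0..1::real}" by (simp add: convex_imp_contractible)
    moreover have "\<gamma> t \<noteq> 0" if "t \<in> {0..1}" for t
      using n0 that by (auto simp: path_image_def)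
    ultimately obtain q where q: "continuous_on {0..1} q" "\<And>t. t \<in> {0..1} \<Longrightarrow> \<gamma> t = exp (q t)"
      using continuous_logarithm_on_contractible by metis
    have pq: "path q" using q by (simp add: path_def)
    have qe: "Re \<zeta> < 0 \<and> norm (f (exp \<zeta>)) \<le> e" if "\<zeta> \<in> path_image q" for \<zeta>
    proof -
      obtain t where t: "t \<in> {0..1}" "\<zeta> = q t" using \<open>\<zeta> \<in> path_image q\<close> by (auto simp: path_image_def)
      then have "exp \<zeta> \<in> path_image \<gamma>" using q(2) by (auto simp: path_image_def)
      then show ?thesis using pb pe by auto
    qed
    have no: False if st: "s \<in> {0..1}" "t \<in> {0..1}" and "Im (q t) = Im (q s) + 2 * pi / 2 ^ K" for s t
    proof -
      have "norm (f 0) ^ (2 ^ K) \<le> e * M ^ (2 ^ K - 1)"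
      proof (rule koebe_angle[OF holf M, where q = "subpath s t q"])
        show "path (subpath s t q)" using pq st by simp
        show "Re \<zeta> < 0 \<and> norm (f (exp \<zeta>)) \<le> e" if "\<zeta> \<in> path_image (subpath s t q)" for \<zeta>
          using path_image_subpath_subset[OF st] that qe by blast
      qed (use that in \<open>auto simp: K_def\<close>)
      then show False using eM by simp
    qed
    have "\<bar>Im (q 1) - Im (q 0)\<bar> < 2 * pi / 2 ^ K"
    proof (rule ccontr)
      assume *: "\<not> \<bar>Im (q 1) - Im (q 0)\<bar> < 2 * pi / 2 ^ K"
      have cI: "continuous_on {0..1} (\<lambda>t. Im (q t))" using q(1) by (intro continuous_intros)
      have pos: "0 < 2 * pi / 2 ^ K" by simp
      show False
      proof (cases "Im (q 1) \<ge> Im (q 0)")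
        case True
        then have "\<exists>t\<ge>0. t \<le> 1 \<and> Im (q t) = Im (q 0) + 2 * pi / 2 ^ K"
          using * pos by (intro IVT' cI) auto
        then show False using no[of 0] by auto
      next
        case False
        then have "\<exists>t\<ge>0. t \<le> 1 \<and> Im (q t) = Im (q 0) - 2 * pi / 2 ^ K"
          using * pos by (intro IVT2' cI) auto
        \<comment> \<open>Here the argument decreases, so the sweeping subpath is run backwards and
          ends at parameter 0.\<close>
        then show False using no[of _ 0] by force
      qed
    qed
    then have less: "\<bar>Im (q 1) - Im (q 0)\<bar> < d" using K by simp
    have "sgn (exp z) = cis (Im z)" for z :: complex
      by (simp add: sgn_eq exp_eq_polar norm_mult)
    then have sg: "sgn (exp z) = exp (\<i> * of_real (Im z))" for z :: complex
      by (simp add: cis_conv_exp)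
    have "norm (sgn (\<gamma> 1) - sgn (\<gamma> 0)) = norm (exp (\<i> * of_real (Im (q 1))) - exp (\<i> * of_real (Im (q 0))))"
      using q(2) by (simp add: sg)
    also have "\<dots> \<le> \<bar>Im (q 1) - Im (q 0)\<bar>"
      by (rule norm_exp_i_diff_le)
    finally show "norm (sgn (pathfinish \<gamma>) - sgn (pathstart \<gamma>)) < d"
      using less by (simp add: pathstart_def pathfinish_def)
  qed
qed

section \<open>Jordan domains near the boundary\<close>

lemma connected_subset_ball:
  fixes w :: "'a::euclidean_space"
  assumes "connected U" "U \<inter> sphere w e = {}" "x \<in> U" "x \<in> ball w e"
  shows "U \<subseteq> ball w e"
proof -
  have "ball w e \<inter> U = {} \<or> (- cball w e) \<inter> U = {}"
    by (rule connectedD[OF assms(1)]) (use assms(2) in \<open>auto simp: not_less\<close>)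
  then show ?thesis using assms by force
qed

lemma connected_subset_inside:
  assumes "connected U" "U \<inter> S = {}" "x \<in> U" "x \<in> inside S"
  shows "U \<subseteq> inside S"
proof
  fix y assume "y \<in> U"
  then have "connected_component (- S) x y"
    using assms by (auto simp: connected_component_def)
  then show "y \<in> inside S" using inside_same_component assms(4) by blast
qed

text \<open>The loop is reparametrised to start at \<open>w\<close>; a short initial and a short
  final piece are cut off, and both lie near \<open>w\<close> by continuity.\<close>

lemma loop_far_arc:
  fixes c :: "real \<Rightarrow> 'a::euclidean_space"
  assumes c: "simple_path c" "pathfinish c = pathstart c" and w: "w \<in> path_image c" and e: "e > 0"
  obtains B where "compact B" "connected B" "B \<subseteq> path_image c" "w \<notin> B" "path_image c - B \<subseteq> ball w e"
proof -
  obtain a where a: "a \<in> {0..1}" "c a = w" using w by (auto simp: path_image_def)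
  define g where "g = shiftpath a c"
  have g: "simple_path g" "pathfinish g = pathstart g" "path_image g = path_image c"
    using a c by (auto simp: g_def simple_path_shiftpath pathfinish_shiftpath pathstart_shiftpath path_image_shiftpath)
  have g0: "g 0 = w" using a by (simp add: g_def shiftpath_def)
  have g1: "g 1 = w" using g(2) g0 by (simp add: pathstart_def pathfinish_def)
  have contg: "continuous_on {0..1} g" using g(1) simple_path_def path_def by blast
  obtain d0 where d0: "d0 > 0" "\<And>t. t \<in> {0..1} \<Longrightarrow> dist t 0 < d0 \<Longrightarrow> dist (g t) (g 0) < e"
    using contg e unfolding continuous_on_iff by (metis atLeastAtMost_iff order_refl zero_le_one)
  obtain d1 where d1: "d1 > 0" "\<And>t. t \<in> {0..1} \<Longrightarrow> dist t 1 < d1 \<Longrightarrow> dist (g t) (g 1) < e"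
    using contg e unfolding continuous_on_iff by (metis atLeastAtMost_iff order_refl zero_le_one)
  define d where "d = min (1/3) (min d0 d1)"
  have d: "0 < d" "d \<le> 1/3" "d \<le> d0" "d \<le> d1" using d0 d1 by (auto simp: d_def)
  have sub: "{d..1-d} \<subseteq> {0..1}" using d by auto
  show thesis
  proof (rule that[of "g ` {d..1-d}"])
    show "compact (g ` {d..1-d})" "connected (g ` {d..1-d})"
      using continuous_on_subset[OF contg sub]
      by (auto intro: compact_continuous_image connected_continuous_image)
    show "g ` {d..1-d} \<subseteq> path_image c"
      using sub g(3) by (auto simp: path_image_def)
    show "w \<notin> g ` {d..1-d}"
    proof
      assume "w \<in> g ` {d..1-d}"
      then obtain t where t: "d \<le> t" "t \<le> 1 - d" "g t = g 0" using g0 by auto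
      then have "t = 0 \<or> t = 1"
        using g(1) d unfolding simple_path_def loop_free_def by force
      then show False using t d by auto
    qed
    show "path_image c - g ` {d..1-d} \<subseteq> ball w e"
    proof
      fix x assume "x \<in> path_image c - g ` {d..1-d}"
      then have x: "x \<in> g ` {0..1}" "x \<notin> g ` {d..1-d}"
        using g(3) by (simp_all add: path_image_def)
      then obtain t where t: "t \<in> {0..1}" "x = g t" "t \<notin> {d..1-d}"
        by blast
      then have "dist t 0 < d0 \<or> dist t 1 < d1" using d by (auto simp: dist_real_def)
      then show "x \<in> ball w e"
        using d0(2)[OF t(1)] d1(2)[OF t(1)] t g0 g1 by (auto simp: dist_commute)
    qed
  qed
qed

text \<open>The arc of the curve away from \<open>w\<close> meets the curve in a connected set even after a small
  circle about \<open>w\<close> is added, so Janiszewski's theorem applies.\<close>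
lemma inside_uniformly_locally_connected:
  fixes c :: "real \<Rightarrow> complex"
  assumes c: "simple_path c" "pathfinish c = pathstart c" and w: "w \<in> path_image c" and e: "e > 0"
  shows "\<exists>d>0. \<forall>x\<in>inside (path_image c) \<inter> ball w d. \<forall>y\<in>inside (path_image c) \<inter> ball w d.
       \<exists>\<gamma>. path \<gamma> \<and> path_image \<gamma> \<subseteq> inside (path_image c) \<inter> ball w e \<and> pathstart \<gamma> = x \<and> pathfinish \<gamma> = y"
proof -
  obtain B where B: "compact B" "connected B" "B \<subseteq> path_image c" "w \<notin> B" "path_image c - B \<subseteq> ball w e"
    using loop_far_arc[OF c w e] by blast
  obtain d0 where d0: "d0 > 0" "\<And>x. x \<in> B \<Longrightarrow> d0 \<le> dist w x"
    using separate_point_closed[of B w] B compact_imp_closed by blast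
  define d where "d = min d0 e"
  have d: "d > 0" "d \<le> d0" "d \<le> e" using d0 e by (auto simp: d_def)
  define S where "S = path_image c"
  \<comment> \<open>The rest of the curve lies in the open ball, hence off the circle, so the curve
    meets \<open>T\<close> exactly in the connected set \<open>B\<close>.\<close>
  define T where "T = B \<union> sphere w e"
  have cS: "compact S" unfolding S_def using c simple_path_imp_path compact_path_image by blast
  have clT: "closed T" unfolding T_def by (rule closed_Un[OF compact_imp_closed[OF B(1)] closed_sphere])
  have "S \<inter> T = B" using B(3,5) by (auto simp: S_def T_def)
  then have conn: "connected (S \<inter> T)" using B by simp
  have J: "open (inside S)" "connected (inside S)"
    using Jordan_inside_outside[OF c] by (auto simp: S_def)
  have disj: "inside S \<subseteq> - S" using inside_no_overlap by blast
  show ?thesis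
  proof (intro exI[of _ d] conjI ballI d(1))
    fix x y assume x: "x \<in> inside (path_image c) \<inter> ball w d" and y: "y \<in> inside (path_image c) \<inter> ball w d"
    \<comment> \<open>Neither set separates \<open>x\<close> from \<open>y\<close> by itself: the
      inside of the curve joins them off \<open>S\<close>, and the small ball joins them off
      \<open>T\<close>.\<close>
    have "connected_component (- S) x y"
      unfolding connected_component_def
      using J x y disj by (intro exI[of _ "inside S"]) (auto simp: S_def)
    moreover have "connected_component (- T) x y"
      unfolding connected_component_def
    proof (intro exI[of _ "ball w d"] conjI)
      show "ball w d \<subseteq> - T"
        using d by (auto simp: T_def dest: d0(2))
    qed (use x y in auto)
    ultimately have cc: "connected_component (- (S \<union> T)) x y"
      using Janiszewski[OF cS clT conn] by blast
    \<comment> \<open>A component that contains \<open>x\<close> and meets neither the curve nor the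
      circle can leave neither the inside nor the ball; being open, it is path connected.\<close>
    define U where "U = connected_component_set (- (S \<union> T)) x"
    have "closed (S \<union> T)" using cS clT compact_imp_closed by blast
    then have oU: "open U" unfolding U_def by (intro open_connected_component open_Compl)
    have cU: "connected U" by (simp add: U_def)
    have Usub: "U \<subseteq> - (S \<union> T)" unfolding U_def by (rule connected_component_subset)
    have xU: "x \<in> U" "y \<in> U"
      using cc connected_component_refl connected_component_in(1)[OF cc] by (auto simp: U_def)
    have "path_connected U" using oU cU by (simp add: connected_open_path_connected)
    then obtain \<gamma> where \<gamma>: "path \<gamma>" "path_image \<gamma> \<subseteq> U" "pathstart \<gamma> = x" "pathfinish \<gamma> = y"
      using xU unfolding path_connected_def by blast
    have "U \<subseteq> inside S"
      by (rule connected_subset_inside[OF cU _ xU(1)]) (use Usub x in \<open>auto simp: S_def\<close>)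
    moreover have "U \<subseteq> ball w e"
      by (rule connected_subset_ball[OF cU _ xU(1)]) (use Usub x d in \<open>auto simp: T_def\<close>)
    ultimately show "\<exists>\<gamma>. path \<gamma> \<and> path_image \<gamma> \<subseteq> inside (path_image c) \<inter> ball w e \<and> pathstart \<gamma> = x \<and> pathfinish \<gamma> = y"
      using \<gamma> unfolding S_def by blast
  qed
qed

text \<open>The points \<open>a\<close> and \<open>b\<close> cut the loop into two arcs. If
  \<open>C\<close> contains one of them, any inner point of that arc has positive distance from the
  other arc. Otherwise \<open>C\<close> misses a point on each, and these two points separate
  \<open>a\<close> from \<open>b\<close> on the loop.\<close>

lemma connected_subset_loop_interior:
  fixes c :: "real \<Rightarrow> 'a::euclidean_space"
  assumes c: "simple_path c" "pathfinish c = pathstart c"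
    and C: "connected C" "C \<subseteq> path_image c" "a \<in> C" "b \<in> C" "a \<noteq> b"
  obtains w r where "w \<in> path_image c" "r > 0" "path_image c \<inter> ball w r \<subseteq> C"
proof -
  obtain u d where ud: "arc u" "arc d" "pathstart u = a" "pathfinish u = b"
      "pathstart d = b" "pathfinish d = a"
      "path_image u \<inter> path_image d = {a,b}" "path_image u \<union> path_image d = path_image c"
    using exists_double_arc[OF c, of a b] C by blast
  note found = that
  have arcs: thesis if v: "arc v" "arc v'" "path_image v \<inter> path_image v' = {a,b}" "path_image v \<union> path_image v' = path_image c"
      "path_image v \<subseteq> C" for v v'
  proof -
    have "\<exists>w. w \<in> path_image v \<and> w \<noteq> a \<and> w \<noteq> b"
    proof -
      have inj: "inj_on v {0..1}" using v(1) by (simp add: arc_def)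
      have "\<not> {v 0, v (1/2), v 1} \<subseteq> {a, b}"
      proof
        assume *: "{v 0, v (1/2), v 1} \<subseteq> {a, b}"
        have "v 0 \<noteq> v (1/2)" "v 1 \<noteq> v (1/2)" "v 0 \<noteq> v 1"
          using inj_onD[OF inj, of 0 "1/2"] inj_onD[OF inj, of 1 "1/2"] inj_onD[OF inj, of 0 1] by auto
        then show False using * by auto
      qed
      then show ?thesis by (auto simp: path_image_def)
    qed
    then obtain w where w: "w \<in> path_image v" "w \<noteq> a" "w \<noteq> b" by blast
    then have nw: "w \<notin> path_image v'" using v by blast
    have "closed (path_image v')" using v(2) by (simp add: closed_arc_image)
    then obtain r where r: "r > 0" "\<And>x. x \<in> path_image v' \<Longrightarrow> r \<le> dist w x"
      using separate_point_closed[OF _ nw] by auto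
    show thesis
    proof (rule found[of w r])
      show "path_image c \<inter> ball w r \<subseteq> C"
      proof
        fix x assume x: "x \<in> path_image c \<inter> ball w r"
        then have "x \<notin> path_image v'" using r(2)[of x] by auto
        then show "x \<in> C" using x v(4,5) by blast
      qed
    qed (use w v r in auto)
  qed
  show thesis
  proof (cases "path_image u \<subseteq> C \<or> path_image d \<subseteq> C")
    case True
    then show ?thesis using arcs[of u d] arcs[of d u] ud by (auto simp: Int_commute Un_commute)
  next
    case False
    then obtain p q where p: "p \<in> path_image u" "p \<notin> C" and q: "q \<in> path_image d" "q \<notin> C" by blast
    obtain s where s: "s \<in> {0..1}" "p = u s" using p by (auto simp: path_image_def)
    obtain t where t: "t \<in> {0..1}" "q = d t" using q by (auto simp: path_image_def)
    \<comment> \<open>Cutting at the missing points \<open>p\<close> and \<open>q\<close> leaves a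
      closed piece around \<open>a\<close> and one around \<open>b\<close>; \<open>d\<close> runs
      from \<open>b\<close> to \<open>a\<close>, so its final part belongs to the piece around
      \<open>a\<close>.\<close>
    define A where "A = u ` {0..s} \<union> d ` {t..1}"
    define B where "B = u ` {s..1} \<union> d ` {0..t}"
    have cu: "continuous_on {0..1} u" "inj_on u {0..1}" and cd: "continuous_on {0..1} d" "inj_on d {0..1}"
      using ud by (auto simp: arc_def path_def)
    have "compact A" "compact B" unfolding A_def B_def using s t
      by (auto intro!: compact_Un compact_continuous_image continuous_on_subset[OF cu(1)] continuous_on_subset[OF cd(1)])
    then have cl: "closed A" "closed B" by (auto simp: compact_imp_closed)
    have un: "C \<subseteq> A \<union> B"
    proof -
      have "{0..s} \<union> {s..1} = {0..1}" "{t..1} \<union> {0..t} = {0..1}" using s t by auto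
      then have "A \<union> B = path_image u \<union> path_image d"
        unfolding A_def B_def path_image_def by (metis image_Un Un_assoc Un_left_commute)
      then show ?thesis using C ud by simp
    qed
    have ab: "u 0 = a" "u 1 = b" "d 0 = b" "d 1 = a" using ud by (auto simp: pathstart_def pathfinish_def)
    have ud0: "u x = d y \<Longrightarrow> x \<in> {0..1} \<Longrightarrow> y \<in> {0..1} \<Longrightarrow> (x = 0 \<and> y = 1) \<or> (x = 1 \<and> y = 0)" for x y
    proof -
      assume e: "u x = d y" and xy: "x \<in> {0..1}" "y \<in> {0..1}"
      have "u x \<in> path_image u" "d y \<in> path_image d" using xy by (auto simp: path_image_def)
      then have "u x \<in> path_image u \<inter> path_image d" using e by simp
      then have "u x = a \<or> u x = b" using ud(7) by blast
      then show ?thesis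
        using e xy ab C(5) cu(2) cd(2) unfolding inj_on_def
        by (metis atLeastAtMost_iff order_refl zero_le_one)
    qed
    have sab: "s \<noteq> 0" "s \<noteq> 1" "t \<noteq> 0" "t \<noteq> 1" using p q s t ab C by auto
    have int: "A \<inter> B \<subseteq> {p, q}"
    proof
      fix x assume x: "x \<in> A \<inter> B"
      have 1: "x = p" if "x \<in> u ` {0..s}" "x \<in> u ` {s..1}"
      proof -
        obtain i j where "i \<in> {0..s}" "j \<in> {s..1}" "x = u i" "x = u j" using \<open>x \<in> u ` {0..s}\<close> \<open>x \<in> u ` {s..1}\<close> by blast
        moreover then have "i = j" using cu(2) s unfolding inj_on_def by auto
        ultimately show ?thesis using s by auto
      qed
      have 2: "x = q" if "x \<in> d ` {t..1}" "x \<in> d ` {0..t}"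
      proof -
        obtain i j where "i \<in> {t..1}" "j \<in> {0..t}" "x = d i" "x = d j" using \<open>x \<in> d ` {t..1}\<close> \<open>x \<in> d ` {0..t}\<close> by blast
        moreover then have "i = j" using cd(2) t unfolding inj_on_def by auto
        ultimately show ?thesis using t by auto
      qed
      have 3: False if xu: "x \<in> u ` {0..s}" and xd: "x \<in> d ` {0..t}"
      proof -
        obtain i where i: "i \<in> {0..s}" "x = u i" using xu by blast
        obtain j where j: "j \<in> {0..t}" "x = d j" using xd by blast
        have "u i = d j" using i j by simp
        with i j show False using ud0[of i j] s t sab by auto
      qed
      have 4: False if xd: "x \<in> d ` {t..1}" and xu: "x \<in> u ` {s..1}"
      proof -
        obtain i where i: "i \<in> {s..1}" "x = u i" using xu by blast
        obtain j where j: "j \<in> {t..1}" "x = d j" using xd by blast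
        have "u i = d j" using i j by simp
        with i j show False using ud0[of i j] s t sab by auto
      qed
      show "x \<in> {p, q}" using x 1 2 3 4 unfolding A_def B_def by blast
    qed
    have "a \<in> A" unfolding A_def using ab s by (metis UnI1 atLeastAtMost_iff image_eqI order_refl)
    moreover have "b \<in> B" unfolding B_def using ab s by (metis UnI1 atLeastAtMost_iff image_eqI order_refl)
    ultimately show ?thesis
      using C(1,3,4) un int p q cl unfolding connected_closed by blast
  qed
qed

section \<open>The boundary correspondence of the Riemann map\<close>

locale jordan_riemann =
  fixes c :: "real \<Rightarrow> complex" and f g :: "complex \<Rightarrow> complex"
  assumes c: "simple_path c" "pathfinish c = pathstart c"
    and holf: "f holomorphic_on ball 0 1"
    and holg: "g holomorphic_on inside (path_image c)"
    and fim: "z \<in> ball 0 1 \<Longrightarrow> f z \<in> inside (path_image c)"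
    and gim: "x \<in> inside (path_image c) \<Longrightarrow> g x \<in> ball 0 1"
    and gf: "z \<in> ball 0 1 \<Longrightarrow> g (f z) = z"
    and fg: "x \<in> inside (path_image c) \<Longrightarrow> f (g x) = x"
begin

abbreviation "G \<equiv> inside (path_image c)"

lemma G: "open G" "connected G" "bounded G" "frontier G = path_image c" "G \<inter> path_image c = {}"
  using Jordan_inside_outside[OF c] inside_no_overlap[of "path_image c"] by auto

lemma G_disj: "x \<in> G \<Longrightarrow> x \<notin> path_image c"
  using G(5) by blast

lemma clG: "closure G = G \<union> path_image c"
  using closure_Un_frontier[of G] G by simp

lemma compact_clG: "compact (closure G)"
  using G compact_closure by blast

text \<open>Properness: the image of a smaller closed disc under \<open>f\<close> is compact in the
  domain and so keeps a distance from the curve.\<close>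

lemma g_near_boundary:
  assumes w: "w \<in> path_image c" and r: "0 \<le> r" "r < 1"
  obtains d where "d > 0" "\<And>x. x \<in> G \<inter> ball w d \<Longrightarrow> norm (g x) > r"
proof -
  have "continuous_on (cball 0 r) f"
    by (rule continuous_on_subset[OF holomorphic_on_imp_continuous_on[OF holf]]) (use r in auto)
  then have "compact (f ` cball 0 r)" by (simp add: compact_continuous_image)
  then have cl: "closed (f ` cball 0 r)" by (rule compact_imp_closed)
  have "f z \<noteq> w" if "z \<in> cball 0 r" for z
    using fim[of z] G_disj w r that by auto
  then have "w \<notin> f ` cball 0 r" by blast
  from separate_point_closed[OF cl this]
  obtain d where d: "d > 0" "\<And>x. x \<in> f ` cball 0 r \<Longrightarrow> d \<le> dist w x" by blast
  show thesis
  proof (rule that[OF d(1)])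
    fix x assume x: "x \<in> G \<inter> ball w d"
    show "norm (g x) > r"
    proof (rule ccontr)
      assume "\<not> norm (g x) > r"
      then have "f (g x) \<in> f ` cball 0 r" by simp
      then show False using d(2)[of x] x fg by auto
    qed
  qed
qed

lemma g_oscillation_interior:
  assumes w: "w \<in> G" and e: "e > 0"
  obtains d where "d > 0" "\<And>x y. x \<in> G \<inter> ball w d \<Longrightarrow> y \<in> G \<inter> ball w d \<Longrightarrow> dist (g x) (g y) < e"
proof -
  have "continuous_on G g" using holg holomorphic_on_imp_continuous_on by blast
  then obtain d where d: "d > 0" "\<And>x. x \<in> G \<Longrightarrow> dist x w < d \<Longrightarrow> dist (g x) (g w) < e/2"
    using w e unfolding continuous_on_iff by (meson half_gt_zero)
  show thesis
  proof (rule that[OF d(1)])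
    fix x y assume xy: "x \<in> G \<inter> ball w d" "y \<in> G \<inter> ball w d"
    have "dist (g x) (g w) < e/2" by (rule d(2)) (use xy in \<open>auto simp: dist_commute\<close>)
    moreover have "dist (g y) (g w) < e/2" by (rule d(2)) (use xy in \<open>auto simp: dist_commute\<close>)
    ultimately show "dist (g x) (g y) < e" by (rule dist_triangle_half_l)
  qed
qed

text \<open>Two points near \<open>w\<close> are joined in the domain by a path close to
  \<open>w\<close>. On its image in the disc the bounded function \<open>f - w\<close>, nonzero at
  0, is small, so Koebe's lemma makes the directions of the endpoints close; their moduli are both
  near 1.\<close>

lemma g_oscillation_boundary:
  assumes w: "w \<in> path_image c" and e: "e > 0"
  obtains d where "d > 0" "\<And>x y. x \<in> G \<inter> ball w d \<Longrightarrow> y \<in> G \<inter> ball w d \<Longrightarrow> dist (g x) (g y) < e"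
proof -
  obtain M where M: "\<And>x. x \<in> G \<Longrightarrow> norm x \<le> M" using G(3) by (auto simp: bounded_iff)
  have 1: "norm (f z - w) \<le> M + norm w" if "z \<in> ball 0 1" for z
    using norm_triangle_ineq4[of "f z" w] M[OF fim[OF that]] by linarith
  have 2: "(\<lambda>z. f z - w) holomorphic_on ball 0 1" by (intro holomorphic_intros holf)
  have 3: "f 0 - w \<noteq> 0" using fim[of 0] w G_disj by auto
  have 4: "e / 3 > 0" using e by simp
  obtain e1 where e1: "e1 > 0"
    and koe: "\<forall>\<gamma>. path \<gamma> \<longrightarrow> path_image \<gamma> \<subseteq> ball 0 1 \<longrightarrow> (\<forall>z\<in>path_image \<gamma>. norm (f z - w) \<le> e1)
       \<longrightarrow> norm (sgn (pathfinish \<gamma>) - sgn (pathstart \<gamma>)) < e / 3"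
    using koebe[OF 2 1 3 4] by metis
  obtain d1 where d1: "d1 > 0"
    "\<forall>x\<in>G \<inter> ball w d1. \<forall>y\<in>G \<inter> ball w d1.
       \<exists>\<gamma>. path \<gamma> \<and> path_image \<gamma> \<subseteq> G \<inter> ball w e1 \<and> pathstart \<gamma> = x \<and> pathfinish \<gamma> = y"
    using inside_uniformly_locally_connected[OF c w e1] by metis
  \<comment> \<open>Modulus above 1 - e/3 puts a point within e/3 of its direction; the three errors
    then add up to less than \<open>e\<close>. The maximum with 0 also makes the points
    nonzero.\<close>
  define r where "r = max 0 (1 - e / 3)"
  have r: "0 \<le> r" "r < 1" "1 - e/3 \<le> r" using e by (auto simp: r_def)
  obtain d2 where d2: "d2 > 0" "\<And>x. x \<in> G \<inter> ball w d2 \<Longrightarrow> norm (g x) > r"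
    using g_near_boundary[OF w r(1,2)] by blast
  show thesis
  proof (rule that[of "min d1 d2"])
    show "min d1 d2 > 0" using d1 d2 by simp
    fix x y assume x: "x \<in> G \<inter> ball w (min d1 d2)" and y: "y \<in> G \<inter> ball w (min d1 d2)"
    obtain \<gamma> where \<gamma>: "path \<gamma>" "path_image \<gamma> \<subseteq> G \<inter> ball w e1" "pathstart \<gamma> = x" "pathfinish \<gamma> = y"
      using bspec[OF bspec[OF d1(2), of x], of y] x y by auto
    have pg: "path (g \<circ> \<gamma>)"
      using \<gamma> holg by (intro path_continuous_image) (auto intro: holomorphic_on_imp_continuous_on holomorphic_on_subset)
    have "norm (sgn (pathfinish (g \<circ> \<gamma>)) - sgn (pathstart (g \<circ> \<gamma>))) < e / 3"
    proof (rule koe[rule_format, OF pg])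
      show "path_image (g \<circ> \<gamma>) \<subseteq> ball 0 1"
        unfolding path_image_compose using \<gamma>(2) gim by blast
      fix z assume "z \<in> path_image (g \<circ> \<gamma>)"
      then obtain u where u: "u \<in> path_image \<gamma>" "z = g u" by (auto simp: path_image_compose)
      then have "u \<in> G" "dist w u < e1" using \<gamma>(2) by auto
      then show "norm (f z - w) \<le> e1" using u fg by (simp add: dist_norm norm_minus_commute)
    qed
    then have s: "norm (sgn (g y) - sgn (g x)) < e / 3"
      using \<gamma> by (simp add: pathfinish_compose pathstart_compose)
    have near: "norm (g v - sgn (g v)) < e / 3" if "v \<in> G \<inter> ball w (min d1 d2)" for v
    proof -
      have v: "norm (g v) > r" "norm (g v) < 1" using d2(2)[of v] gim[of v] that by auto
      then have nz: "norm (g v) > 0" using r by linarith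
      then have "of_real (norm (g v)) * sgn (g v) = g v" by (simp add: sgn_eq)
      then have "g v - sgn (g v) = of_real (norm (g v) - 1) * sgn (g v)"
        by (simp add: left_diff_distrib)
      then have "norm (g v - sgn (g v)) = \<bar>norm (g v) - 1\<bar> * norm (sgn (g v))"
        by (simp only: norm_mult norm_of_real)
      also have "\<dots> = 1 - norm (g v)" using v nz by (simp add: norm_sgn)
      finally show ?thesis using v r by simp
    qed
    have "norm (g x - g y) \<le> norm (g x - sgn (g x)) + norm (sgn (g y) - sgn (g x)) + norm (g y - sgn (g y))"
    proof -
      have "g x - g y = (g x - sgn (g x)) + (sgn (g x) - sgn (g y)) + (sgn (g y) - g y)" by simp
      then have "norm (g x - g y) \<le> norm (g x - sgn (g x)) + norm (sgn (g x) - sgn (g y)) + norm (sgn (g y) - g y)"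
        by (metis norm_triangle_mono norm_triangle_ineq order_refl)
      then show ?thesis by (simp add: norm_minus_commute)
    qed
    then show "dist (g x) (g y) < e"
      using s near[OF x] near[OF y] by (simp add: dist_norm)
  qed
qed

text \<open>A Lebesgue number for the cover of the compact closure by balls on which
  \<open>g\<close> oscillates by less than \<open>e\<close>.\<close>

lemma g_uniformly_continuous: "uniformly_continuous_on G g"
  unfolding uniformly_continuous_on_def
proof (intro allI impI)
  fix e :: real assume e: "e > 0"
  define F where "F = {ball w d |w d. \<forall>x y. x \<in> G \<inter> ball w d \<longrightarrow> y \<in> G \<inter> ball w d \<longrightarrow> dist (g x) (g y) < e}"
  have "closure G \<subseteq> \<Union>F"
  proof
    fix w assume "w \<in> closure G"
    then consider "w \<in> G" | "w \<in> path_image c" using clG by auto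
    then obtain d where "d > 0" "\<forall>x y. x \<in> G \<inter> ball w d \<longrightarrow> y \<in> G \<inter> ball w d \<longrightarrow> dist (g x) (g y) < e"
      by cases (metis g_oscillation_interior[OF _ e], metis g_oscillation_boundary[OF _ e])
    then have "ball w d \<in> F" "w \<in> ball w d" unfolding F_def by auto
    then show "w \<in> \<Union>F" by blast
  qed
  moreover have "open B" if "B \<in> F" for B using that by (auto simp: F_def)
  ultimately obtain \<epsilon> where \<epsilon>: "\<epsilon> > 0" "\<And>x. x \<in> closure G \<Longrightarrow> \<exists>B\<in>F. ball x \<epsilon> \<subseteq> B"
    using Heine_Borel_lemma[OF compact_clG] by metis
  show "\<exists>d>0. \<forall>x\<in>G. \<forall>x'\<in>G. dist x' x < d \<longrightarrow> dist (g x') (g x) < e"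
  proof (intro exI[of _ \<epsilon>] conjI ballI impI \<epsilon>(1))
    fix x x' assume x: "x \<in> G" "x' \<in> G" "dist x' x < \<epsilon>"
    then have "x \<in> closure G" using clG by blast
    then obtain B where B: "B \<in> F" "ball x \<epsilon> \<subseteq> B" using \<epsilon>(2) by blast
    have "x \<in> ball x \<epsilon>" "x' \<in> ball x \<epsilon>" using x \<epsilon>(1) by (auto simp: dist_commute)
    then have "x \<in> B" "x' \<in> B" using B by auto
    then show "dist (g x') (g x) < e" using B(1) x(1,2) unfolding F_def by blast
  qed
qed

end

text \<open>The inverse map \<open>g\<close> is the one extended, since its uniform continuity is
  what Koebe's lemma yields. The extension \<open>h\<close> is onto the closed disc by compactness;
  the difficulty is its injectivity on the curve, and \<open>f\<close> is extended by inverting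
  \<open>h\<close>.\<close>

locale jordan_riemann_ext = jordan_riemann +
  fixes h :: "complex \<Rightarrow> complex"
  assumes conth: "continuous_on (closure G) h" and hg: "x \<in> G \<Longrightarrow> h x = g x"
begin

lemma h_le: "x \<in> closure G \<Longrightarrow> norm (h x) \<le> 1"
proof -
  have "h ` G \<subseteq> cball 0 1" using hg gim by force
  then have "h ` closure G \<subseteq> cball 0 1"
    by (intro image_closure_subset conth) auto
  then show "x \<in> closure G \<Longrightarrow> norm (h x) \<le> 1" by auto
qed

lemma h_boundary:
  assumes w: "w \<in> path_image c"
  shows "norm (h w) = 1"
proof (rule ccontr)
  assume "norm (h w) \<noteq> 1"
  then have l: "norm (h w) < 1" using h_le[of w] w clG by auto
  define r where "r = (norm (h w) + 1) / 2"
  have r: "0 \<le> r" "r < 1" "norm (h w) < r"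
    unfolding r_def using l norm_ge_zero[of "h w"] by auto
  obtain d where d: "d > 0" "\<And>x. x \<in> G \<inter> ball w d \<Longrightarrow> norm (g x) > r"
    using g_near_boundary[OF w r(1,2)] by blast
  have wcl: "w \<in> closure G" using w clG by blast
  then obtain d1 where d1: "d1 > 0" "\<And>x. x \<in> closure G \<Longrightarrow> dist x w < d1 \<Longrightarrow> dist (h x) (h w) < r - norm (h w)"
    using conth r(3) unfolding continuous_on_iff by (meson diff_gt_0_iff_gt)
  have "min d d1 > 0" using d d1 by simp
  then obtain x where x: "x \<in> G" "dist x w < min d d1"
    using wcl closure_approachable by blast
  have "norm (g x) > r" by (rule d(2)) (use x in \<open>auto simp: dist_commute\<close>)
  moreover have "dist (h x) (h w) < r - norm (h w)"
    by (rule d1(2)) (use x clG in auto)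
  then have "norm (h x) < r"
    using norm_triangle_ineq2[of "h x" "h w"] by (simp add: dist_norm)
  ultimately show False using hg x by simp
qed

text \<open>The product of \<open>h - a\<close> over the rotations about a point \<open>w\<^sub>0\<close> near \<open>w\<close> vanishes on the frontier of a
  component of the intersection of the rotated domains; that component stays near \<open>w\<close> because a circle
  about \<open>w\<^sub>0\<close> has an arc outside the curve.\<close>
lemma h_not_locally_constant:
  assumes w: "w \<in> path_image c" and r0: "r0 > 0"
  shows "\<exists>x \<in> path_image c \<inter> ball w r0. h x \<noteq> a"
proof (rule ccontr)
  assume "\<not> ?thesis"
  then have ha: "\<And>x. x \<in> path_image c \<Longrightarrow> dist w x < r0 \<Longrightarrow> h x = a" by auto
  have na: "norm a = 1" using h_boundary[OF w] ha[OF w] r0 by simp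
  have J: "open (outside (path_image c))" "frontier (outside (path_image c)) = path_image c"
      "outside (path_image c) \<inter> G = {}" "outside (path_image c) \<inter> path_image c = {}"
    using Jordan_inside_outside[OF c] outside_no_overlap[of "path_image c"]
    by (simp_all add: Int_commute)
  have w1: "w \<in> closure G" "w \<in> closure (outside (path_image c))"
    using w clG closure_Un_frontier[of "outside (path_image c)"] J(2) by auto
  obtain w0 where w0: "w0 \<in> G" "dist w0 w < r0 / 4"
    using w1(1) r0 closure_approachable[of w G] by (meson divide_pos_pos zero_less_numeral)
  obtain y where y: "y \<in> outside (path_image c)" "dist y w < r0 / 4"
    using w1(2) r0 closure_approachable[of w "outside (path_image c)"] by (meson divide_pos_pos zero_less_numeral)
  \<comment> \<open>The circle about \<open>w0\<close> through the outside point \<open>y\<close>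
    has radius below r0/2, so everything within it stays within \<open>r0\<close> of
    \<open>w\<close>.\<close>
  define r where "r = norm (y - w0)"
  have "y \<noteq> w0" using y w0 J by blast
  then have rpos: "r > 0" by (simp add: r_def)
  have rsm: "r < r0 / 2"
    using dist_triangle_less_add[of y w "r0/4" w0 "r0/4"] y w0 by (simp add: r_def dist_norm norm_minus_commute)
  obtain \<rho> where \<rho>: "\<rho> > 0" "ball y \<rho> \<subseteq> outside (path_image c)"
    using J(1) y(1) openE by blast
  \<comment> \<open>\<open>m\<close> equal steps around the circle are so short that every point of
    it is carried by some step into the ball about \<open>y\<close>, that is, outside the
    curve.\<close>
  obtain m :: nat where m: "m > 0" "2 * pi * r / m < \<rho>"
  proof -
    obtain m :: nat where m: "2 * pi * r / \<rho> < m" using reals_Archimedean2 by blast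
    have "0 < 2 * pi * r / \<rho>" using rpos \<rho> by simp
    then have "0 < real m" using m by linarith
    then show thesis using that[of m] m \<rho> by (simp add: field_simps)
  qed
  define \<omega> where "\<omega> = (\<lambda>k::nat. exp (\<i> * of_real (2 * pi * k / m)))"
  define T where "T = (\<lambda>k z. w0 + \<omega> k * (z - w0))"
  have n\<omega>: "norm (\<omega> k) = 1" for k by (simp add: \<omega>_def)
  have dT: "norm (T k z - w0) = norm (z - w0)" for k z
    by (simp add: T_def norm_mult n\<omega>)
  have contT: "continuous_on S (T k)" for S k unfolding T_def by (intro continuous_intros)
  \<comment> \<open>A point of the circle cannot have all its rotations in the domain, so the
    component of \<open>w0\<close> in this intersection never reaches the circle.\<close>
  define S where "S = (\<Inter>k<m. T k -` G)"
  have oS: "open S" unfolding S_def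
    using G(1) contT by (intro open_INT) (auto intro: open_vimage)
  have w0S: "w0 \<in> S" using w0 by (simp add: S_def T_def)
  define \<Omega> where "\<Omega> = connected_component_set S w0"
  have o\<Omega>: "open \<Omega>" and c\<Omega>: "connected \<Omega>" and s\<Omega>: "\<Omega> \<subseteq> S" and w0\<Omega>: "w0 \<in> \<Omega>"
    using oS w0S by (auto simp: \<Omega>_def open_connected_component connected_component_subset)
  have key: "\<exists>k<m. T k z \<in> ball y \<rho>" if z: "norm (z - w0) = r" for z
  proof -
    define \<alpha> where "\<alpha> = Arg (z - w0)"
    define \<beta> where "\<beta> = Arg (y - w0)"
    have zz: "z - w0 = of_real r * exp (\<i> * of_real \<alpha>)"
      using Arg_eq[of "z - w0"] z rpos unfolding \<alpha>_def by force
    have yy: "y - w0 = of_real r * exp (\<i> * of_real \<beta>)"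
      using Arg_eq[of "y - w0"] rpos unfolding \<beta>_def r_def by force
    \<comment> \<open>\<open>j\<close> counts the angular steps from \<open>\<alpha>\<close> to
      \<open>\<beta>\<close>, rounded down, and is then reduced modulo \<open>m\<close> to the index
      of a rotation; the angular error is at most one step.\<close>
    define j where "j = \<lfloor>(\<beta> - \<alpha>) * m / (2 * pi)\<rfloor>"
    define k where "k = nat (j mod int m)"
    have km: "k < m" using m by (simp add: k_def nat_less_iff)
    have ik: "int k = j - int m * (j div int m)"
      using m by (simp add: k_def minus_mult_div_eq_mod)
    then have rk: "real k = of_int j - real m * of_int (j div int m)"
      by (metis of_int_diff of_int_mult of_int_of_nat_eq)
    have kj: "2 * pi * k / m = 2 * pi * of_int j / m - 2 * pi * of_int (j div int m)"
      unfolding rk using m(1) by (simp add: diff_divide_distrib right_diff_distrib)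
    have "exp (\<i> * of_real (2 * pi * k / m)) = exp (\<i> * of_real (2 * pi * of_int j / m))"
      unfolding exp_eq
    proof
      show "\<i> * of_real (2 * pi * k / m) =
          \<i> * of_real (2 * pi * of_int j / m) + of_real (of_int (2 * - (j div int m)) * pi) * \<i>"
        unfolding complex_eq_iff kj by (simp add: algebra_simps)
    qed
    then have wk: "\<omega> k = exp (\<i> * of_real (2 * pi * of_int j / m))"
      unfolding \<omega>_def .
    have "T k z - y = \<omega> k * (z - w0) - (y - w0)" by (simp add: T_def)
    also have "\<dots> = of_real r * (exp (\<i> * of_real (2 * pi * of_int j / m + \<alpha>)) - exp (\<i> * of_real \<beta>))"
      unfolding zz yy wk by (simp add: algebra_simps exp_add)
    finally have "norm (T k z - y) = r * norm (exp (\<i> * of_real (2 * pi * of_int j / m + \<alpha>)) - exp (\<i> * of_real \<beta>))"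
      using rpos by (simp only: norm_mult norm_of_real abs_of_pos)
    also have "\<dots> \<le> r * \<bar>2 * pi * of_int j / m + \<alpha> - \<beta>\<bar>"
      by (rule mult_left_mono[OF norm_exp_i_diff_le less_imp_le[OF rpos]])
    also have "\<bar>2 * pi * of_int j / m + \<alpha> - \<beta>\<bar> \<le> 2 * pi / m"
    proof -
      have "of_int j \<le> (\<beta> - \<alpha>) * m / (2 * pi)" "(\<beta> - \<alpha>) * m / (2 * pi) < of_int j + 1"
        using floor_correct[of "(\<beta> - \<alpha>) * m / (2 * pi)"] unfolding j_def by (simp_all only: of_int_add of_int_1)
      then have "2 * pi * of_int j / m \<le> \<beta> - \<alpha>" "\<beta> - \<alpha> < 2 * pi * of_int j / m + 2 * pi / m"
        using m by (simp_all add: field_simps)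
      then show ?thesis by linarith
    qed
    finally have "norm (T k z - y) < \<rho>"
      using m rpos by (simp add: mult_left_mono mult.commute)
    then show ?thesis using km by (auto simp: dist_norm norm_minus_commute)
  qed
  have \<Omega>b: "\<Omega> \<subseteq> ball w0 r"
  proof (rule connected_subset_ball[OF c\<Omega> _ w0\<Omega>])
    show "\<Omega> \<inter> sphere w0 r = {}"
    proof (rule ccontr)
      assume "\<Omega> \<inter> sphere w0 r \<noteq> {}"
      then obtain z where z: "z \<in> \<Omega>" "z \<in> sphere w0 r" by blast
      then have "norm (z - w0) = r" by (simp add: dist_norm norm_minus_commute)
      from key[OF this] obtain k where k: "k < m" "T k z \<in> ball y \<rho>" by blast
      then have "T k z \<in> G" using z s\<Omega> by (auto simp: S_def)
      then show False using k \<rho> J by blast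
    qed
  qed (use rpos in auto)
  \<comment> \<open>At a frontier point of \<open>\<Omega>\<close> some rotation lands on the curve
    within \<open>r0\<close> of \<open>w\<close>, where \<open>h\<close> equals \<open>a\<close>, so
    one factor vanishes.\<close>
  define \<Phi> where "\<Phi> = (\<lambda>z. \<Prod>k<m. (h (T k z) - a))"
  have Tcl: "T k z \<in> closure G" if "k < m" "z \<in> closure S" for k z
  proof -
    have "T k ` closure S \<subseteq> closure G"
    proof (rule image_closure_subset[OF contT])
      show "T k ` S \<subseteq> closure G" using that(1) closure_subset by (auto simp: S_def)
    qed simp
    then show ?thesis using that by blast
  qed
  have clsub: "closure \<Omega> \<subseteq> closure S" using s\<Omega> closure_mono by blast
  have "norm (\<Phi> w0) \<le> 0"
  proof (rule maximum_modulus_frontier[of \<Phi> \<Omega>])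
    have "h holomorphic_on G" using holg holomorphic_cong[of G G h g] hg by simp
    then have "(\<lambda>z. h (T k z)) holomorphic_on \<Omega>" if "k < m" for k
      using that s\<Omega> unfolding S_def
      by (intro holomorphic_on_compose_gen[of "T k" \<Omega> h G, unfolded o_def]) (auto simp: T_def intro!: holomorphic_intros)
    then show "\<Phi> holomorphic_on interior \<Omega>"
      unfolding \<Phi>_def using o\<Omega> by (auto simp: interior_open intro!: holomorphic_intros)
    have "continuous_on (closure \<Omega>) (\<lambda>z. h (T k z))" if "k < m" for k
      by (rule continuous_on_compose2[OF conth contT]) (use Tcl[OF that] clsub in auto)
    then show "continuous_on (closure \<Omega>) \<Phi>"
      unfolding \<Phi>_def by (auto intro!: continuous_intros)
    show "bounded \<Omega>" using \<Omega>b bounded_subset by blast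
    show "w0 \<in> \<Omega>" by (rule w0\<Omega>)
    fix z assume z: "z \<in> frontier \<Omega>"
    have "z \<in> frontier S"
      using z frontier_of_connected_component_subset unfolding \<Omega>_def by blast
    then have "z \<notin> S" "z \<in> closure S" using oS by (auto simp: frontier_def interior_open)
    then obtain k where k: "k < m" "T k z \<notin> G" by (auto simp: S_def)
    then have Tc: "T k z \<in> path_image c" using Tcl \<open>z \<in> closure S\<close> clG by blast
    have "z \<in> closure \<Omega>" using z by (simp add: frontier_def)
    then have "z \<in> closure (ball w0 r)" using closure_mono[OF \<Omega>b] by blast
    then have "z \<in> cball w0 r" using rpos by simp
    then have "norm (T k z - w0) \<le> r" unfolding dT by (simp add: dist_norm norm_minus_commute)
    then have "dist w (T k z) < r0"
      using dist_triangle[of w "T k z" w0] w0 rsm r0 by (simp add: dist_norm norm_minus_commute)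
    then have "h (T k z) = a" using ha Tc by blast
    then show "norm (\<Phi> z) \<le> 0" unfolding \<Phi>_def using k(1) by (auto intro!: prod_zero)
  qed
  \<comment> \<open>Every rotation fixes \<open>w0\<close>, so \<open>h\<close> takes the value
    \<open>a\<close> of modulus 1 at an interior point, which is impossible.\<close>
  then have "\<exists>k<m. h (T k w0) = a" unfolding \<Phi>_def by auto
  then have "h w0 = a" by (simp add: T_def)
  then show False using hg[OF w0(1)] gim[OF w0(1)] na by auto
qed

lemma h_f: "z \<in> ball 0 1 \<Longrightarrow> h (f z) = z"
  using hg[OF fim] gf by simp

lemma h_image: "h ` closure G = cball 0 1"
proof
  show "h ` closure G \<subseteq> cball 0 1" using h_le by auto
  have "ball 0 1 \<subseteq> h ` closure G"
  proof
    fix z :: complex assume z: "z \<in> ball 0 1"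
    then have "f z \<in> closure G" using fim clG by blast
    then show "z \<in> h ` closure G" using h_f[OF z] by (metis imageI)
  qed
  moreover have "closed (h ` closure G)"
    using compact_imp_closed compact_continuous_image conth compact_clG by blast
  ultimately have "closure (ball 0 1) \<subseteq> h ` closure G" by (rule closure_minimal)
  then show "cball 0 1 \<subseteq> h ` closure G" by simp
qed

text \<open>The cluster set of \<open>f\<close> at a boundary point is connected and contained in a fibre of \<open>h\<close>,
  which contains no arc.\<close>
lemma h_inj_boundary:
  assumes w1: "w1 \<in> path_image c" and w2: "w2 \<in> path_image c" and eq: "h w1 = h w2"
  shows "w1 = w2"
proof (rule ccontr)
  assume ne: "w1 \<noteq> w2"
  define b where "b = h w1"
  have nb: "norm b = 1" using h_boundary[OF w1] by (simp add: b_def)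
  \<comment> \<open>The intersection of these closures is the cluster set of \<open>f\<close> at
    \<open>b\<close>; it is connected as a nested intersection of compact connected sets.\<close>
  define R where "R = (\<lambda>n::nat. closure (f ` (ball 0 1 \<inter> ball b (1 / Suc n))))"
  have sub: "f ` (ball 0 1 \<inter> ball b (1 / Suc n)) \<subseteq> G" for n using fim by blast
  have contf: "continuous_on (ball 0 1) f" using holf holomorphic_on_imp_continuous_on by blast
  have conn: "connected (\<Inter>(range R))"
  proof (rule connected_nest)
    show "compact (R n)" for n
      unfolding R_def using sub G(3) bounded_subset compact_closure by blast
    show "connected (R n)" for n
      unfolding R_def
      by (intro connected_imp_connected_closure connected_continuous_image continuous_on_subset[OF contf]
          convex_connected convex_Int convex_ball) auto
    show "R n \<subseteq> R m" if "m \<le> n" for m n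
    proof -
      have "1 / real (Suc n) \<le> 1 / real (Suc m)" using that by (simp add: frac_le)
      then have "ball b (1 / Suc n) \<subseteq> ball b (1 / Suc m)" by (rule subset_ball)
      then show ?thesis unfolding R_def by (intro closure_mono image_mono) blast
    qed
  qed
  \<comment> \<open>Points of the domain tending to \<open>w\<close> have \<open>g\<close>-images
    tending to \<open>b\<close>, so \<open>w\<close> is a cluster value of \<open>f\<close> at
    \<open>b\<close>.\<close>
  have inX: "w \<in> \<Inter>(range R)" if w: "w \<in> path_image c" "h w = b" for w
  proof -
    have wcl: "w \<in> closure G" using w clG by blast
    have "w \<in> R n" for n
      unfolding R_def closure_approachable
    proof (intro allI impI)
      fix e :: real assume e: "e > 0"
      have "0 < 1 / real (Suc n)" by simp
      then obtain d where d: "d > 0" "\<And>x. x \<in> closure G \<Longrightarrow> dist x w < d \<Longrightarrow> dist (h x) (h w) < 1 / Suc n"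
        using conth wcl unfolding continuous_on_iff by meson
      obtain x where x: "x \<in> G" "dist x w < min d e"
        using wcl closure_approachable[of w G] d(1) e by (meson min_less_iff_conj)
      have "dist (h x) b < 1 / Suc n" using d(2)[of x] x clG w by auto
      then have "g x \<in> ball 0 1 \<inter> ball b (1 / Suc n)"
        using hg[OF x(1)] gim[OF x(1)] by (simp add: dist_commute)
      moreover have "f (g x) = x" using fg x by blast
      ultimately show "\<exists>y\<in>f ` (ball 0 1 \<inter> ball b (1 / Suc n)). dist y w < e"
        using x(2) by (intro bexI[of _ x]) (auto intro: image_eqI[of x f "g x"])
    qed
    then show ?thesis by blast
  qed
  have Xsub: "x \<in> path_image c \<and> h x = b" if x: "x \<in> \<Inter>(range R)" for x
  proof -
    have xR: "x \<in> R n" for n using x by blast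
    then have xcl: "x \<in> closure G" unfolding R_def using sub closure_mono by blast
    have "h x = b"
    proof (rule ccontr)
      assume "h x \<noteq> b"
      define \<delta> where "\<delta> = dist (h x) b / 2"
      have \<delta>: "\<delta> > 0" using \<open>h x \<noteq> b\<close> by (simp add: \<delta>_def)
      obtain d where d: "d > 0" "\<And>y. y \<in> closure G \<Longrightarrow> dist y x < d \<Longrightarrow> dist (h y) (h x) < \<delta>"
        using conth xcl \<delta> unfolding continuous_on_iff by meson
      obtain n where n: "1 / Suc n < \<delta>" using \<delta> nat_approx_posE by blast
      obtain z where z: "z \<in> ball 0 1 \<inter> ball b (1 / Suc n)" "dist (f z) x < d"
        using xR[of n] d(1) unfolding R_def closure_approachable by blast
      have "dist z (h x) < \<delta>" using d(2)[of "f z"] z h_f[of z] fim[of z] clG by auto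
      moreover have "dist z b < \<delta>" using z n by (simp add: dist_commute)
      ultimately have "dist (h x) b < \<delta> + \<delta>"
        using dist_triangle3[of "h x" b z] by linarith
      then show False by (simp add: \<delta>_def)
    qed
    moreover have "x \<notin> G" using \<open>h x = b\<close> hg gim nb by force
    ultimately show ?thesis using xcl clG by blast
  qed
  \<comment> \<open>A connected subset of the curve with the two points \<open>w1\<close> and
    \<open>w2\<close> contains a whole open piece of the curve, on which \<open>h\<close> would be
    constantly \<open>b\<close>.\<close>
  have "\<Inter>(range R) \<subseteq> path_image c" using Xsub by blast
  then obtain w r where w: "w \<in> path_image c" "r > 0" "path_image c \<inter> ball w r \<subseteq> \<Inter>(range R)"
    using connected_subset_loop_interior[OF c conn _ inX[OF w1] inX[OF w2] ne] eq b_def by metis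
  then show False
    using h_not_locally_constant[OF w(1,2), of b] Xsub by blast
qed

lemma h_inj: "inj_on h (closure G)"
proof (rule inj_onI)
  fix x y assume xy: "x \<in> closure G" "y \<in> closure G" and eq: "h x = h y"
  have lt: "norm (h x) < 1" if "x \<in> G" for x using hg[OF that] gim[OF that] by simp
  have 1: "x \<in> G \<or> x \<in> path_image c" "y \<in> G \<or> y \<in> path_image c" using xy clG by auto
  show "x = y"
  proof (cases "norm (h x) = 1")
    case True
    then have "x \<in> path_image c" "y \<in> path_image c" using 1 lt eq by force+
    then show ?thesis using h_inj_boundary eq by blast
  next
    case False
    have "x \<notin> path_image c" using False h_boundary by blast
    moreover have "y \<notin> path_image c" using False eq h_boundary[of y] by metis
    ultimately have "x \<in> G" "y \<in> G" using 1 by auto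
    then show ?thesis using eq hg fg by metis
  qed
qed

lemma homeomorphism_extension:
  obtains F where "homeomorphism (cball 0 1) (closure G) F h" "\<And>z. z \<in> ball 0 1 \<Longrightarrow> F z = f z"
proof -
  obtain F where F: "homeomorphism (closure G) (cball 0 1) h F"
    using homeomorphism_compact[OF compact_clG conth h_image h_inj] by blast
  show thesis
  proof (rule that[of F])
    show "homeomorphism (cball 0 1) (closure G) F h" using F homeomorphism_sym by blast
    fix z :: complex assume z: "z \<in> ball 0 1"
    have "f z \<in> closure G" using fim[OF z] clG by blast
    then have "F (h (f z)) = f z" using F by (simp add: homeomorphism_def)
    then show "F z = f z" using h_f[OF z] by simp
  qed
qed

end

text \<open>The prescribed value at the centre matters later: with centre 0 the map respects the
  puncture, both for the given curve and for its inversion.\<close>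

theorem Caratheodory_Jordan:
  fixes c :: "real \<Rightarrow> complex"
  assumes c: "simple_path c" "pathfinish c = pathstart c" and a: "a \<in> inside (path_image c)"
  obtains F h where "homeomorphism (cball 0 1) (inside (path_image c) \<union> path_image c) F h"
    "F holomorphic_on ball 0 1" "F 0 = a" "F ` ball 0 1 = inside (path_image c)"
    "F ` sphere 0 1 = path_image c"
proof -
  define G where "G = inside (path_image c)"
  have oG: "open G" and bG: "bounded G" and disj: "G \<inter> path_image c = {}"
    using Jordan_inside_outside[OF c] inside_no_overlap[of "path_image c"] by (auto simp: G_def)
  have sG: "simply_connected G" unfolding G_def using simply_connected_inside_simple_path c by blast
  have "G \<noteq> {}" using a by (auto simp: G_def)
  moreover have "G \<noteq> UNIV" using bG by auto
  ultimately obtain f0 g0 where f0: "f0 holomorphic_on G" and g0: "g0 holomorphic_on ball 0 1"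
    and 1: "\<And>z. z \<in> G \<Longrightarrow> f0 z \<in> ball 0 1 \<and> g0 (f0 z) = z"
    and 2: "\<And>z. z \<in> ball 0 1 \<Longrightarrow> g0 z \<in> G \<and> f0 (g0 z) = z"
    using Riemann_mapping_theorem[of G] oG sG by blast
  have "f0 a \<in> ball 0 1" using 1 a by (simp add: G_def)
  \<comment> \<open>An automorphism of the disc moves the image of \<open>a\<close> to the
    centre.\<close>
  then obtain m k where m: "m (f0 a) = 0" and hm: "m holomorphic_on ball 0 1" "m ` ball 0 1 \<subseteq> ball 0 1"
    and hk: "k holomorphic_on ball 0 1" "k ` ball 0 1 \<subseteq> ball 0 1"
    and mk: "\<And>z. z \<in> ball 0 1 \<Longrightarrow> m (k z) = z" and km: "\<And>z. z \<in> ball 0 1 \<Longrightarrow> k (m z) = z"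
    using ball_biholomorphism_exists by blast
  define f where "f = (\<lambda>z. g0 (k z))"
  define g where "g = (\<lambda>z. m (f0 z))"
  interpret jordan_riemann c f g
  proof
    show "f holomorphic_on ball 0 1" unfolding f_def
      by (rule holomorphic_on_compose_gen[OF hk(1) g0 hk(2), unfolded o_def])
    show "g holomorphic_on inside (path_image c)" unfolding g_def
      by (rule holomorphic_on_compose_gen[OF f0[unfolded G_def] hm(1), unfolded o_def]) (use 1 in \<open>auto simp: G_def\<close>)
    have kb: "k z \<in> ball 0 1" if "z \<in> ball 0 1" for z using hk(2) that by blast
    have mb: "m z \<in> ball 0 1" if "z \<in> ball 0 1" for z using hm(2) that by blast
    show "f z \<in> inside (path_image c)" if "z \<in> ball 0 1" for z
      using 2[OF kb[OF that]] by (simp add: f_def G_def)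
    show "g x \<in> ball 0 1" if "x \<in> inside (path_image c)" for x
      using 1 mb that by (simp only: g_def G_def)
    show "g (f z) = z" if "z \<in> ball 0 1" for z
      using 2[OF kb[OF that]] mk[OF that] by (simp add: f_def g_def)
    show "f (g x) = x" if "x \<in> inside (path_image c)" for x
      using 1[of x] km[of "f0 x"] that by (simp add: f_def g_def G_def)
    show "simple_path c" "pathfinish c = pathstart c" by (fact c)+
  qed
  obtain h where h: "uniformly_continuous_on (closure (inside (path_image c))) h"
    "\<And>x. x \<in> inside (path_image c) \<Longrightarrow> g x = h x"
    using uniformly_continuous_on_extension_on_closure[OF g_uniformly_continuous] by metis
  interpret jordan_riemann_ext c f g h
  proof
    show "continuous_on (closure (inside (path_image c))) h"
      using h(1) uniformly_continuous_imp_continuous by blast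
    show "h x = g x" if "x \<in> inside (path_image c)" for x
      using h(2)[OF that] by simp
  qed
  obtain F where F: "homeomorphism (cball 0 1) (closure (inside (path_image c))) F h"
    "\<And>z. z \<in> ball 0 1 \<Longrightarrow> F z = f z"
    using homeomorphism_extension by blast
  show thesis
  proof (rule that[of F h])
    show "homeomorphism (cball 0 1) (inside (path_image c) \<union> path_image c) F h"
      using F(1) clG by simp
    show "F holomorphic_on ball 0 1"
      using holf F(2) holomorphic_cong[of "ball 0 1" "ball 0 1" F f] by simp
    have "k (m (f0 a)) = f0 a" using km \<open>f0 a \<in> ball 0 1\<close> by blast
    then show "F 0 = a" using F(2)[of 0] 1[of a] a by (simp add: f_def m G_def)
    have b: "F ` ball 0 1 = f ` ball 0 1" using F(2) by (rule image_cong[OF refl])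
    have "f ` ball 0 1 = inside (path_image c)"
    proof
      show "f ` ball 0 1 \<subseteq> inside (path_image c)" using fim by blast
      show "inside (path_image c) \<subseteq> f ` ball 0 1" using fg gim by (metis image_eqI subsetI)
    qed
    with b show Fb: "F ` ball 0 1 = inside (path_image c)" by simp
    have inj: "inj_on F (cball 0 1)" using F(1) by (metis homeomorphism_apply1 inj_on_inverseI)
    have "sphere 0 1 = cball 0 1 - ball (0::complex) 1" by auto
    then have "F ` sphere 0 1 = F ` cball 0 1 - F ` ball 0 1"
      using inj_on_image_set_diff[OF inj, of "cball 0 1" "ball 0 1"] by (simp add: ball_subset_cball)
    also have "F ` cball 0 1 = inside (path_image c) \<union> path_image c"
      using F(1) clG by (simp add: homeomorphism_def)
    also have "\<dots> - F ` ball 0 1 = path_image c"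
      using Fb disj unfolding G_def by blast
    finally show "F ` sphere 0 1 = path_image c" .
  qed
qed

section \<open>Isotopies of the punctured plane\<close>

text \<open>Polar coordinates with the circle kept as pairs of unit norm, as in
  \<open>half_cylinder_top\<close>. The height in a pipe becomes the radius, so the core side of an
  open pipe becomes the puncture 0.\<close>

definition polar :: "(real \<times> real) \<times> real \<Rightarrow> complex" where
  "polar p = Complex (snd p * fst (fst p)) (snd p * snd (fst p))"

definition polar_inv :: "complex \<Rightarrow> (real \<times> real) \<times> real" where
  "polar_inv z = ((Re (sgn z), Im (sgn z)), norm z)"

lemma norm_polar: "p \<in> sphere 0 1 \<times> {0<..} \<Longrightarrow> norm (polar p) = snd p"
proof -
  assume p: "p \<in> sphere 0 1 \<times> {0<..}"
  have "norm (fst p) = 1" using p by (cases p) simp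
  then have "(fst (fst p))\<^sup>2 + (snd (fst p))\<^sup>2 = 1" by (cases "fst p") (simp add: norm_Pair)
  then have "(snd p * fst (fst p))\<^sup>2 + (snd p * snd (fst p))\<^sup>2 = (snd p)\<^sup>2"
    by (simp add: power_mult_distrib flip: distrib_left)
  then show ?thesis using p by (cases p) (simp add: polar_def complex_norm)
qed

lemma polar_homeomorphic_maps:
  "homeomorphic_maps (top_of_set (- {0})) (top_of_set (sphere 0 1 \<times> {0<..})) polar_inv polar"
  unfolding homeomorphic_maps_def continuous_map_subtopology_eu
proof (intro conjI ballI)
  show "continuous_on (- {0}) polar_inv"
    unfolding polar_inv_def sgn_eq by (intro continuous_intros) auto
  show "continuous_on (sphere 0 1 \<times> {0<..}) polar"
    unfolding polar_def Complex_eq by (intro continuous_intros)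
  show "polar_inv \<in> - {0} \<rightarrow> sphere 0 1 \<times> {0<..}"
  proof
    fix z :: complex assume z: "z \<in> - {0}"
    have "norm (sgn z) = 1" using z by (simp add: norm_sgn)
    then have "(Re (sgn z))\<^sup>2 + (Im (sgn z))\<^sup>2 = 1" by (simp add: cmod_def)
    then show "polar_inv z \<in> sphere 0 1 \<times> {0<..}"
      using z by (simp add: polar_inv_def norm_Pair power_divide)
  qed
  show "polar \<in> sphere 0 1 \<times> {0<..} \<rightarrow> - {0}"
  proof
    fix p :: "(real \<times> real) \<times> real" assume p: "p \<in> sphere 0 1 \<times> {0<..}"
    then have "norm (polar p) > 0" using norm_polar[OF p] by (cases p) simp
    then show "polar p \<in> - {0}" by auto
  qed
  show "polar (polar_inv z) = z" if "z \<in> topspace (top_of_set (- {0}))" for z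
    using that by (simp add: polar_def polar_inv_def sgn_eq complex_eq_iff)
  show "polar_inv (polar p) = p" if "p \<in> topspace (top_of_set (sphere 0 1 \<times> {0<..}))" for p
  proof -
    have "norm (polar p) = snd p" "snd p > 0" using norm_polar[of p] that by (cases p; auto)+
    then show ?thesis by (simp add: polar_inv_def sgn_eq polar_def prod_eq_iff)
  qed
qed

lemma ambient_isotopic_punctured_cball:
  assumes "0 < r" "0 < s"
  shows "ambient_isotopic (top_of_set (- {0::complex})) (cball 0 r - {0}) (cball 0 s - {0})"
proof (rule ambient_isotopic_homeomorphic_maps[OF _ polar_homeomorphic_maps])
  have im: "polar_inv ` (cball 0 u - {0}) = {p \<in> sphere 0 1 \<times> {0<..}. snd p \<le> u}" for u
  proof (intro equalityI subsetI)
    fix p assume "p \<in> polar_inv ` (cball 0 u - {0})"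
    then show "p \<in> {p \<in> sphere 0 1 \<times> {0<..}. snd p \<le> u}"
      using polar_homeomorphic_maps unfolding homeomorphic_maps_def continuous_map_subtopology_eu
      by (auto simp: polar_inv_def)
  next
    fix p :: "(real \<times> real) \<times> real" assume p: "p \<in> {p \<in> sphere 0 1 \<times> {0<..}. snd p \<le> u}"
    then have "polar_inv (polar p) = p" "polar p \<noteq> 0" "norm (polar p) \<le> u"
      using polar_homeomorphic_maps norm_polar[of p]
      unfolding homeomorphic_maps_def continuous_map_subtopology_eu by (auto simp: Pi_iff)
    then show "p \<in> polar_inv ` (cball 0 u - {0})"
      by (intro image_eqI[of _ _ "polar p"]) auto
  qed
  have "{min r s / 2..2 * max r s} \<subseteq> {0<..}" using assms by auto
  moreover have "min r s / 2 < r \<and> r < 2 * max r s \<and> min r s / 2 < s \<and> s < 2 * max r s"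
    using assms by (auto simp: min_def max_def)
  ultimately show "ambient_isotopic (top_of_set (sphere 0 1 \<times> {0<..})) (polar_inv ` (cball 0 r - {0})) (polar_inv ` (cball 0 s - {0}))"
    unfolding im by (intro ambient_isotopic_subgraph[OF compact_sphere[of "0::real \<times> real" 1] subset_refl]) auto
qed (auto simp: Hausdorff_space_subtopology)

section \<open>From conformal discs to round discs\<close>

lemma frontier_ball_image:
  fixes f :: "complex \<Rightarrow> complex"
  assumes f: "continuous_on (cball 0 r) f" "inj_on f (cball 0 r)" and r: "0 < r"
  shows "open (f ` ball 0 r)" "connected (f ` ball 0 r)" "frontier (f ` ball 0 r) = f ` sphere 0 r"
proof -
  have cb: "continuous_on (ball 0 r) f" "inj_on f (ball 0 r)"
    using continuous_on_subset[OF f(1) ball_subset_cball] inj_on_subset[OF f(2) ball_subset_cball] by auto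
  show o: "open (f ` ball 0 r)" by (rule invariance_of_domain[OF cb(1) open_ball cb(2)])
  show "connected (f ` ball 0 r)" by (rule connected_continuous_image[OF cb(1) connected_ball])
  have "closure (f ` ball 0 r) = f ` cball 0 r"
  proof
    have "closed (f ` cball 0 r)"
      using compact_continuous_image[OF f(1) compact_cball] compact_imp_closed by blast
    then show "closure (f ` ball 0 r) \<subseteq> f ` cball 0 r"
      by (rule closure_minimal[rotated]) (use ball_subset_cball in blast)
    show "f ` cball 0 r \<subseteq> closure (f ` ball 0 r)"
      using image_closure_subset[of "ball 0 r" f "closure (f ` ball 0 r)"] f(1) r closure_subset[of "f ` ball 0 r"] by simp
  qed
  then have "frontier (f ` ball 0 r) = f ` cball 0 r - f ` ball 0 r"
    using o by (simp add: frontier_def interior_open)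
  also have "\<dots> = f ` (cball 0 r - ball 0 r)"
    using inj_on_image_set_diff[OF f(2), of "cball 0 r" "ball 0 r"] by (simp add: ball_subset_cball)
  also have "cball 0 r - ball (0::complex) r = sphere 0 r" by auto
  finally show "frontier (f ` ball 0 r) = f ` sphere 0 r" .
qed

text \<open>The connected open image of one disc cannot cross the frontier of the other, and the
  images share the point at the centre. It is needed because a cut-off map agrees with the original
  on the circle only, not on the disc.\<close>

lemma cball_image_eq:
  fixes f g :: "complex \<Rightarrow> complex"
  assumes f: "continuous_on (cball 0 r) f" "inj_on f (cball 0 r)"
    and g: "continuous_on (cball 0 r) g" "inj_on g (cball 0 r)"
    and r: "0 < r" and eq: "\<And>z. norm z = r \<Longrightarrow> f z = g z" and 0: "f 0 = g 0"
  shows "f ` cball 0 r = g ` cball 0 r"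
proof -
  have sph: "f ` sphere 0 r = g ` sphere 0 r" using eq by (intro image_cong) auto
  have sub: "u ` ball 0 r \<subseteq> v ` ball 0 r"
    if u: "continuous_on (cball 0 r) u" "inj_on u (cball 0 r)"
    and v: "continuous_on (cball 0 r) v" "inj_on v (cball 0 r)"
    and s: "u ` sphere 0 r = v ` sphere 0 r" and z: "u 0 = v 0" for u v :: "complex \<Rightarrow> complex"
  proof (rule ccontr)
    assume "\<not> u ` ball 0 r \<subseteq> v ` ball 0 r"
    then have 1: "u ` ball 0 r - v ` ball 0 r \<noteq> {}" by blast
    have "u 0 \<in> u ` ball 0 r" "u 0 \<in> v ` ball 0 r"
      using r z by (auto intro: image_eqI[of _ _ 0])
    then have 2: "u ` ball 0 r \<inter> v ` ball 0 r \<noteq> {}" by blast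
    have "u ` ball 0 r \<inter> u ` sphere 0 r = {}"
      using inj_on_image_Int[OF u(2), of "ball 0 r" "sphere 0 r"] by auto
    then show False
      using connected_Int_frontier[OF frontier_ball_image(2)[OF u r] 2 1]
        frontier_ball_image(3)[OF v r] s by simp
  qed
  have "f ` ball 0 r = g ` ball 0 r"
    using sub[OF f g sph 0] sub[OF g f sph[symmetric] 0[symmetric]] by blast
  moreover have "cball (0::complex) r = ball 0 r \<union> sphere 0 r" by auto
  ultimately show ?thesis using sph by (simp only: image_Un)
qed

text \<open>Adding \<open>t * g\<close> to the identity gives a homeomorphism for every
  \<open>t\<close> in [0,1], because \<open>t * g\<close> contracts by 1/2; the inverse is
  2-Lipschitz.\<close>

lemma ambient_isotopic_contraction_perturbation:
  fixes g :: "complex \<Rightarrow> complex"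
  assumes lip: "\<And>x y. dist (g x) (g y) \<le> dist x y / 2"
    and K: "compact K" "0 \<notin> K" and gK: "\<And>x. x \<notin> K \<Longrightarrow> g x = 0"
    and B: "(\<lambda>x. x + g x) ` A = B"
  shows "ambient_isotopic (top_of_set (- {0})) A B"
proof -
  have lipt: "dist (of_real t * g x) (of_real t * g y) \<le> dist x y / 2" if "t \<in> {0..1::real}" for t x y
  proof -
    have "dist (of_real t * g x) (of_real t * g y) = t * dist (g x) (g y)"
      using that by (simp add: dist_norm norm_mult flip: right_diff_distrib)
    also have "\<dots> \<le> 1 * dist (g x) (g y)" using that by (intro mult_right_mono) auto
    finally show ?thesis using lip[of x y] by simp
  qed
  have ex1: "\<exists>!x. y - of_real t * g x = x" if "t \<in> {0..1::real}" for t y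
    by (rule banach_fix_type[of "1/2"]) (use lipt[OF that] in \<open>auto simp: dist_norm norm_minus_commute\<close>)
  \<comment> \<open>The inverse of the perturbed identity: Banach's theorem solves x + t g(x) = y as
    a fixed point equation in x.\<close>
  define k where "k = (\<lambda>t y. THE x. y - of_real t * g x = x)"
  have k1: "y - of_real t * g (k t y) = k t y" if "t \<in> {0..1::real}" for t y
    unfolding k_def by (rule theI'[OF ex1[OF that]])
  have k2: "k t (x + of_real t * g x) = x" if "t \<in> {0..1::real}" for t x
    unfolding k_def by (rule the1_equality[OF ex1[OF that]]) simp
  have contk: "continuous_on UNIV (k t)" if t: "t \<in> {0..1::real}" for t
  proof -
    have "dist (k t x) (k t y) \<le> 2 * dist x y" for x y
    proof -
      have "k t x - k t y = (x - y) - (of_real t * g (k t x) - of_real t * g (k t y))"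
        using k1[OF t, of x] k1[OF t, of y] by (simp add: algebra_simps)
      then have "norm (k t x - k t y) \<le> norm (x - y) + norm (of_real t * g (k t x) - of_real t * g (k t y))"
        by (metis norm_triangle_ineq4)
      then show ?thesis using lipt[OF t, of "k t x" "k t y"] by (simp add: dist_norm)
    qed
    then have "2-lipschitz_on UNIV (k t)" by (intro lipschitz_onI) auto
    then show ?thesis by (rule lipschitz_on_continuous_on)
  qed
  have contg: "continuous_on UNIV g"
    by (rule lipschitz_on_continuous_on[OF lipschitz_onI[of _ _ "1/2"]]) (use lip in auto)
  have g0: "g 0 = 0" using gK K by blast
  have k0: "k t 0 = 0" if "t \<in> {0..1::real}" for t using k2[OF that, of 0] g0 by simp
  show ?thesis
  proof (rule ambient_isotopic_euclideanI[where C = K and H = "\<lambda>p. fst p + of_real (snd p) * g (fst p)" and k = k])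
    show "K \<subseteq> - {0}" using K by auto
    show "continuous_on ((- {0}) \<times> {0..1}) (\<lambda>p. fst p + of_real (snd p) * g (fst p))"
      by (intro continuous_intros continuous_on_compose2[OF contg]) auto
    show "fst (x, t) + of_real (snd (x, t)) * g (fst (x, t)) \<in> - {0}" if "x \<in> - {0}" "t \<in> {0..1}" for x t
      using k2[OF that(2), of x] k0[OF that(2)] that by auto
    show "continuous_on (- {0}) (k t)" if "t \<in> {0..1}" for t
      using contk[OF that] continuous_on_subset by blast
    show "k t x \<in> - {0}" if "x \<in> - {0}" "t \<in> {0..1}" for x t
      using k1[OF that(2), of x] that g0 by auto
    show "fst (k t x, t) + of_real (snd (k t x, t)) * g (fst (k t x, t)) = x" if "x \<in> - {0}" "t \<in> {0..1}" for x t
      using k1[OF that(2), of x] by (simp add: algebra_simps)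
  qed (use K k2 gK B in auto)
qed

text \<open>Divided by its derivative at 0, \<open>F\<close> is the identity plus a remainder
  \<open>p\<close> with zero derivative at 0. On a small annulus a cut-off of \<open>p\<close> is a
  contraction, and the resulting perturbation of the identity agrees with the normalised map on one
  circle.\<close>

lemma ambient_isotopic_conformal_disc:
  assumes holF: "F holomorphic_on ball 0 1" and inj: "inj_on F (ball 0 1)" and F0: "F 0 = 0"
  obtains r s where "0 < r" "r < 1" "0 < s"
    "ambient_isotopic (top_of_set (- {0})) (cball 0 s - {0}) (F ` cball 0 r - {0})"
proof -
  define a where "a = deriv F 0"
  have a: "a \<noteq> 0" unfolding a_def
    using holomorphic_injective_imp_regular[OF holF open_ball inj] by simp
  define q where "q = (\<lambda>z. F z / a)"
  define p where "p = (\<lambda>z. q z - z)"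
  have holq: "q holomorphic_on ball 0 1" unfolding q_def by (intro holomorphic_intros holF) (use a in auto)
  have holp: "p holomorphic_on ball 0 1" unfolding p_def by (intro holomorphic_intros holq)
  have p0: "p 0 = 0" by (simp add: p_def q_def F0)
  have dp: "deriv p 0 = 0"
  proof -
    have "(F has_field_derivative a) (at 0)"
      unfolding a_def using holomorphic_derivI[OF holF open_ball, of 0] by simp
    then have "((\<lambda>z. F z / a) has_field_derivative a / a) (at 0)" by (rule DERIV_cdivide)
    from DERIV_diff[OF this DERIV_ident]
    have "(p has_field_derivative a / a - 1) (at 0)" by (simp only: p_def q_def)
    then show ?thesis using a DERIV_imp_deriv by force
  qed
  have "continuous_on (ball 0 1) (deriv p)"
    using holomorphic_deriv[OF holp open_ball] holomorphic_on_imp_continuous_on by blast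
  from this[unfolded continuous_on_iff, rule_format, of 0 "1/10"]
  have "\<exists>d>0. \<forall>z\<in>ball 0 1. dist z 0 < d \<longrightarrow> dist (deriv p z) (deriv p 0) < 1/10"
    by simp
  then obtain d where d: "d > 0" "\<And>z. z \<in> ball 0 1 \<Longrightarrow> norm z < d \<Longrightarrow> norm (deriv p z) < 1/10"
    using dp by auto
  define R where "R = min d 1"
  have R: "0 < R" "R \<le> 1" "R \<le> d" using d by (auto simp: R_def)
  have lip: "norm (p x - p y) \<le> 1/10 * norm (x - y)" if "norm x < R" "norm y < R" for x y
  proof (rule field_differentiable_bound[of "ball 0 R" p "deriv p"])
    show "(p has_field_derivative deriv p z) (at z within ball 0 R)" if "z \<in> ball 0 R" for z
      by (rule holomorphic_derivI[OF holp open_ball]) (use that R in auto)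
    show "norm (deriv p z) \<le> 1/10" if "z \<in> ball 0 R" for z
      using d(2)[of z] that R by auto
  qed (use that in auto)
  \<comment> \<open>With \<open>2 * r\<close> below \<open>R\<close> the estimate for
    \<open>p\<close> covers the whole support of the cut-off.\<close>
  define r where "r = R / 3"
  have r: "0 < r" "r < 1" "3 * r = R" using R by (auto simp: r_def)
  \<comment> \<open>A tent in the radius: 1 on the circle of radius \<open>r\<close>, zero unless
    the radius differs from \<open>r\<close> by less than r/2, slope 2/r.\<close>
  define \<eta> where "\<eta> = (\<lambda>z::complex. max 0 (1 - \<bar>norm z - r\<bar> * (2 / r)))"
  define g where "g = (\<lambda>z. of_real (\<eta> z) * p z)"
  have \<eta>01: "0 \<le> \<eta> z" "\<eta> z \<le> 1" for z using r by (auto simp: \<eta>_def)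
  have \<eta>lip: "\<bar>\<eta> x - \<eta> y\<bar> \<le> 2 / r * norm (x - y)" for x y
  proof -
    have "\<bar>\<eta> x - \<eta> y\<bar> \<le> \<bar>\<bar>norm x - r\<bar> * (2 / r) - \<bar>norm y - r\<bar> * (2 / r)\<bar>"
    proof -
      have "\<bar>max 0 (1 - a) - max 0 (1 - b)\<bar> \<le> \<bar>a - b\<bar>" for a b :: real
        by (auto simp: max_def)
      then show ?thesis unfolding \<eta>_def .
    qed
    also have "\<dots> = \<bar>\<bar>norm x - r\<bar> - \<bar>norm y - r\<bar>\<bar> * (2 / r)"
      unfolding left_diff_distrib[symmetric] abs_mult using r by simp
    also have "\<dots> \<le> norm (x - y) * (2 / r)"
      using r norm_triangle_ineq3[of x y] by (intro mult_right_mono) auto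
    finally show ?thesis by (simp add: mult.commute)
  qed
  have \<eta>out: "\<eta> z = 0" if "norm z \<ge> 2 * r \<or> norm z \<le> r / 2" for z
  proof -
    have "\<bar>norm z - r\<bar> \<ge> r / 2" using that r by auto
    then have "\<bar>norm z - r\<bar> * (2 / r) \<ge> 1" using r by (simp add: field_simps)
    then show ?thesis by (simp add: \<eta>_def)
  qed
  \<comment> \<open>The product rule gives 2/r times the bound r/5 for \<open>p\<close>, that is
    2/5, and the variation of \<open>p\<close> contributes 1/10; together exactly 1/2. If
    \<open>y\<close> is far out, its weight \<open>\<eta> y\<close> vanishes, so only
    \<open>x\<close> needs to be small.\<close>
  have half: "norm (g x - g y) \<le> norm (x - y) / 2" if x: "norm x < 2 * r" for x y
  proof -
    have px: "norm (p x) \<le> r / 5" using lip[of x 0] x r p0 by simp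
    have first: "norm (of_real (\<eta> x - \<eta> y) * p x) \<le> 2/5 * norm (x - y)"
    proof -
      have "norm (of_real (\<eta> x - \<eta> y) * p x) = \<bar>\<eta> x - \<eta> y\<bar> * norm (p x)"
        by (simp only: norm_mult norm_of_real)
      also have "\<dots> \<le> (2 / r * norm (x - y)) * (r / 5)"
        using \<eta>lip px r by (intro mult_mono) auto
      also have "\<dots> = 2/5 * norm (x - y)" using r by simp
      finally show ?thesis .
    qed
    have second: "norm (of_real (\<eta> y) * (p x - p y)) \<le> 1/10 * norm (x - y)"
    proof (cases "norm y < 2 * r")
      case True
      have "norm (of_real (\<eta> y) * (p x - p y)) = \<eta> y * norm (p x - p y)"
        using \<eta>01[of y] by (simp add: norm_mult)
      also have "\<dots> \<le> 1 * norm (p x - p y)" using \<eta>01[of y] by (intro mult_right_mono) auto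
      also have "\<dots> \<le> 1/10 * norm (x - y)" using lip[of x y] x True r by simp
      finally show ?thesis .
    qed (use \<eta>out in simp)
    have "g x - g y = of_real (\<eta> x - \<eta> y) * p x + of_real (\<eta> y) * (p x - p y)"
      by (simp add: g_def algebra_simps)
    then have "norm (g x - g y) \<le> norm (of_real (\<eta> x - \<eta> y) * p x) + norm (of_real (\<eta> y) * (p x - p y))"
      by (simp only: norm_triangle_ineq)
    then show ?thesis using first second by simp
  qed
  have lipg: "dist (g x) (g y) \<le> dist x y / 2" for x y
  proof -
    have "g x = 0" if "norm x \<ge> 2 * r" for x using \<eta>out that by (simp add: g_def)
    then show ?thesis
      using half[of x y] half[of y x] by (cases "norm x < 2 * r"; cases "norm y < 2 * r")
        (auto simp: dist_norm norm_minus_commute)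
  qed
  define \<Psi> where "\<Psi> = (\<lambda>z. z + g z)"
  define K where "K = cball (0::complex) (2 * r) - ball 0 (r / 2)"
  have K: "compact K" "0 \<notin> K" using r by (auto simp: K_def compact_diff)
  have gK: "g x = 0" if "x \<notin> K" for x
    using that \<eta>out[of x] by (auto simp: K_def g_def)
  have c1: "ambient_isotopic (top_of_set (- {0})) (cball 0 r - {0}) (\<Psi> ` (cball 0 r - {0}))"
    by (rule ambient_isotopic_contraction_perturbation[OF lipg K gK]) (simp_all add: \<Psi>_def)
  have \<Psi>inj: "inj \<Psi>"
  proof (rule injI)
    fix x y assume "\<Psi> x = \<Psi> y"
    then have "x - y = g y - g x" by (simp add: \<Psi>_def algebra_simps)
    then have "dist x y = dist (g x) (g y)" by (simp add: dist_norm norm_minus_commute)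
    then show "x = y" using lipg[of x y] by simp
  qed
  have "continuous_on UNIV g"
    by (rule lipschitz_on_continuous_on[OF lipschitz_onI[of _ _ "1/2"]]) (use lipg in auto)
  then have \<Psi>c: "continuous_on UNIV \<Psi>" unfolding \<Psi>_def by (intro continuous_intros)
  have g0: "g 0 = 0" using gK K by blast
  have "\<Psi> ` cball 0 r = q ` cball 0 r"
  proof (rule cball_image_eq)
    show "continuous_on (cball 0 r) q"
      by (rule continuous_on_subset[OF holomorphic_on_imp_continuous_on[OF holq]]) (use r in auto)
    show "inj_on q (cball 0 r)"
      using a r by (intro inj_onI) (auto simp: q_def intro: inj_onD[OF inj])
    show "\<Psi> z = q z" if "norm z = r" for z
      using that by (simp add: \<Psi>_def g_def \<eta>_def p_def)
    show "\<Psi> 0 = q 0" using g0 by (simp add: \<Psi>_def q_def F0)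
  qed (use r \<Psi>c \<Psi>inj continuous_on_subset inj_on_subset in blast)+
  moreover have "\<Psi> ` (cball 0 r - {0}) = \<Psi> ` cball 0 r - {0}"
  proof -
    have "\<Psi> 0 = 0" using g0 by (simp add: \<Psi>_def)
    then show ?thesis using image_set_diff[OF \<Psi>inj, of "cball 0 r" "{0}"] by simp
  qed
  ultimately have c2: "ambient_isotopic (top_of_set (- {0})) (cball 0 r - {0}) (q ` cball 0 r - {0})"
    using c1 by simp
  \<comment> \<open>Multiplication by \<open>a\<close> undoes the normalisation; the round disc of
    radius \<open>r\<close> becomes one of radius \<open>norm a * r\<close>.\<close>
  have m: "homeomorphic_map (top_of_set (- {0})) (top_of_set (- {0})) (\<lambda>z. a * z)"
    unfolding homeomorphic_map_maps
  proof (intro exI[of _ "\<lambda>z. z / a"])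
    show "homeomorphic_maps (top_of_set (- {0})) (top_of_set (- {0})) (\<lambda>z. a * z) (\<lambda>z. z / a)"
      unfolding homeomorphic_maps_def continuous_map_subtopology_eu
      using a by (auto intro!: continuous_intros)
  qed
  have inja: "inj (\<lambda>z. a * z)" using a by (simp add: inj_on_def)
  have "ambient_isotopic (top_of_set (- {0})) ((\<lambda>z. a * z) ` (cball 0 r - {0})) ((\<lambda>z. a * z) ` (q ` cball 0 r - {0}))"
    by (rule ambient_isotopic_homeomorphic_image[OF _ m _ _ c2]) (auto simp: Hausdorff_space_subtopology)
  moreover have "(\<lambda>z. a * z) ` (cball 0 r - {0}) = cball 0 (norm a * r) - {0}"
  proof (intro equalityI subsetI)
    fix z :: complex assume z: "z \<in> cball 0 (norm a * r) - {0}"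
    have "z = a * (z / a)" using a by simp
    moreover have "z / a \<in> cball 0 r - {0}" using z a by (simp add: norm_divide field_simps)
    ultimately show "z \<in> (\<lambda>z. a * z) ` (cball 0 r - {0})" by blast
  qed (use a in \<open>auto simp: norm_mult\<close>)
  moreover have "(\<lambda>z. a * z) ` (q ` cball 0 r - {0}) = F ` cball 0 r - {0}"
    unfolding image_set_diff[OF inja] image_image q_def using a by simp
  ultimately have "ambient_isotopic (top_of_set (- {0})) (cball 0 (norm a * r) - {0}) (F ` cball 0 r - {0})"
    by simp
  then show thesis using that[of r "norm a * r"] r a by simp
qed

text \<open>Boundedness decides which side goes where: inversion makes a punctured neighbourhood of
  0 unbounded, while the inside of the original curve is bounded.\<close>

lemma inverse_loop_sides:
  fixes c :: "real \<Rightarrow> complex"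
  assumes c: "simple_path c" "pathfinish c = pathstart c" and 0: "0 \<in> inside (path_image c)"
  shows "simple_path (inverse \<circ> c)" "pathfinish (inverse \<circ> c) = pathstart (inverse \<circ> c)"
    "0 \<in> inside (path_image (inverse \<circ> c))"
    "\<And>z. z \<in> inside (path_image (inverse \<circ> c)) \<Longrightarrow> z \<noteq> 0 \<Longrightarrow> inverse z \<in> outside (path_image c)"
proof -
  define C where "C = path_image c"
  define C' where "C' = path_image (inverse \<circ> c)"
  have C': "C' = inverse ` C" by (simp add: C'_def C_def path_image_compose)
  have nC: "0 \<notin> C" using 0 inside_no_overlap[of "path_image c"] unfolding C_def by blast
  show sp: "simple_path (inverse \<circ> c)"
    by (rule simple_path_continuous_image[OF c(1)])
      (use nC in \<open>auto intro!: continuous_intros simp: C_def inj_on_def\<close>)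
  show lp: "pathfinish (inverse \<circ> c) = pathstart (inverse \<circ> c)"
    using c(2) by (simp add: pathfinish_compose pathstart_compose)
  have J: "open (inside C)" "connected (inside C)" "bounded (inside C)" "inside C \<union> outside C = - C"
    "inside C \<inter> outside C = {}"
    using Jordan_inside_outside[OF c] by (auto simp: C_def)
  have J': "open (inside C')" "connected (inside C')" "bounded (inside C')" "inside C' \<union> outside C' = - C'"
    "open (outside C')" "connected (outside C')" "\<not> bounded (outside C')"
    using Jordan_inside_outside[OF sp lp] by (auto simp: C'_def)
  have nC': "0 \<notin> C'" using nC by (auto simp: C')
  have mapC: "inverse z \<notin> C" if "z \<notin> C'" for z
    using that unfolding C' by (metis image_eqI inverse_inverse_eq)
  have conn: "connected (inverse ` (U - {0}))" if "open U" "connected U" for U :: "complex set"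
    by (intro connected_continuous_image connected_open_delete that continuous_intros) auto
  obtain e where e: "e > 0" "ball 0 e \<subseteq> inside C"
    using J(1) 0 openE unfolding C_def by blast
  have no0: "bounded (inverse ` (U - {0})) \<Longrightarrow> open U \<Longrightarrow> 0 \<notin> U" for U :: "complex set"
  proof
    assume b: "bounded (inverse ` (U - {0}))" and U: "open U" "0 \<in> U"
    obtain M where M: "M > 0" "\<And>z. z \<in> U - {0} \<Longrightarrow> norm (inverse z) \<le> M"
      using b unfolding bounded_pos by auto
    obtain d where d: "d > 0" "ball 0 d \<subseteq> U" using U openE by blast
    define z where "z = complex_of_real (min (d / 2) (1 / (2 * M)))"
    have nz: "norm z = min (d / 2) (1 / (2 * M))" using d M by (simp add: z_def)
    have "norm z > 0" "norm z < d" "norm z \<le> 1 / (2 * M)" using d M unfolding nz by auto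
    then have "z \<in> U - {0}" using d by auto
    then have "norm (inverse z) \<le> M" using M by blast
    then have "inverse (norm z) \<le> M" by (simp only: norm_inverse)
    then have "1 \<le> M * norm z" using \<open>norm z > 0\<close> by (simp add: field_simps)
    also have "\<dots> \<le> M * (1 / (2 * M))" using M \<open>norm z \<le> 1 / (2 * M)\<close> by (intro mult_left_mono) auto
    finally show False using M by simp
  qed
  show zin: "0 \<in> inside (path_image (inverse \<circ> c))"
  proof (rule ccontr)
    assume "0 \<notin> inside (path_image (inverse \<circ> c))"
    moreover have "0 \<in> inside C' \<union> outside C'" unfolding J'(4) using nC' by simp
    ultimately have o: "0 \<in> outside C'" unfolding C'_def by blast
    \<comment> \<open>A point far out is inverted into the small disc inside \<open>C\<close>, and
      connectedness drags the whole outer side along; were 0 on that side, the image would be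
      unbounded.\<close>
    obtain x where x: "x \<in> outside C'" "norm x > 1 / e"
      using J'(7) unfolding bounded_iff by (meson not_le)
    have xpos: "norm x > 0" using x(2) e(1) by (meson divide_pos_pos less_trans zero_less_one)
    have "inverse (norm x) < e" using x(2) e(1) xpos by (simp add: field_simps)
    then have "norm (inverse x) < e" by (simp only: norm_inverse)
    then have xi: "inverse x \<in> inside C" using e by auto
    have "inverse ` (outside C' - {0}) \<subseteq> inside C"
    proof (rule connected_subset_inside[OF conn[OF J'(5,6)] _ _ xi])
      show "inverse ` (outside C' - {0}) \<inter> C = {}"
        using mapC outside_no_overlap[of C'] by blast
      show "inverse x \<in> inverse ` (outside C' - {0})" using x xpos by auto
    qed
    then have "bounded (inverse ` (outside C' - {0}))" using J(3) bounded_subset by blast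
    then show False using no0[OF _ J'(5)] o by blast
  qed
  fix z assume z: "z \<in> inside (path_image (inverse \<circ> c))" "z \<noteq> 0"
  have dis: "inverse ` (inside C' - {0}) \<inter> C = {}"
    using mapC inside_no_overlap[of C'] by blast
  have "inverse z \<notin> inside C"
  proof
    assume a: "inverse z \<in> inside C"
    have "inverse ` (inside C' - {0}) \<subseteq> inside C"
      by (rule connected_subset_inside[OF conn[OF J'(1,2)] dis _ a]) (use z in \<open>auto simp: C'_def\<close>)
    then have "bounded (inverse ` (inside C' - {0}))" using J(3) bounded_subset by blast
    then show False using no0[OF _ J'(1)] zin by (auto simp: C'_def)
  qed
  moreover have "inverse z \<notin> C" using dis z by (auto simp: C'_def)
  ultimately have "inverse z \<in> inside C \<union> outside C" unfolding J(4) by blast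
  with \<open>inverse z \<notin> inside C\<close> show "inverse z \<in> outside (path_image c)"
    unfolding C_def by blast
qed

text \<open>The outside is filled by the Riemann map \<open>Fo\<close> of the inverted curve. The
  two boundary parametrisations need not match; a homeomorphism between circles corrects this and is
  extended radially, so the result is conformal in the disc only.\<close>

lemma Jordan_conformal_extension:
  fixes c :: "real \<Rightarrow> complex"
  assumes c: "simple_path c" "pathfinish c = pathstart c" and 0: "0 \<in> inside (path_image c)"
  obtains \<Phi> where "continuous_on UNIV \<Phi>" "inj \<Phi>" "\<Phi> holomorphic_on ball 0 1" "\<Phi> 0 = 0"
    "\<Phi> ` cball 0 1 = inside (path_image c) \<union> path_image c"
proof -
  define C where "C = path_image c"
  note inv = inverse_loop_sides[OF c 0]
  define C' where "C' = path_image (inverse \<circ> c)"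
  have C': "C' = inverse ` C" by (simp add: C'_def C_def path_image_compose)
  obtain F h where F: "homeomorphism (cball 0 1) (inside C \<union> C) F h"
    and holF: "F holomorphic_on ball 0 1" and F0: "F 0 = 0"
    and "F ` ball 0 1 = inside C" and FC: "F ` sphere 0 1 = C"
    by (rule Caratheodory_Jordan[OF c 0, folded C_def]) (rule that; assumption)
  obtain Fo ho where Fo: "homeomorphism (cball 0 1) (inside C' \<union> C') Fo ho"
    and "Fo holomorphic_on ball 0 1" and Fo0: "Fo 0 = 0" and Fob: "Fo ` ball 0 1 = inside C'"
    and FoC: "Fo ` sphere 0 1 = C'"
    by (rule Caratheodory_Jordan[OF inv(1,2,3), folded C'_def]) (rule that; assumption)
  have nC: "0 \<notin> C" using 0 inside_no_overlap[of "path_image c"] unfolding C_def by blast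
  have cF: "continuous_on (cball 0 1) F" and cFo: "continuous_on (cball 0 1) Fo" and cho: "continuous_on C' ho"
    using F Fo continuous_on_subset by (auto simp: homeomorphism_def intro: continuous_on_subset)
  have hF: "h (F z) = z" and hoFo: "ho (Fo z) = z" if "norm z \<le> 1" for z
    using F Fo that by (auto simp: homeomorphism_def)
  have Foho: "Fo (ho z) = z" "norm (ho z) = 1" if "z \<in> C'" for z
  proof -
    have "z \<in> Fo ` sphere 0 1" using that FoC by simp
    then obtain u where u: "norm u = 1" "z = Fo u" by auto
    then show "Fo (ho z) = z" "norm (ho z) = 1" using hoFo by auto
  qed
  \<comment> \<open>The boundary correction: the parameter at which \<open>Fo\<close> reaches the
    inverse of the boundary value of \<open>F\<close> in direction \<open>z\<close>.\<close>
  define \<theta> where "\<theta> = (\<lambda>z. ho (inverse (F (sgn z))))"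
  have Fs: "F (sgn z) \<in> C" "inverse (F (sgn z)) \<in> C'" if "z \<noteq> 0" for z
  proof -
    show "F (sgn z) \<in> C" using FC that by (auto simp: norm_sgn)
    then show "inverse (F (sgn z)) \<in> C'" by (simp add: C')
  qed
  have n\<theta>: "norm (\<theta> z) = 1" "Fo (\<theta> z) = inverse (F (sgn z))" if "z \<noteq> 0" for z
    using Foho[OF Fs(2)[OF that]] by (auto simp: \<theta>_def)
  \<comment> \<open>Radius t > 1 goes to radius 1/t inside the disc of \<open>Fo\<close> and back
    out by inversion; at radius 1 the correction makes it equal to \<open>F\<close>.\<close>
  define \<Psi> where "\<Psi> = (\<lambda>z. inverse (Fo (\<theta> z / of_real (norm z))))"
  define \<Phi> where "\<Phi> = (\<lambda>z. if norm z \<le> 1 then F z else \<Psi> z)"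
  have \<Psi>1: "\<Psi> z = F z" if "norm z = 1" for z
  proof -
    have "z \<noteq> 0" "sgn z = z" using that by (auto simp: sgn_eq)
    then show ?thesis using n\<theta>(2)[of z] that by (simp add: \<Psi>_def)
  qed
  have dn: "norm (\<theta> z / of_real (norm z)) = 1 / norm z" if "norm z \<ge> 1" for z
    using n\<theta>(1)[of z] that by (auto simp: norm_divide)
  have dl: "norm (\<theta> z / of_real (norm z)) \<le> 1" if "norm z \<ge> 1" for z
    unfolding dn[OF that] using that by (simp add: divide_le_eq)
  have Fon0: "Fo (\<theta> z / of_real (norm z)) \<noteq> 0" if "norm z \<ge> 1" for z
  proof
    assume "Fo (\<theta> z / of_real (norm z)) = 0"
    then have "\<theta> z / of_real (norm z) = 0"
      using hoFo[OF dl[OF that]] hoFo[of 0] Fo0 by simp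
    then show False using dn[OF that] that by auto
  qed
  have \<Psi>out: "\<Psi> z \<in> outside C" if "norm z > 1" for z
  proof -
    have "norm (\<theta> z / of_real (norm z)) < 1" using dn[of z] that by (simp add: divide_less_eq)
    then have "Fo (\<theta> z / of_real (norm z)) \<in> inside C'" using Fob by auto
    then show ?thesis using inv(4) Fon0[of z] that unfolding \<Psi>_def C_def C'_def by simp
  qed
  have Fin: "F z \<in> inside C \<union> C" if "norm z \<le> 1" for z
    using F that by (auto simp: homeomorphism_def)
  have dj: "outside C \<inter> (inside C \<union> C) = {}"
    using inside_Int_outside[of C] outside_no_overlap[of C] by blast
  have \<Psi>inj: "z = w" if z: "norm z > 1" and w: "norm w > 1" and eq: "\<Psi> z = \<Psi> w" for z w
  proof -
    have "Fo (\<theta> z / of_real (norm z)) = Fo (\<theta> w / of_real (norm w))"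
      using eq by (simp add: \<Psi>_def)
    then have e: "\<theta> z / of_real (norm z) = \<theta> w / of_real (norm w)"
      using hoFo[OF dl[OF less_imp_le[OF z]]] hoFo[OF dl[OF less_imp_le[OF w]]] by metis
    then have n: "norm z = norm w" using dn[of z] dn[of w] z w by simp
    then have "\<theta> z = \<theta> w" using e z by auto
    moreover have nz: "z \<noteq> 0" "w \<noteq> 0" using z w by auto
    ultimately have "inverse (F (sgn z)) = inverse (F (sgn w))"
      using n\<theta>(2)[OF nz(1)] n\<theta>(2)[OF nz(2)] by simp
    then have "F (sgn z) = F (sgn w)" by simp
    moreover have "h (F (sgn z)) = sgn z" "h (F (sgn w)) = sgn w"
      by (rule hF; simp add: norm_sgn)+
    ultimately have "sgn z = sgn w" by metis
    then have "of_real (norm z) * sgn z = of_real (norm w) * sgn w" using n by simp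
    then show ?thesis using z w by (auto simp: sgn_eq)
  qed
  show thesis
  proof (rule that[of \<Phi>])
    have csgn: "continuous_on {z::complex. 1 \<le> norm z} sgn"
      unfolding sgn_eq by (intro continuous_intros) auto
    have c1: "continuous_on {z. 1 \<le> norm z} (\<lambda>z. F (sgn z))"
      by (rule continuous_on_compose2[OF cF csgn]) (auto simp: norm_sgn)
    have "continuous_on {z. 1 \<le> norm z} (\<lambda>z. inverse (F (sgn z)))"
    proof (rule continuous_on_inverse[OF c1], rule ballI)
      fix z :: complex assume "z \<in> {z. 1 \<le> norm z}"
      then have "z \<noteq> 0" by auto
      then show "F (sgn z) \<noteq> 0" using Fs(1) nC by metis
    qed
    then have "continuous_on {z. 1 \<le> norm z} \<theta>"
      unfolding \<theta>_def
    proof (rule continuous_on_compose2[OF cho], safe)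
      fix z :: complex assume "1 \<le> norm z"
      then have "z \<noteq> 0" by auto
      then show "inverse (F (sgn z)) \<in> C'" by (rule Fs(2))
    qed
    then have "continuous_on {z. 1 \<le> norm z} (\<lambda>z. \<theta> z / of_real (norm z))"
      by (intro continuous_intros) auto
    then have "continuous_on {z. 1 \<le> norm z} (\<lambda>z. Fo (\<theta> z / of_real (norm z)))"
      by (rule continuous_on_compose2[OF cFo]) (use dl in auto)
    then have c2: "continuous_on {z. 1 \<le> norm z} \<Psi>"
      unfolding \<Psi>_def by (rule continuous_on_inverse) (use Fon0 in auto)
    show "continuous_on UNIV \<Phi>"
      unfolding \<Phi>_def
    proof (rule continuous_on_cases_le)
      show "continuous_on {z \<in> UNIV. norm z \<le> 1} F"
        by (rule continuous_on_subset[OF cF]) auto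
      show "continuous_on {z \<in> UNIV. 1 \<le> norm z} \<Psi>" using c2 by simp
    qed (use \<Psi>1 in \<open>auto intro!: continuous_intros\<close>)
    show "inj \<Phi>"
    proof (rule injI)
      fix z w assume eq: "\<Phi> z = \<Phi> w"
      consider "norm z \<le> 1" "norm w \<le> 1" | "norm z > 1" "norm w > 1"
        | "norm z \<le> 1" "norm w > 1" | "norm z > 1" "norm w \<le> 1" by linarith
      then show "z = w"
      proof cases
        case 1
        then have "F z = F w" using eq by (simp add: \<Phi>_def)
        then show ?thesis using hF[OF 1(1)] hF[OF 1(2)] by metis
      next
        case 2
        then show ?thesis using eq \<Psi>inj by (simp add: \<Phi>_def)
      next
        case 3
        then have "F z = \<Psi> w" using eq by (simp add: \<Phi>_def)
        then show ?thesis using Fin[OF 3(1)] \<Psi>out[OF 3(2)] dj by auto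
      next
        case 4
        then have "F w = \<Psi> z" using eq by (simp add: \<Phi>_def)
        then show ?thesis using Fin[OF 4(2)] \<Psi>out[OF 4(1)] dj by auto
      qed
    qed
    show "\<Phi> holomorphic_on ball 0 1"
      using holF holomorphic_cong[of "ball 0 1" "ball 0 1" \<Phi> F] by (simp add: \<Phi>_def)
    show "\<Phi> 0 = 0" by (simp add: \<Phi>_def F0)
    have "\<Phi> ` cball 0 1 = F ` cball 0 1" by (intro image_cong) (auto simp: \<Phi>_def)
    then show "\<Phi> ` cball 0 1 = inside (path_image c) \<union> path_image c"
      using F by (simp add: homeomorphism_def C_def)
  qed
qed

text \<open>In the chart given by the embedding the closed domain is a round disc, which shrinks to
  a small one with support also outside the curve. The small image disc is already handled by the
  linear approximation at the centre.\<close>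

theorem ambient_isotopic_Jordan_domain:
  fixes c :: "real \<Rightarrow> complex"
  assumes c: "simple_path c" "pathfinish c = pathstart c" and 0: "0 \<in> inside (path_image c)"
  obtains s where "0 < s"
    "ambient_isotopic (top_of_set (- {0})) (inside (path_image c) \<union> path_image c - {0}) (cball 0 s - {0})"
proof -
  obtain \<Phi> where \<Phi>: "continuous_on UNIV \<Phi>" "inj \<Phi>" "\<Phi> holomorphic_on ball 0 1" "\<Phi> 0 = 0"
    "\<Phi> ` cball 0 1 = inside (path_image c) \<union> path_image c"
    by (rule Jordan_conformal_extension[OF c 0]) (rule that)
  obtain r s where rs: "0 < r" "r < 1" "0 < s"
    "ambient_isotopic (top_of_set (- {0})) (cball 0 s - {0}) (\<Phi> ` cball 0 r - {0})"
    using ambient_isotopic_conformal_disc[OF \<Phi>(3) inj_on_subset[OF \<Phi>(2) subset_UNIV] \<Phi>(4)] by metis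
  define N where "N = \<Phi> ` (- {0})"
  have im: "\<Phi> ` (A - {0}) = \<Phi> ` A - {0}" for A
    using image_set_diff[OF \<Phi>(2), of A "{0}"] \<Phi>(4) by simp
  have cont: "continuous_on (- {0}) \<Phi>" using \<Phi>(1) continuous_on_subset by blast
  have inj: "inj_on \<Phi> (- {0})" using \<Phi>(2) inj_on_subset by blast
  have oN: "open N" unfolding N_def by (rule invariance_of_domain[OF cont _ inj]) auto
  have Nsub: "N \<subseteq> - {0}" using im[of UNIV] by (auto simp: N_def Compl_eq_Diff_UNIV)
  obtain w where w: "homeomorphism (- {0}) N \<Phi> w"
    using invariance_of_domain_homeomorphism[OF _ cont _ inj] by (auto simp: N_def)
  have wm: "homeomorphic_maps (subtopology (top_of_set (- {0})) N) (top_of_set (- {0})) w \<Phi>"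
  proof -
    have "subtopology (top_of_set (- {0})) N = top_of_set N"
      using Nsub by (simp add: subtopology_subtopology Int_absorb1)
    then show ?thesis
      using w unfolding homeomorphic_maps_def continuous_map_subtopology_eu by (auto simp: homeomorphism_def)
  qed
  have wim: "w ` ((\<Phi> ` cball 0 u - {0}) \<inter> N) = cball 0 u - {0}" for u
  proof -
    have "(\<Phi> ` cball 0 u - {0}) \<inter> N = \<Phi> ` (cball 0 u - {0})"
      unfolding im[symmetric] N_def by blast
    moreover have "w (\<Phi> z) = z" if "z \<noteq> 0" for z using w that by (simp add: homeomorphism_def)
    ultimately show ?thesis by (simp add: image_image)
  qed
  have sub: "\<Phi> ` cball 0 u - {0} - N = {}" for u
    unfolding im[symmetric] N_def by blast
  have "ambient_isotopic (top_of_set (- {0})) (\<Phi> ` cball 0 1 - {0}) (\<Phi> ` cball 0 r - {0})"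
  proof (rule ambient_isotopic_local[OF _ _ wm])
    show "openin (top_of_set (- {0})) N" using oN Nsub by (auto simp: openin_open)
    show "\<Phi> ` cball 0 1 - {0} - N = \<Phi> ` cball 0 r - {0} - N" by (simp only: sub)
    show "ambient_isotopic (top_of_set (- {0})) (w ` ((\<Phi> ` cball 0 1 - {0}) \<inter> N)) (w ` ((\<Phi> ` cball 0 r - {0}) \<inter> N))"
      unfolding wim using ambient_isotopic_punctured_cball rs by simp
  qed (auto simp: Hausdorff_space_subtopology)
  moreover have "ambient_isotopic (top_of_set (- {0})) (\<Phi> ` cball 0 r - {0}) (cball 0 s - {0})"
    by (rule ambient_isotopic_sym[OF rs(4)]) auto
  ultimately have "ambient_isotopic (top_of_set (- {0})) (\<Phi> ` cball 0 1 - {0}) (cball 0 s - {0})"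
    by (rule ambient_isotopic_trans)
  then show thesis using that[OF rs(3)] \<Phi>(5) by simp
qed

section \<open>Invariance of domain in surfaces\<close>

text \<open>The local condition of a surface at one point, so that it also applies to the interior
  points of the core and of the pipes.\<close>

definition planar_at :: "'a topology \<Rightarrow> 'a \<Rightarrow> bool" where
  "planar_at X x \<longleftrightarrow> (\<exists>U V. openin X U \<and> x \<in> U \<and> open (V :: (real \<times> real) set) \<and>
     subtopology X U homeomorphic_space top_of_set V)"

lemma planar_atE:
  assumes "planar_at X x"
  obtains U V k k' where "openin X U" "x \<in> U" "open (V :: (real \<times> real) set)"
    "homeomorphic_maps (subtopology X U) (top_of_set V) k k'"
  using assms unfolding planar_at_def homeomorphic_space_def by blast

text \<open>Invariance of domain transported through a chart at \<open>x\<close>; it serves to show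
  that boundary points have no planar chart.\<close>

lemma planar_nbhd_open_image:
  fixes j :: "'a \<Rightarrow> 'b::euclidean_space"
  assumes dim: "DIM('b) = 2" and pl: "planar_at X x" and N: "openin X N" "x \<in> N"
    and j: "continuous_map (subtopology X N) euclidean j" "inj_on j N"
  obtains W where "open W" "j x \<in> W" "W \<subseteq> j ` N"
proof -
  obtain U V k k' where U: "openin X U" "x \<in> U" "open (V :: (real \<times> real) set)"
    and k: "homeomorphic_maps (subtopology X U) (top_of_set V) k k'"
    using pl by (rule planar_atE)
  have UX: "U \<subseteq> topspace X" using U openin_subset by blast
  have k'k: "k' (k y) = y" if "y \<in> U" for y
    using k UX that by (auto simp: homeomorphic_maps_def)
  define W where "W = k ` (U \<inter> N)"
  have "openin (subtopology X U) (U \<inter> N)" using N by (auto simp: openin_subtopology)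
  moreover have "homeomorphic_map (subtopology X U) (top_of_set V) k"
    using k homeomorphic_maps_map by blast
  ultimately have "openin (top_of_set V) W"
    unfolding W_def using homeomorphic_map_openness_eq by blast
  then have W: "open W" "W \<subseteq> V" using U(3) by (auto simp: openin_open_eq)
  have "continuous_map (top_of_set V) (subtopology X U) k'"
    using k by (simp add: homeomorphic_maps_def)
  then have "continuous_map (top_of_set W) X k'"
    using W(2) continuous_map_from_subtopology_mono continuous_map_into_fulltopology by blast
  moreover have k'W: "k' ` W = U \<inter> N" unfolding W_def image_image using k'k by simp
  ultimately have "continuous_map (top_of_set W) (subtopology X N) k'"
    by (auto simp: continuous_map_in_subtopology)
  from continuous_map_compose[OF this j(1)]
  have "continuous_on W (j \<circ> k')" by simp
  moreover have "inj_on (j \<circ> k') W"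
  proof (rule comp_inj_on)
    show "inj_on k' W" unfolding W_def by (rule inj_on_inverseI[of _ k]) (use k'k in auto)
    show "inj_on j (k' ` W)" unfolding k'W using j(2) inj_on_subset by blast
  qed
  ultimately have "open ((j \<circ> k') ` W)"
    using W(1) dim by (intro invariance_of_domain_gen) auto
  moreover have "(j \<circ> k') ` W = j ` (U \<inter> N)" by (simp only: image_comp[symmetric] k'W)
  ultimately show thesis using that[of "j ` (U \<inter> N)"] U(2) N(2) by auto
qed

text \<open>The converse direction, from the Euclidean plane into the surface: continuity and
  injectivity give openness. The type is generic in order to serve complex numbers and pairs of
  reals alike.\<close>

lemma invariance_of_domain_planar:
  fixes g :: "'b::euclidean_space \<Rightarrow> 'a"
  assumes dim: "DIM('b) = 2" and pl: "\<And>x. x \<in> topspace X \<Longrightarrow> planar_at X x"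
    and E: "open E" and g: "continuous_map (top_of_set E) X g" "inj_on g E"
  shows "openin X (g ` E)" "homeomorphic_map (top_of_set E) (subtopology X (g ` E)) g"
proof -
  have gX: "g e \<in> topspace X" if "e \<in> E" for e
    using g(1) that by (auto simp: continuous_map_def)
  have op: "openin X (g ` S)" if S: "open S" "S \<subseteq> E" for S
  proof (subst openin_subopen, intro ballI)
    fix y assume "y \<in> g ` S"
    then obtain e where e: "e \<in> S" "y = g e" by blast
    then have "y \<in> topspace X" using gX S(2) by blast
    then obtain U V k k' where U: "openin X U" "y \<in> U" "open (V :: (real \<times> real) set)"
      and k: "homeomorphic_maps (subtopology X U) (top_of_set V) k k'"
      using pl planar_atE by metis
    have UX: "U \<subseteq> topspace X" using U openin_subset by blast
    define S' where "S' = S \<inter> {x \<in> E. g x \<in> U}"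
    have "openin (top_of_set E) {x \<in> E. g x \<in> U}"
      using openin_continuous_map_preimage[OF g(1) U(1)] by simp
    then have S': "open S'" using E S unfolding S'_def by (auto simp: openin_open_eq)
    have kc: "continuous_map (subtopology X U) (top_of_set V) k"
      and k'k: "\<And>y. y \<in> U \<Longrightarrow> k' (k y) = y"
      using k UX by (auto simp: homeomorphic_maps_def)
    have "continuous_map (top_of_set S') (subtopology X U) g"
      unfolding continuous_map_in_subtopology
      using continuous_map_from_subtopology_mono[OF g(1), of S'] by (auto simp: S'_def)
    from continuous_map_compose[OF this kc]
    have co: "continuous_on S' (k \<circ> g)" "(k \<circ> g) ` S' \<subseteq> V" by (auto simp: continuous_map_subtopology_eu)
    have "inj_on (k \<circ> g) S'"
    proof (rule comp_inj_on)
      show "inj_on g S'" using g(2) by (rule inj_on_subset) (auto simp: S'_def)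
      show "inj_on k (g ` S')" by (rule inj_on_inverseI[of _ k']) (use k'k in \<open>auto simp: S'_def\<close>)
    qed
    then have "open ((k \<circ> g) ` S')"
      using S' co(1) dim by (intro invariance_of_domain_gen) auto
    then have "openin (top_of_set V) ((k \<circ> g) ` S')" using co(2) U(3) by (simp add: openin_open_eq)
    moreover have "homeomorphic_map (top_of_set V) (subtopology X U) k'"
      using k homeomorphic_maps_map by blast
    ultimately have "openin (subtopology X U) (k' ` ((k \<circ> g) ` S'))"
      using homeomorphic_map_openness_eq by blast
    moreover have "k' ` ((k \<circ> g) ` S') = g ` S'"
      unfolding image_image o_def using k'k by (intro image_cong) (auto simp: S'_def)
    ultimately have "openin X (g ` S')" using U(1) openin_trans_full by metis
    moreover have "y \<in> g ` S'" using e U(2) S(2) by (auto simp: S'_def)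
    ultimately show "\<exists>T. openin X T \<and> y \<in> T \<and> T \<subseteq> g ` S" by (auto simp: S'_def)
  qed
  show "openin X (g ` E)" using op E by blast
  have "open_map (top_of_set E) X g"
    unfolding open_map_def using op E by (auto simp: openin_open_eq)
  then have "embedding_map (top_of_set E) X g"
    by (rule injective_open_imp_embedding_map[OF g(1)]) (use g(2) in simp)
  then show "homeomorphic_map (top_of_set E) (subtopology X (g ` E)) g"
    by (simp add: embedding_map_def)
qed

section \<open>Boundary points do not depend on the chart\<close>

lemma half_plane_boundary_not_interior:
  assumes "open W" "z \<in> W" "W \<subseteq> half_plane" "snd z = 0"
  shows False
proof -
  obtain e where e: "e > 0" "ball z e \<subseteq> W" using assms openE by blast
  have "(fst z, - (e / 2)) \<in> ball z e"
    using e(1) assms(4) by (cases z) (simp add: dist_Pair_Pair dist_real_def)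
  then have "(fst z, - (e / 2)) \<in> half_plane" using e(2) assms(3) by blast
  then show False using e(1) by (simp add: half_plane_def)
qed

lemma unit_circle_not_interior:
  fixes z :: "'b::real_normed_vector"
  assumes "open W" "z \<in> W" "\<And>x. x \<in> W \<Longrightarrow> 1 \<le> norm x" "norm z = 1"
  shows False
proof -
  obtain e where e: "e > 0" "ball z e \<subseteq> W" using assms openE by blast
  define d where "d = min (e / 2) (1 / 2)"
  have d: "0 < d" "d < e" "d < 1" using e by (auto simp: d_def)
  have "dist z ((1 - d) *\<^sub>R z) = d"
    using d assms(4) by (simp add: dist_norm algebra_simps)
  then have "(1 - d) *\<^sub>R z \<in> W" using d e by auto
  then show False using assms(3)[of "(1 - d) *\<^sub>R z"] assms(4) d by simp
qed

text \<open>A boundary point is defined by the existence of one boundary chart; that no other chart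
  makes it interior holds because a half plane is no neighbourhood of its edge points.\<close>

lemma planar_at_mboundary:
  assumes "planar_at X x"
  shows "x \<notin> mboundary X"
proof
  assume "x \<in> mboundary X"
  then obtain U V f where U: "openin X U" "x \<in> U" "openin (top_of_set half_plane) V"
    and f: "homeomorphic_map (subtopology X U) (top_of_set V) f" and f0: "snd (f x) = 0"
    unfolding mboundary_def by blast
  have UX: "U \<subseteq> topspace X" using U openin_subset by blast
  have Vh: "V \<subseteq> half_plane" using U(3) openin_imp_subset by blast
  have tU: "topspace (subtopology X U) = U" using UX by auto
  have inj: "inj_on f U" and im: "f ` U = V"
    using f tU by (auto simp: homeomorphic_eq_everything_map)
  have "continuous_map (subtopology X U) euclidean f"
    using homeomorphic_imp_continuous_map[OF f] continuous_map_in_subtopology by blast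
  then obtain W where "open W" "f x \<in> W" "W \<subseteq> f ` U"
    using planar_nbhd_open_image[OF _ assms U(1,2), of f] inj by auto
  then show False using half_plane_boundary_not_interior[of W "f x"] f0 im Vh by blast
qed

lemma planar_at_half_plane_chart:
  assumes U: "openin X U" "x \<in> U" "openin (top_of_set half_plane) V"
    and f: "homeomorphic_maps (subtopology X U) (top_of_set V) f f'" and pos: "snd (f x) > 0"
  shows "planar_at X x"
proof -
  have UX: "U \<subseteq> topspace X" using U openin_subset by blast
  have tU: "topspace (subtopology X U) = U" using UX by auto
  define V' where "V' = V \<inter> {z. 0 < snd z}"
  define U' where "U' = {y \<in> U. f y \<in> V'}"
  obtain T where T: "open T" "V = half_plane \<inter> T" using U(3) by (auto simp: openin_open)
  have "open {z::real \<times> real. 0 < snd z}" by (intro open_Collect_less continuous_intros)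
  moreover have "V' = T \<inter> {z. 0 < snd z}" using T(2) by (auto simp: V'_def half_plane_def)
  ultimately have oV: "open V'" using T(1) by auto
  have oV': "openin (top_of_set V) V'" using oV by (auto simp: V'_def openin_open)
  have cf: "continuous_map (subtopology X U) (top_of_set V) f" using f by (simp add: homeomorphic_maps_def)
  have "openin (subtopology X U) U'"
    using openin_continuous_map_preimage[OF cf oV'] unfolding tU U'_def .
  then have oU: "openin X U'" using U(1) openin_trans_full by blast
  have f': "f' z \<in> U" "f (f' z) = z" if "z \<in> V" for z
    using f that tU by (auto simp: homeomorphic_maps_def continuous_map_def)
  have "f ` (topspace (subtopology X U) \<inter> U') = topspace (top_of_set V) \<inter> V'"
    unfolding tU
  proof (intro equalityI subsetI)
    fix z assume "z \<in> topspace (top_of_set V) \<inter> V'"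
    then have "f' z \<in> U \<inter> U'" "z = f (f' z)" using f'[of z] by (auto simp: U'_def V'_def)
    then show "z \<in> f ` (U \<inter> U')" by blast
  qed (auto simp: U'_def V'_def)
  from homeomorphic_maps_subtopologies[OF f this]
  have "homeomorphic_maps (subtopology X U') (top_of_set V') f f'"
  proof -
    have "U \<inter> U' = U'" "V \<inter> V' = V'" by (auto simp: U'_def V'_def)
    then show ?thesis
      using \<open>homeomorphic_maps (subtopology (subtopology X U) U') (subtopology (top_of_set V) V') f f'\<close>
      by (simp only: subtopology_subtopology)
  qed
  moreover have "f x \<in> V" using cf U(2) tU by (auto simp: continuous_map_def)
  ultimately show ?thesis
    unfolding planar_at_def using oU oV U(2) pos by (auto simp: homeomorphic_space_def U'_def V'_def)
qed

lemma mboundary_half_plane_chart: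
  assumes U: "openin X U" "x \<in> U" "openin (top_of_set half_plane) V"
    and f: "homeomorphic_maps (subtopology X U) (top_of_set V) f f'"
  shows "x \<in> mboundary X \<longleftrightarrow> snd (f x) = 0"
proof
  have xX: "x \<in> topspace X" using U openin_subset by blast
  have "f x \<in> V" using f U(2) xX by (auto simp: homeomorphic_maps_def continuous_map_def)
  then have ge: "snd (f x) \<ge> 0" using U(3) openin_imp_subset unfolding half_plane_def by blast
  show "snd (f x) = 0" if "x \<in> mboundary X"
  proof (rule ccontr)
    assume "snd (f x) \<noteq> 0"
    then have "planar_at X x" using planar_at_half_plane_chart[OF U f] ge by simp
    then show False using planar_at_mboundary that by metis
  qed
  show "x \<in> mboundary X" if "snd (f x) = 0"
    unfolding mboundary_def using that xX U f homeomorphic_maps_map by blast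
qed

lemma not_mboundary_imp_planar:
  assumes X: "surface_wb X" and x: "x \<in> topspace X" "x \<notin> mboundary X"
  shows "planar_at X x"
proof -
  obtain U V where U: "openin X U" "x \<in> U" "openin (top_of_set half_plane) V"
    and UV: "subtopology X U homeomorphic_space top_of_set V"
    using X x(1) unfolding surface_wb_def by blast
  obtain f f' where f: "homeomorphic_maps (subtopology X U) (top_of_set V) f f'"
    using UV by (auto simp: homeomorphic_space_def)
  have "f x \<in> V" using f U(2) x(1) by (auto simp: homeomorphic_maps_def continuous_map_def)
  then have "snd (f x) \<ge> 0" using U(3) openin_imp_subset unfolding half_plane_def by blast
  moreover have "snd (f x) \<noteq> 0" using mboundary_half_plane_chart[OF U f] x(2) by simp
  ultimately show ?thesis using planar_at_half_plane_chart[OF U f] by simp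
qed

text \<open>Scaling a direction by one plus the height lays the half cylinder out as the complement
  of the open unit disc. Positive heights give a planar chart, while at height 0 the image lies
  outside the unit disc and so is no neighbourhood.\<close>

lemma mboundary_half_cylinder_chart:
  assumes X: "surface_wb X" and U: "openin X U" "x \<in> U"
    and u: "homeomorphic_maps (subtopology X U) half_cylinder_top u u'"
  shows "x \<in> mboundary X \<longleftrightarrow> snd (u x) = 0"
proof
  have UX: "U \<subseteq> topspace X" using U openin_subset by blast
  have tU: "topspace (subtopology X U) = U" using UX by auto
  have cu: "continuous_map (subtopology X U) (top_of_set (sphere 0 1 \<times> {0..})) u"
    and cu': "continuous_map (top_of_set (sphere 0 1 \<times> {0..})) (subtopology X U) u'"
    and u'u: "\<And>y. y \<in> U \<Longrightarrow> u' (u y) = y" and uu': "\<And>q. q \<in> sphere 0 1 \<times> {0..} \<Longrightarrow> u (u' q) = q"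
    using u tU by (auto simp: homeomorphic_maps_def half_cylinder_top_def)
  have uC: "u y \<in> sphere 0 1 \<times> {0..}" if "y \<in> U" for y
    using cu that tU by (auto simp: continuous_map_def)
  define J :: "(real \<times> real) \<times> real \<Rightarrow> real \<times> real" where "J = (\<lambda>q. (1 + snd q) *\<^sub>R fst q)"
  have nJ: "norm (J q) = 1 + snd q" if "q \<in> sphere 0 1 \<times> {0..}" for q
    using that by (cases q) (simp add: J_def)
  have contJ: "continuous_on S J" for S unfolding J_def by (intro continuous_intros)
  have "inj_on J (sphere 0 1 \<times> {0..})"
  proof (rule inj_onI)
    fix p q :: "(real \<times> real) \<times> real"
    assume pq: "p \<in> sphere 0 1 \<times> {0..}" "q \<in> sphere 0 1 \<times> {0..}" and eq: "J p = J q"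
    then have s: "snd p = snd q" using nJ[OF pq(1)] nJ[OF pq(2)] by simp
    moreover have "1 + snd q \<noteq> 0" using pq(2) by (cases q) auto
    ultimately have "fst p = fst q" using eq by (simp add: J_def)
    then show "p = q" using s by (simp add: prod_eq_iff)
  qed
  then have "inj_on J (u ` U)" by (rule inj_on_subset) (use uC in blast)
  moreover have "inj_on u U" by (rule inj_on_inverseI[of _ u']) (rule u'u)
  ultimately have injJu: "inj_on (J \<circ> u) U"
    by (intro comp_inj_on)
  have "continuous_map (top_of_set (sphere 0 1 \<times> {0..})) euclidean J" using contJ by simp
  from continuous_map_compose[OF cu this]
  have cJu: "continuous_map (subtopology X U) euclidean (J \<circ> u)" .
  show "snd (u x) = 0" if "x \<in> mboundary X"
  proof (rule ccontr)
    assume "snd (u x) \<noteq> 0"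
    then have pos: "snd (u x) > 0" using uC[OF U(2)] by (cases "u x") auto
    define U' where "U' = {y \<in> U. u y \<in> {q. 0 < snd q}}"
    have "open {q::(real \<times> real) \<times> real. 0 < snd q}" by (intro open_Collect_less continuous_intros)
    then have "openin euclidean {q::(real \<times> real) \<times> real. 0 < snd q}" by simp
    from openin_continuous_map_preimage[OF continuous_map_into_fulltopology[OF cu] this]
    have "openin (subtopology X U) U'" unfolding tU U'_def .
    then have oU: "openin X U'" using U(1) openin_trans_full by blast
    define V where "V = {z :: real \<times> real. 1 < norm z}"
    have oV: "open V" unfolding V_def by (intro open_Collect_less continuous_intros)
    define J' :: "real \<times> real \<Rightarrow> (real \<times> real) \<times> real" where "J' = (\<lambda>z. (z /\<^sub>R norm z, norm z - 1))"
    have J'C: "J' z \<in> sphere 0 1 \<times> {0..}" "0 < snd (J' z)" "J (J' z) = z" if "z \<in> V" for z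
    proof -
      have n: "norm z > 1" using that by (simp add: V_def)
      then have "norm z \<noteq> 0" by linarith
      then show "J' z \<in> sphere 0 1 \<times> {0..}" "0 < snd (J' z)" "J (J' z) = z"
        using n by (simp_all add: J'_def J_def)
    qed
    have "homeomorphic_maps (subtopology X U') (top_of_set V) (J \<circ> u) (u' \<circ> J')"
      unfolding homeomorphic_maps_def
    proof (intro conjI ballI)
      have "continuous_map (subtopology X U') euclidean (J \<circ> u)"
        by (rule continuous_map_from_subtopology_mono[OF cJu]) (auto simp: U'_def)
      then show "continuous_map (subtopology X U') (top_of_set V) (J \<circ> u)"
        unfolding continuous_map_in_subtopology
        using nJ uC by (fastforce simp: U'_def V_def)
      have cJ': "continuous_on V J'" unfolding J'_def V_def by (intro continuous_intros) auto
      have "continuous_map (top_of_set V) (top_of_set (sphere 0 1 \<times> {0..})) J'"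
        unfolding continuous_map_subtopology_eu using cJ' J'C(1) by blast
      from continuous_map_compose[OF this continuous_map_into_fulltopology[OF cu']]
      have c: "continuous_map (top_of_set V) X (u' \<circ> J')" .
      have "u' (J' z) \<in> U'" if "z \<in> V" for z
      proof -
        have "u' (J' z) \<in> U" using cu' J'C(1)[OF that] tU by (auto simp: continuous_map_def)
        then show ?thesis using uu'[OF J'C(1)[OF that]] J'C(2)[OF that] by (simp add: U'_def)
      qed
      then show "continuous_map (top_of_set V) (subtopology X U') (u' \<circ> J')"
        unfolding continuous_map_in_subtopology using c by auto
      show "(u' \<circ> J') ((J \<circ> u) y) = y" if "y \<in> topspace (subtopology X U')" for y
      proof -
        have y: "y \<in> U" using that by (simp add: U'_def)
        have "norm (fst (u y)) = 1" "snd (u y) \<ge> 0" using uC[OF y] by (cases "u y"; auto)+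
        then have "J' (J (u y)) = u y" by (simp add: J'_def J_def prod_eq_iff)
        then show ?thesis using u'u[OF y] by simp
      qed
      show "(J \<circ> u) ((u' \<circ> J') z) = z" if "z \<in> topspace (top_of_set V)" for z
        using J'C[of z] uu' that by simp
    qed
    then have "planar_at X x"
      unfolding planar_at_def using oU oV U(2) pos by (auto simp: homeomorphic_space_def U'_def)
    then show False using planar_at_mboundary that by metis
  qed
  show "x \<in> mboundary X" if 0: "snd (u x) = 0"
  proof (rule ccontr)
    assume "x \<notin> mboundary X"
    with U(2) UX have "planar_at X x" by (intro not_mboundary_imp_planar X) auto
    then obtain W where W: "open W" "(J \<circ> u) x \<in> W" "W \<subseteq> (J \<circ> u) ` U"
      using planar_nbhd_open_image[OF _ _ U(1,2) cJu injJu] by auto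
    have "1 \<le> norm z" if zW: "z \<in> W" for z
    proof -
      obtain y where y: "y \<in> U" "z = J (u y)" using W(3) zW by auto
      then have "norm z = 1 + snd (u y)" using nJ uC by blast
      moreover have "snd (u y) \<ge> 0" using uC[OF y(1)] by (cases "u y") auto
      ultimately show ?thesis by simp
    qed
    moreover have "norm ((J \<circ> u) x) = 1" using nJ[OF uC[OF U(2)]] 0 by simp
    ultimately show False using unit_circle_not_interior[OF W(1,2)] by blast
  qed
qed

section \<open>Collars\<close>

text \<open>One pipe together with one cylinder chart of it. That the circle is open in the boundary
  of \<open>K\<close> separates it from the other boundary circles.\<close>

locale collar =
  fixes F :: "'a topology" and K P U :: "'a set" and u :: "'a \<Rightarrow> (real \<times> real) \<times> real" and u'
  assumes haus: "Hausdorff_space F" and pl: "\<And>x. x \<in> topspace F \<Longrightarrow> planar_at F x"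
    and K: "K \<subseteq> topspace F" "surface_wb (subtopology F K)"
    and P: "P \<subseteq> topspace F" "surface_wb (subtopology F P)"
    and PK: "P \<inter> K = mboundary (subtopology F P)"
    and D: "openin (subtopology F (mboundary (subtopology F K))) (mboundary (subtopology F P))"
    and U: "openin (subtopology F P) U" "mboundary (subtopology F P) \<subseteq> U"
    and u: "homeomorphic_maps (subtopology F U) half_cylinder_top u u'"
begin

abbreviation "D \<equiv> mboundary (subtopology F P)"
abbreviation "M \<equiv> mboundary (subtopology F K)"
abbreviation "N \<equiv> {y \<in> U. 0 < snd (u y)}"

lemma UP: "U \<subseteq> P" and UF: "U \<subseteq> topspace F"
  using U(1) P(1) openin_subset by fastforce+

lemma tU: "topspace (subtopology F U) = U"
  using UF by auto

lemma cu: "continuous_map (subtopology F U) (top_of_set (sphere 0 1 \<times> {0..})) u"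
  and cu': "continuous_map (top_of_set (sphere 0 1 \<times> {0..})) (subtopology F U) u'"
  and u'u: "y \<in> U \<Longrightarrow> u' (u y) = y"
  and uu': "q \<in> sphere 0 1 \<times> {0..} \<Longrightarrow> u (u' q) = q"
  using u unfolding homeomorphic_maps_def half_cylinder_top_def tU by auto

lemma u_in: "y \<in> U \<Longrightarrow> u y \<in> sphere 0 1 \<times> {0..}"
  and u'_in: "q \<in> sphere 0 1 \<times> {0..} \<Longrightarrow> u' q \<in> U"
  using cu cu' unfolding continuous_map_def tU by auto

lemma cu'F: "continuous_map (top_of_set (sphere 0 1 \<times> {0..})) F u'"
  using cu' continuous_map_into_fulltopology by blast

lemma D_iff: "y \<in> U \<Longrightarrow> y \<in> D \<longleftrightarrow> snd (u y) = 0"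
  using mboundary_half_cylinder_chart[OF P(2) U(1), of y u u'] u UP
  by (simp add: subtopology_subtopology Int_absorb1)

lemma DM: "D \<subseteq> M"
  using D openin_subset by fastforce

lemma K_iff: "y \<in> U \<Longrightarrow> y \<in> K \<longleftrightarrow> snd (u y) = 0"
  using D_iff PK UP by blast

lemma u_nonneg: "y \<in> U \<Longrightarrow> 0 \<le> snd (u y)" and u_sphere: "y \<in> U \<Longrightarrow> fst (u y) \<in> sphere 0 1"
  using u_in[of y] by (cases "u y"; auto)+

text \<open>The chart domain \<open>U\<close> is open in the pipe only. Its part of positive height
  is an injective continuous image of the punctured plane, so invariance of domain makes it open in
  the surface.\<close>

lemma N_open: "openin F N"
  and N_maps: "homeomorphic_maps (subtopology F N) (top_of_set (sphere 0 1 \<times> {0<..})) u u'"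
proof -
  have pm: "continuous_map (top_of_set (- {0})) (top_of_set (sphere 0 1 \<times> {0<..})) polar_inv"
    and pp: "\<And>z. z \<noteq> 0 \<Longrightarrow> polar (polar_inv z) = z"
    and pq: "\<And>q. q \<in> sphere 0 1 \<times> {0<..} \<Longrightarrow> polar_inv (polar q) = q \<and> polar q \<noteq> 0"
    using polar_homeomorphic_maps by (auto simp: homeomorphic_maps_def continuous_map_def)
  have sub: "sphere 0 1 \<times> {0<..} \<subseteq> sphere (0::real \<times> real) 1 \<times> {0::real..}" by auto
  have pin: "polar_inv z \<in> sphere 0 1 \<times> {0<..}" if "z \<noteq> 0" for z
    using pm that by (auto simp: continuous_map_def)
  have "continuous_map (top_of_set (sphere 0 1 \<times> {0<..})) F u'"
    by (rule continuous_map_from_subtopology_mono[OF cu'F sub])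
  from continuous_map_compose[OF pm this]
  have c: "continuous_map (top_of_set (- {0})) F (u' \<circ> polar_inv)" .
  have inj: "inj_on (u' \<circ> polar_inv) (- {0})"
  proof (rule comp_inj_on)
    show "inj_on polar_inv (- {0})" by (rule inj_on_inverseI[of _ polar]) (use pp in auto)
    show "inj_on u' (polar_inv ` (- {0}))"
      by (rule inj_on_inverseI[of _ u]) (use pin uu' sub in blast)
  qed
  have im: "(u' \<circ> polar_inv) ` (- {0}) = N"
  proof (intro equalityI subsetI)
    fix y assume "y \<in> (u' \<circ> polar_inv) ` (- {0})"
    then obtain z where z: "z \<noteq> 0" "y = u' (polar_inv z)" by auto
    have "polar_inv z \<in> sphere 0 1 \<times> {0..}" "0 < snd (polar_inv z)"
      using pin[OF z(1)] by (cases "polar_inv z"; simp)+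
    then show "y \<in> N" using z u'_in uu' by simp
  next
    fix y assume y: "y \<in> N"
    then have "u y \<in> sphere 0 1 \<times> {0<..}" using u_in[of y] by (cases "u y") auto
    then have "y = (u' \<circ> polar_inv) (polar (u y))" "polar (u y) \<in> - {0}" using pq u'u y by auto
    then show "y \<in> (u' \<circ> polar_inv) ` (- {0})" by blast
  qed
  show "openin F N"
    using invariance_of_domain_planar(1)[OF _ pl open_Compl[OF closed_singleton] c inj] im by simp
  have "homeomorphic_maps (subtopology (subtopology F U) N) (subtopology (top_of_set (sphere 0 1 \<times> {0..})) (sphere 0 1 \<times> {0<..})) u u'"
  proof (rule homeomorphic_maps_subtopologies_alt)
    show "homeomorphic_maps (subtopology F U) (top_of_set (sphere 0 1 \<times> {0..})) u u'"
      using u by (simp add: half_cylinder_top_def)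
    show "u ` (topspace (subtopology F U) \<inter> N) \<subseteq> sphere 0 1 \<times> {0<..}"
      unfolding tU
    proof
      fix q assume "q \<in> u ` (U \<inter> N)"
      then show "q \<in> sphere 0 1 \<times> {0<..}" using u_in by (cases q) force
    qed
    show "u' ` (topspace (top_of_set (sphere 0 1 \<times> {0..})) \<inter> sphere 0 1 \<times> {0<..}) \<subseteq> N"
      using u'_in uu' by auto
  qed
  moreover have "U \<inter> N = N" by blast
  ultimately show "homeomorphic_maps (subtopology F N) (top_of_set (sphere 0 1 \<times> {0<..})) u u'"
    using sub by (simp add: subtopology_subtopology Int_absorb1)
qed

text \<open>A boundary chart of \<open>K\<close> is continued across the boundary circle along the lines of the collar.\<close>
lemma glued_chart:
  assumes x: "x \<in> D"
  obtains a0 e g \<kappa> where "e > 0" "openin F (g ` (ball a0 e \<times> {-e<..}))"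
    "homeomorphic_map (top_of_set (ball a0 e \<times> {-e<..})) (subtopology F (g ` (ball a0 e \<times> {-e<..}))) g"
    "g (a0, 0) = x" "continuous_on (ball (a0::real) e) \<kappa>" "\<kappa> \<in> ball a0 e \<rightarrow> sphere 0 1"
    "\<And>a s. a \<in> ball a0 e \<Longrightarrow> s < 0 \<Longrightarrow> -e < s \<Longrightarrow> g (a, s) \<in> K - M"
    "\<And>a s. a \<in> ball a0 e \<Longrightarrow> 0 \<le> s \<Longrightarrow> g (a, s) \<in> U \<and> u (g (a, s)) = (\<kappa> a, s)"
proof -
  have xM: "x \<in> M" and xK: "x \<in> K" using x DM PK by auto
  then obtain V V0 where V: "openin (subtopology F K) V" "x \<in> V" "openin (top_of_set half_plane) V0"
    and VV: "subtopology (subtopology F K) V homeomorphic_space top_of_set V0"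
    using K unfolding surface_wb_def by (metis topspace_subtopology_subset)
  obtain v v' where v: "homeomorphic_maps (subtopology (subtopology F K) V) (top_of_set V0) v v'"
    using VV by (auto simp: homeomorphic_space_def)
  have VK: "V \<subseteq> K" using V(1) openin_subset by fastforce
  have VF: "V \<subseteq> topspace F" using VK K by blast
  have sV: "subtopology (subtopology F K) V = subtopology F V"
    using VK by (simp add: subtopology_subtopology Int_absorb1)
  have tV: "topspace (subtopology F V) = V" using VF by auto
  have cv': "continuous_map (top_of_set V0) (subtopology F V) v'"
    and v'v: "\<And>y. y \<in> V \<Longrightarrow> v' (v y) = y" and vv': "\<And>z. z \<in> V0 \<Longrightarrow> v (v' z) = z"
    and v_in: "\<And>y. y \<in> V \<Longrightarrow> v y \<in> V0" and v'_in: "\<And>z. z \<in> V0 \<Longrightarrow> v' z \<in> V"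
    using v tV unfolding sV by (auto simp: homeomorphic_maps_def continuous_map_def)
  have cv'F: "continuous_map (top_of_set V0) F v'"
    using cv' continuous_map_into_fulltopology by blast
  have M_iff: "v' z \<in> M \<longleftrightarrow> snd z = 0" if "z \<in> V0" for z
    using mboundary_half_plane_chart[OF V(1) v'_in[OF that] V(3) v] vv'[OF that] by simp
  define a0 where "a0 = fst (v x)"
  have vx: "v x = (a0, 0)"
    using M_iff[OF v_in[OF V(2)]] v'v[OF V(2)] xM by (simp add: a0_def prod_eq_iff)
  \<comment> \<open>Restricting the chart of \<open>K\<close> to \<open>Q\<close> keeps all its
    boundary points on this one circle.\<close>
  obtain Q where Q: "openin F Q" "D = Q \<inter> M" using D by (auto simp: openin_subtopology)
  define G where "G = {z \<in> V0. v' z \<in> Q}"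
  have "openin (top_of_set V0) G"
    using openin_continuous_map_preimage[OF cv'F Q(1)] by (simp add: G_def)
  then have "openin (top_of_set half_plane) G" using V(3) openin_trans by blast
  then obtain T where T: "open T" "G = half_plane \<inter> T" by (auto simp: openin_open)
  have "(a0, 0) \<in> G" using v_in[OF V(2)] v'v[OF V(2)] vx Q(2) x by (auto simp: G_def)
  then obtain r where r: "r > 0" "ball (a0, 0) r \<subseteq> T" using T openE by blast
  \<comment> \<open>A box with both side bounds r/2 fits into the ball, as the product distance is
    at most the sum of the two distances.\<close>
  define e where "e = r / 2"
  have e: "e > 0" using r by (simp add: e_def)
  define I where "I = ball a0 e"
  have inG: "(a, b) \<in> G" if "a \<in> I" "0 \<le> b" "b < e" for a b
  proof -
    have "dist (a0, 0) (a, b) \<le> dist a0 a + dist 0 b"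
      unfolding dist_Pair_Pair by (rule sqrt_sum_squares_le_sum) auto
    also have "\<dots> < r" using that by (simp add: I_def e_def)
    finally have "(a, b) \<in> T" using r(2) by auto
    then show ?thesis using that(2) T(2) by (simp add: half_plane_def)
  qed
  then have inV0: "(a, b) \<in> V0" if "a \<in> I" "0 \<le> b" "b < e" for a b using that by (auto simp: G_def)
  have base: "v' (a, 0) \<in> D" if "a \<in> I" for a
    using inG[OF that, of 0] M_iff[of "(a, 0)"] e Q(2) by (auto simp: G_def)
  \<comment> \<open>The position on the circle of the boundary point with parameter
    \<open>a\<close>; it labels the collar line that continues the chart.\<close>
  define \<kappa> where "\<kappa> = (\<lambda>a. fst (u (v' (a, 0))))"
  have u\<kappa>: "u (v' (a, 0)) = (\<kappa> a, 0)" "u' (\<kappa> a, 0) = v' (a, 0)" if "a \<in> I" for a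
  proof -
    have d: "v' (a, 0) \<in> U" "snd (u (v' (a, 0))) = 0" using base[OF that] U(2) D_iff by blast+
    then show "u (v' (a, 0)) = (\<kappa> a, 0)" by (simp add: \<kappa>_def prod_eq_iff)
    then show "u' (\<kappa> a, 0) = v' (a, 0)" using u'u[OF d(1)] by simp
  qed
  have \<kappa>S: "\<kappa> a \<in> sphere 0 1" if "a \<in> I" for a
    using base[OF that] U(2) u_sphere unfolding \<kappa>_def by blast
  have cont\<kappa>: "continuous_on I \<kappa>"
  proof -
    have "continuous_map (top_of_set I) (top_of_set V0) (\<lambda>a. (a, 0))"
      unfolding continuous_map_subtopology_eu using inV0 e by (auto intro!: continuous_intros)
    from continuous_map_compose[OF this cv'F]
    have "continuous_map (top_of_set I) (subtopology F U) (\<lambda>a. v' (a, 0))"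
      unfolding continuous_map_in_subtopology o_def using base U(2) by auto
    from continuous_map_compose[OF this continuous_map_into_fulltopology[OF cu]]
    have "continuous_on I (\<lambda>a. u (v' (a, 0)))" by (simp add: o_def)
    then show ?thesis unfolding \<kappa>_def by (rule continuous_on_fst)
  qed
  \<comment> \<open>Negative heights use the chart of \<open>K\<close> turned upside down, positive
    heights follow the collar line without bound. Both give the same point at height 0.\<close>
  define g where "g = (\<lambda>z. if snd z \<le> 0 then v' (fst z, - snd z) else u' (\<kappa> (fst z), snd z))"
  define E where "E = I \<times> {-e<..}"
  have gpos: "g (a, s) \<in> U \<and> u (g (a, s)) = (\<kappa> a, s)" if "a \<in> I" "0 \<le> s" for a s
  proof (cases "s = 0")
    case True
    then show ?thesis using base[OF that(1)] U(2) u\<kappa>[OF that(1)] by (auto simp: g_def)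
  next
    case False
    then show ?thesis using \<kappa>S[OF that(1)] that uu'[of "(\<kappa> a, s)"] u'_in[of "(\<kappa> a, s)"] by (auto simp: g_def)
  qed
  have gneg: "g (a, s) \<in> K - M" if "a \<in> I" "s < 0" "-e < s" for a s
  proof -
    have "(a, -s) \<in> V0" using inV0 that by simp
    then show ?thesis using M_iff[of "(a, -s)"] v'_in VK that by (auto simp: g_def)
  qed
  have oE: "open E" by (auto simp: E_def I_def intro: open_Times)
  have ginj: "inj_on g E"
  proof (rule inj_onI)
    fix z z' assume z: "z \<in> E" "z' \<in> E" and eq: "g z = g z'"
    obtain a s a' s' where zz: "z = (a, s)" "z' = (a', s')" by (meson surj_pair)
    have I: "a \<in> I" "a' \<in> I" "-e < s" "-e < s'" using z by (auto simp: E_def zz)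
    \<comment> \<open>The two halves meet only along the circle, and negative heights avoid the
      boundary of \<open>K\<close>.\<close>
    have pn: False if "0 \<le> t" "t' < 0" "-e < t'" "b \<in> I" "b' \<in> I" "g (b, t) = g (b', t')" for b b' t t'
    proof -
      have k: "g (b', t') \<in> K - M" using gneg that by blast
      then have "snd (u (g (b, t))) = 0" using gpos[OF that(4,1)] K_iff that(6) by auto
      then have "g (b, t) \<in> D" using gpos[OF that(4,1)] D_iff by blast
      then show False using DM k that(6) by auto
    qed
    consider "s < 0" "s' < 0" | "0 \<le> s" "0 \<le> s'" | "0 \<le> s" "s' < 0" | "s < 0" "0 \<le> s'" by linarith
    then show "z = z'"
    proof cases
      case 1
      then have "v' (a, -s) = v' (a', -s')" using eq by (simp add: zz g_def)
      moreover have "(a, -s) \<in> V0" "(a', -s') \<in> V0" using inV0 I 1 by auto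
      ultimately have "(a, -s) = (a', -s')" using vv' by metis
      then show ?thesis by (simp add: zz)
    next
      case 2
      then have e: "(\<kappa> a, s) = (\<kappa> a', s')" using gpos[OF I(1), of s] gpos[OF I(2), of s'] eq zz by metis
      then have "v' (a, 0) = v' (a', 0)" using u\<kappa>(2) I by (metis Pair_inject)
      moreover have "(a, 0) \<in> V0" "(a', 0) \<in> V0" using inV0 I \<open>e > 0\<close> by auto
      ultimately have "a = a'" using vv' by (metis Pair_inject)
      then show ?thesis using e by (simp add: zz)
    next
      case 3
      then show ?thesis using pn[of s s' a a'] I eq zz by blast
    next
      case 4
      then show ?thesis using pn[of s' s a' a] I eq zz by metis
    qed
  qed
  have gcont: "continuous_map (top_of_set E) F g"
    unfolding g_def
  proof (rule continuous_map_cases_le)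
    have 1: "continuous_map (top_of_set {z \<in> E. snd z \<le> 0}) (top_of_set V0) (\<lambda>z. (fst z, - snd z))"
      unfolding continuous_map_subtopology_eu
      by (auto intro!: continuous_intros inV0 simp: E_def)
    show "continuous_map (subtopology (top_of_set E) {x \<in> topspace (top_of_set E). snd x \<le> 0}) F (\<lambda>z. v' (fst z, - snd z))"
      using continuous_map_compose[OF 1 cv'F] by (simp add: subtopology_subtopology o_def Collect_conj_eq[symmetric] Int_def)
    have 2: "continuous_map (top_of_set {z \<in> E. 0 \<le> snd z}) (top_of_set (sphere 0 1 \<times> {0..})) (\<lambda>z. (\<kappa> (fst z), snd z))"
      unfolding continuous_map_subtopology_eu
    proof
      show "continuous_on {z \<in> E. 0 \<le> snd z} (\<lambda>z. (\<kappa> (fst z), snd z))"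
        by (intro continuous_intros continuous_on_compose2[OF cont\<kappa>]) (auto simp: E_def)
      show "(\<lambda>z. (\<kappa> (fst z), snd z)) \<in> {z \<in> E. 0 \<le> snd z} \<rightarrow> sphere 0 1 \<times> {0..}"
        using \<kappa>S by (auto simp: E_def)
    qed
    show "continuous_map (subtopology (top_of_set E) {x \<in> topspace (top_of_set E). 0 \<le> snd x}) F (\<lambda>z. u' (\<kappa> (fst z), snd z))"
      using continuous_map_compose[OF 2 cu'F] by (simp add: subtopology_subtopology o_def Collect_conj_eq[symmetric] Int_def)
    show "v' (fst z, - snd z) = u' (\<kappa> (fst z), snd z)" if "z \<in> topspace (top_of_set E)" "snd z = 0" for z
      using that u\<kappa>(2)[of "fst z"] by (auto simp: E_def)
  qed (auto intro!: continuous_intros)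
  show thesis
  proof (rule that[OF e, of g a0 \<kappa>], fold I_def, fold E_def)
    show "openin F (g ` E)"
      by (rule invariance_of_domain_planar(1)[OF _ pl oE gcont ginj]) auto
    show "homeomorphic_map (top_of_set E) (subtopology F (g ` E)) g"
      by (rule invariance_of_domain_planar(2)[OF _ pl oE gcont ginj]) auto
    show "g (a0, 0) = x" using v'v[OF V(2)] vx by (simp add: g_def)
    show "\<kappa> \<in> I \<rightarrow> sphere 0 1" using \<kappa>S by blast
  qed (use cont\<kappa> gneg gpos in auto)
qed

end

section \<open>Ends of a pipe, and pushing the core along a collar\<close>

context collar
begin

lemma collar_set_eq:
  assumes "S \<subseteq> {0..}"
  shows "{y \<in> U. snd (u y) \<in> S} = u' ` (sphere 0 1 \<times> S)"
proof (intro equalityI subsetI)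
  fix y assume "y \<in> {y \<in> U. snd (u y) \<in> S}"
  then have "y = u' (u y)" "u y \<in> sphere 0 1 \<times> S" using u'u u_in[of y] by (auto simp: mem_Times_iff)
  then show "y \<in> u' ` (sphere 0 1 \<times> S)" by (rule image_eqI)
next
  fix y assume "y \<in> u' ` (sphere 0 1 \<times> S)"
  then obtain q where q: "q \<in> sphere 0 1 \<times> S" "y = u' q" by blast
  then have "q \<in> sphere 0 1 \<times> {0..}" using assms by auto
  then show "y \<in> {y \<in> U. snd (u y) \<in> S}" using q u'_in uu' by auto
qed

lemma compactin_collar: "compactin F {y \<in> U. snd (u y) \<le> s}"
proof -
  have "{y \<in> U. snd (u y) \<le> s} = {y \<in> U. snd (u y) \<in> {0..s}}" using u_nonneg by auto
  also have "\<dots> = u' ` (sphere 0 1 \<times> {0..s})" by (rule collar_set_eq) auto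
  finally have eq: "{y \<in> U. snd (u y) \<le> s} = u' ` (sphere 0 1 \<times> {0..s})" .
  have "compactin (top_of_set (sphere 0 1 \<times> {0..})) (sphere (0::real \<times> real) 1 \<times> {0..s})"
    unfolding compactin_subtopology by (auto intro: compact_Times)
  from image_compactin[OF this cu'F] show ?thesis unfolding eq .
qed

lemma closedin_collar: "closedin F {y \<in> U. snd (u y) \<le> s}"
  by (rule compactin_imp_closedin[OF haus compactin_collar])

lemma openin_collar: "openin (subtopology F P) {y \<in> U. snd (u y) < s}"
proof -
  have "open {q::(real \<times> real) \<times> real. snd q < s}" by (intro open_Collect_less continuous_intros)
  then have "openin euclidean {q::(real \<times> real) \<times> real. snd q < s}" by simp
  from openin_continuous_map_preimage[OF continuous_map_into_fulltopology[OF cu] this]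
  have "openin (subtopology F U) {y \<in> U. snd (u y) < s}" unfolding tU by simp
  moreover have "subtopology F U = subtopology (subtopology F P) U"
    using UP by (simp add: subtopology_subtopology Int_absorb1)
  ultimately show ?thesis using U(1) openin_trans_full by metis
qed

lemma connectedin_collar_end: "s \<ge> 0 \<Longrightarrow> connectedin F {y \<in> U. s \<le> snd (u y)}"
proof -
  assume s: "s \<ge> 0"
  have "{y \<in> U. s \<le> snd (u y)} = u' ` (sphere 0 1 \<times> {s..})"
    using collar_set_eq[of "{s..}"] s by auto
  moreover have "connected (sphere (0::real \<times> real) 1 \<times> {s..})"
    by (intro connected_Times connected_sphere) auto
  then have "connectedin (top_of_set (sphere 0 1 \<times> {0..})) (sphere (0::real \<times> real) 1 \<times> {s..})"
    using s by (auto simp: connectedin_subtopology)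
  ultimately show ?thesis using connectedin_continuous_map_image[OF cu'F] by metis
qed

text \<open>The cylindrical part of the end is connected, so one piece of a separation would miss
  it; that piece would be clopen in the whole pipe.\<close>

lemma connectedin_pipe_end:
  assumes s: "s > 0"
  shows "connectedin F (P - {y \<in> U. snd (u y) < s})"
proof -
  define E where "E = P - {y \<in> U. snd (u y) < s}"
  define T where "T = {y \<in> U. s \<le> snd (u y)}"
  define Q where "Q = {y \<in> U. snd (u y) \<le> s}"
  have tP: "topspace (subtopology F P) = P" using P(1) by auto
  have conP: "connected_space (subtopology F P)" using P(2) by (simp add: surface_wb_def)
  have key: False if A: "openin F A" and B: "openin F B" and cov: "E \<subseteq> A \<union> B" and dis: "A \<inter> B \<inter> E = {}"
    and ne: "A \<inter> E \<noteq> {}" and TA: "T \<inter> A = {}" for A B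
  proof -
    \<comment> \<open>Removing the closed collar \<open>Q\<close> makes the piece open and disjoint
      from \<open>U\<close>; its complement is the other piece without \<open>Q\<close> together
      with the open set \<open>U\<close>, hence open too.\<close>
    define Z where "Z = A \<inter> P - Q"
    have clQ: "closedin (subtopology F P) Q"
      unfolding Q_def using closedin_collar UP by (intro closedin_subset_topspace) auto
    have oZ: "openin (subtopology F P) (A' \<inter> P - Q)" if "openin F A'" for A'
      using that clQ by (intro openin_diff) (auto simp: openin_subtopology_Int)
    have ZU: "Z \<inter> U = {}"
    proof -
      have "y \<notin> A" if "y \<in> U" "y \<notin> Q" for y using that TA by (auto simp: T_def Q_def)
      then show ?thesis by (auto simp: Z_def)
    qed
    have "P - Z = (B \<inter> P - Q) \<union> U"
    proof (intro equalityI subsetI)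
      fix y assume y: "y \<in> P - Z"
      show "y \<in> (B \<inter> P - Q) \<union> U"
      proof (cases "y \<in> U")
        case False
        then have "y \<in> E" "y \<notin> Q" using y by (auto simp: E_def Q_def)
        then show ?thesis using y cov by (auto simp: Z_def)
      qed simp
    next
      fix y assume y: "y \<in> (B \<inter> P - Q) \<union> U"
      show "y \<in> P - Z"
      proof (cases "y \<in> U")
        case True
        then show ?thesis using ZU UP by blast
      next
        case False
        then have "y \<in> E" "y \<in> B" "y \<in> P" using y by (auto simp: E_def)
        then show ?thesis using dis by (auto simp: Z_def)
      qed
    qed
    then have "openin (subtopology F P) (P - Z)" using oZ[OF B] U(1) by auto
    then have "closedin (subtopology F P) Z" using tP by (auto simp: closedin_def Z_def)
    moreover have "openin (subtopology F P) Z" unfolding Z_def by (rule oZ[OF A])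
    ultimately have "Z = {} \<or> Z = P" using conP tP unfolding connected_space_clopen_in by metis
    moreover have "Z \<noteq> {}"
    proof -
      obtain y where y: "y \<in> A" "y \<in> E" using ne by blast
      then have "y \<notin> Q" using TA by (auto simp: E_def Q_def T_def)
      then show ?thesis using y by (auto simp: Z_def E_def)
    qed
    moreover have "U \<noteq> {}" using u'_in[of "((1, 0), 0)"] by (auto simp: norm_Pair)
    then have "Z \<noteq> P" using ZU UP by blast
    ultimately show False by blast
  qed
  have TE: "T \<subseteq> E" unfolding T_def E_def using UP by auto
  have cT: "connectedin F T" unfolding T_def using connectedin_collar_end s by simp
  have "connectedin F E"
    unfolding connectedin
  proof (intro conjI notI)
    show "E \<subseteq> topspace F" using P(1) by (auto simp: E_def)
    assume "\<exists>E1 E2. openin F E1 \<and> openin F E2 \<and> E \<subseteq> E1 \<union> E2 \<and> E1 \<inter> E2 \<inter> E = {} \<and> E1 \<inter> E \<noteq> {} \<and> E2 \<inter> E \<noteq> {}"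
    then obtain A B where AB: "openin F A" "openin F B" "E \<subseteq> A \<union> B" "A \<inter> B \<inter> E = {}" "A \<inter> E \<noteq> {}" "B \<inter> E \<noteq> {}"
      by blast
    have "T \<inter> A = {} \<or> T \<inter> B = {}"
    proof (rule ccontr)
      assume "\<not> (T \<inter> A = {} \<or> T \<inter> B = {})"
      moreover have "T \<subseteq> A \<union> B" "A \<inter> B \<inter> T = {}" using AB TE by blast+
      ultimately show False using cT AB(1,2) unfolding connectedin by blast
    qed
    then show False
    proof
      assume "T \<inter> A = {}"
      then show False by (rule key[OF AB(1-5)])
    next
      assume t: "T \<inter> B = {}"
      have "E \<subseteq> B \<union> A" "B \<inter> A \<inter> E = {}" using AB by blast+
      from key[OF AB(2,1) this AB(6) t] show False .
    qed
  qed
  then show ?thesis by (simp add: E_def)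
qed

text \<open>The region under a graph over the boundary circle. \<open>B\<close> is the core,
  possibly with collars already attached in other pipes.\<close>

definition below :: "'a set \<Rightarrow> (real \<times> real \<Rightarrow> real) \<Rightarrow> 'a set" where
  "below B \<tau> = B \<union> {y \<in> U. snd (u y) \<le> \<tau> (fst (u y))}"

text \<open>The local step, as in proofs of Brown's collar theorem: a chart across the boundary
  turns both sets into regions under graphs over an interval. Functions that differ only near
  \<open>p\<close> differ over a compact part of that interval.\<close>

lemma ambient_isotopic_below_local:
  assumes B: "K \<subseteq> B" "(B - K) \<inter> P = {}" and p: "p \<in> sphere 0 1"
  obtains r where "r > 0"
    "\<And>\<tau> \<tau>'. continuous_on (sphere 0 1) \<tau> \<Longrightarrow> continuous_on (sphere 0 1) \<tau>' \<Longrightarrow>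
      (\<And>q. q \<in> sphere 0 1 \<Longrightarrow> 0 \<le> \<tau> q \<and> 0 \<le> \<tau>' q) \<Longrightarrow>
      (\<And>q. q \<in> sphere 0 1 \<Longrightarrow> r \<le> dist q p \<Longrightarrow> \<tau> q = \<tau>' q) \<Longrightarrow> ambient_isotopic F (below B \<tau>) (below B \<tau>')"
proof -
  define x where "x = u' (p, 0)"
  have p0: "(p, 0::real) \<in> sphere 0 1 \<times> {0..}" using p by simp
  have ux: "x \<in> U" "u x = (p, 0)" using u'_in[OF p0] uu'[OF p0] by (simp_all add: x_def)
  then have "x \<in> D" using D_iff by simp
  then obtain a0 e g \<kappa> where e: "e > 0"
    and oN: "openin F (g ` (ball a0 e \<times> {-e<..}))"
    and hg: "homeomorphic_map (top_of_set (ball a0 e \<times> {-e<..})) (subtopology F (g ` (ball a0 e \<times> {-e<..}))) g"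
    and gx: "g (a0, 0) = x" and c\<kappa>: "continuous_on (ball (a0::real) e) \<kappa>" and \<kappa>S: "\<kappa> \<in> ball a0 e \<rightarrow> sphere 0 1"
    and gneg: "\<And>a s. a \<in> ball a0 e \<Longrightarrow> s < 0 \<Longrightarrow> -e < s \<Longrightarrow> g (a, s) \<in> K - M"
    and gpos: "\<And>a s. a \<in> ball a0 e \<Longrightarrow> 0 \<le> s \<Longrightarrow> g (a, s) \<in> U \<and> u (g (a, s)) = (\<kappa> a, s)"
    by (rule glued_chart) (rule that; assumption)
  define I where "I = ball a0 e"
  define E where "E = I \<times> {-e<..}"
  note defs = I_def[symmetric] E_def[symmetric]
  have ginj: "inj_on g E"
    using homeomorphic_imp_injective_map[OF hg] unfolding I_def E_def by simp
  have \<kappa>I: "\<kappa> a \<in> sphere 0 1" if "a \<in> I" for a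
    using funcset_mem[OF \<kappa>S] that by (simp add: I_def)
  have gu': "g (a, s) = u' (\<kappa> a, s)" if "a \<in> I" "0 \<le> s" for a s
    using gpos[of a s] u'u[of "g (a, s)"] that by (simp add: I_def)
  have \<kappa>inj: "a = a'" if "a \<in> I" "a' \<in> I" "\<kappa> a = \<kappa> a'" for a a'
  proof -
    have "g (a, 0) = g (a', 0)" using gu' that by simp
    moreover have "(a, 0) \<in> E" "(a', 0) \<in> E" using that e by (auto simp: E_def)
    ultimately show ?thesis using ginj unfolding inj_on_def by blast
  qed
  \<comment> \<open>Half of the parameter interval: graph changes near \<open>p\<close> will lie
    over it, which leaves a margin for compact support in the full chart.\<close>
  define N2 where "N2 = g ` (ball a0 (e/2) \<times> {-e<..})"
  have "open (ball a0 (e/2) \<times> {-e<..})" by (intro open_Times) auto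
  moreover have sE: "ball a0 (e/2) \<times> {-e<..} \<subseteq> E" using e by (auto simp: E_def I_def)
  ultimately have "openin (top_of_set E) (ball a0 (e/2) \<times> {-e<..})" by (auto simp: openin_open)
  then have "openin (subtopology F (g ` E)) N2"
    unfolding N2_def using homeomorphic_map_openness_eq[OF hg[unfolded defs]] by blast
  then have oN2: "openin F N2" using openin_trans_full oN[unfolded defs] by blast
  have "continuous_map (top_of_set (sphere (0::real\<times>real) 1)) (top_of_set (sphere 0 1 \<times> {0..})) (\<lambda>q. (q, 0::real))"
    unfolding continuous_map_subtopology_eu by (auto intro!: continuous_intros)
  from openin_continuous_map_preimage[OF continuous_map_compose[OF this cu'F] oN2]
  have "openin (top_of_set (sphere 0 1)) {q \<in> sphere 0 1. u' (q, 0) \<in> N2}" by (simp add: o_def)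
  moreover have "x \<in> N2" unfolding N2_def using gx e by (intro image_eqI[of _ _ "(a0, 0)"]) auto
  ultimately obtain r where r: "r > 0" "\<And>q. q \<in> sphere 0 1 \<Longrightarrow> dist q p < r \<Longrightarrow> u' (q, 0) \<in> N2"
    unfolding openin_euclidean_subtopology_iff using p x_def by blast
  \<comment> \<open>A circle point whose image lies in \<open>N2\<close> cannot come from negative
    height, because there the chart avoids the boundary of \<open>K\<close>.\<close>
  have cover: "\<exists>a\<in>ball a0 (e/2). \<kappa> a = q" if q: "q \<in> sphere 0 1" "dist q p < r" for q
  proof -
    obtain a s where as: "a \<in> ball a0 (e/2)" "-e < s" "u' (q, 0) = g (a, s)"
      using r(2)[OF q] by (auto simp: N2_def)
    have aI: "a \<in> ball a0 e" using as e by auto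
    have q0: "(q, 0::real) \<in> sphere 0 1 \<times> {0..}" using q by simp
    have uq: "u' (q, 0) \<in> U" "u (u' (q, 0)) = (q, 0)" using u'_in[OF q0] uu'[OF q0] by simp_all
    then have "u' (q, 0) \<in> D" using D_iff by simp
    then have "\<not> s < 0" using gneg[OF aI, of s] as DM by auto
    then have "\<kappa> a = q" using gpos[OF aI, of s] as(3) uq by simp
    then show ?thesis using as by blast
  qed
  obtain w where w: "homeomorphic_maps (top_of_set E) (subtopology F (g ` E)) g w"
    using hg[unfolded defs] by (auto simp: homeomorphic_map_maps)
  then have w': "homeomorphic_maps (subtopology F (g ` E)) (top_of_set E) w g"
    by (subst homeomorphic_maps_sym)
  have wg: "w (g z) = z" if "z \<in> E" for z using w that by (simp add: homeomorphic_maps_def)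
  show thesis
  proof (rule that[OF r(1)])
    fix \<tau> \<tau>' :: "real \<times> real \<Rightarrow> real"
    assume c: "continuous_on (sphere 0 1) \<tau>" "continuous_on (sphere 0 1) \<tau>'"
      and nn: "\<And>q. q \<in> sphere 0 1 \<Longrightarrow> 0 \<le> \<tau> q \<and> 0 \<le> \<tau>' q"
      and eq: "\<And>q. q \<in> sphere 0 1 \<Longrightarrow> r \<le> dist q p \<Longrightarrow> \<tau> q = \<tau>' q"
    have im: "w ` (below B \<sigma> \<inter> g ` E) = {z \<in> I \<times> {-e<..}. snd z \<le> \<sigma> (\<kappa> (fst z))}"
      if \<sigma>: "\<And>q. q \<in> sphere 0 1 \<Longrightarrow> 0 \<le> \<sigma> q" for \<sigma>
    proof -
      have mem: "g (a, s) \<in> below B \<sigma> \<longleftrightarrow> s \<le> \<sigma> (\<kappa> a)" if as: "a \<in> I" "-e < s" for a s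
      proof (cases "s < 0")
        case True
        then have "g (a, s) \<in> K - M" using gneg as by (simp add: I_def)
        then have "g (a, s) \<in> below B \<sigma>" using B(1) by (auto simp only: below_def)
        moreover have "s \<le> \<sigma> (\<kappa> a)" using \<sigma>[OF \<kappa>I[OF as(1)]] True by linarith
        ultimately show ?thesis by simp
      next
        case False
        then have gU: "g (a, s) \<in> U" "u (g (a, s)) = (\<kappa> a, s)" using gpos as by (simp_all add: I_def)
        have "s \<le> \<sigma> (\<kappa> a)" if "g (a, s) \<in> B"
        proof -
          have "g (a, s) \<in> K" using that B(2) gU(1) UP by blast
          then have "s = 0" using K_iff[OF gU(1)] gU(2) by simp
          then show ?thesis using \<sigma>[OF \<kappa>I[OF as(1)]] by simp
        qed
        then show ?thesis using gU by (auto simp: below_def)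
      qed
      have "below B \<sigma> \<inter> g ` E = g ` {z \<in> I \<times> {-e<..}. snd z \<le> \<sigma> (\<kappa> (fst z))}"
        unfolding E_def using mem by fastforce
      moreover have "w ` (g ` {z \<in> I \<times> {-e<..}. snd z \<le> \<sigma> (\<kappa> (fst z))}) = {z \<in> I \<times> {-e<..}. snd z \<le> \<sigma> (\<kappa> (fst z))}"
        unfolding image_image using wg by (force simp: E_def)
      ultimately show ?thesis by simp
    qed
    \<comment> \<open>The chart contains complete collar lines, so over points near \<open>p\<close>
      nothing of the collar lies outside it.\<close>
    have diff: "below B \<sigma> - g ` E \<subseteq> below B \<sigma>'"
      if \<sigma>: "\<And>q. q \<in> sphere 0 1 \<Longrightarrow> r \<le> dist q p \<Longrightarrow> \<sigma> q = \<sigma>' q" for \<sigma> \<sigma>'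
    proof
      fix y assume y: "y \<in> below B \<sigma> - g ` E"
      show "y \<in> below B \<sigma>'"
      proof (cases "y \<in> B")
        case False
        then have yU: "y \<in> U" "snd (u y) \<le> \<sigma> (fst (u y))" using y by (auto simp: below_def)
        have "r \<le> dist (fst (u y)) p"
        proof (rule ccontr)
          assume "\<not> r \<le> dist (fst (u y)) p"
          then obtain a where a: "a \<in> ball a0 (e/2)" "\<kappa> a = fst (u y)"
            using cover[OF u_sphere[OF yU(1)]] by auto
          then have "a \<in> I" using e by (auto simp: I_def)
          then have "g (a, snd (u y)) = u' (u y)" using gu' u_nonneg[OF yU(1)] a by simp
          then have "y = g (a, snd (u y))" using u'u yU by simp
          moreover have "(a, snd (u y)) \<in> E" using \<open>a \<in> I\<close> u_nonneg[OF yU(1)] e by (auto simp: E_def)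
          ultimately show False using y by blast
        qed
        then show ?thesis using \<sigma>[OF u_sphere[OF yU(1)]] yU by (simp add: below_def)
      qed (simp add: below_def)
    qed
    have ne: "sphere (0::real \<times> real) 1 \<noteq> {}" by simp
    obtain m1 where m1: "\<And>q. q \<in> sphere 0 1 \<Longrightarrow> \<tau> q \<le> m1"
      using continuous_attains_sup[OF compact_sphere ne c(1)] by blast
    obtain m2 where m2: "\<And>q. q \<in> sphere 0 1 \<Longrightarrow> \<tau>' q \<le> m2"
      using continuous_attains_sup[OF compact_sphere ne c(2)] by blast
    show "ambient_isotopic F (below B \<tau>) (below B \<tau>')"
    proof (rule ambient_isotopic_local[OF haus _ w'])
      show "openin F (g ` E)" using oN[unfolded defs] .
      show "below B \<tau> - g ` E = below B \<tau>' - g ` E"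
        using diff[of \<tau> \<tau>'] diff[of \<tau>' \<tau>] eq by auto
      have i1: "w ` (below B \<tau> \<inter> g ` E) = {z \<in> I \<times> {-e<..}. snd z \<le> \<tau> (\<kappa> (fst z))}"
        by (rule im) (use nn in blast)
      have i2: "w ` (below B \<tau>' \<inter> g ` E) = {z \<in> I \<times> {-e<..}. snd z \<le> \<tau>' (\<kappa> (fst z))}"
        by (rule im) (use nn in blast)
      have "ambient_isotopic (top_of_set (I \<times> {-e<..})) {z \<in> I \<times> {-e<..}. snd z \<le> \<tau> (\<kappa> (fst z))}
         {z \<in> I \<times> {-e<..}. snd z \<le> \<tau>' (\<kappa> (fst z))}"
      \<comment> \<open>Pushing starts inside \<open>K\<close>, at height -e/2, and ends above both
        graphs; the inside room is what allows moving height 0.\<close>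
      proof (rule ambient_isotopic_subgraph[where \<tau> = "\<lambda>a. \<tau> (\<kappa> a)" and \<tau>' = "\<lambda>a. \<tau>' (\<kappa> a)"
            and l = "-e/2" and m = "max m1 m2 + 1"])
        show "compact (cball a0 (e/2))" by simp
        show "cball a0 (e/2) \<subseteq> I" using e by (auto simp: I_def)
        show "{-e/2..max m1 m2 + 1} \<subseteq> {-e<..}" using e by auto
        show "continuous_on I (\<lambda>a. \<tau> (\<kappa> a))" "continuous_on I (\<lambda>a. \<tau>' (\<kappa> a))"
          by (rule continuous_on_compose2[OF c(1)] continuous_on_compose2[OF c(2)],
              use c\<kappa> \<kappa>S in \<open>auto simp: I_def\<close>)+
        fix a assume a: "a \<in> I"
        then have s: "\<kappa> a \<in> sphere 0 1" using \<kappa>I by blast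
        show "-e/2 < \<tau> (\<kappa> a) \<and> \<tau> (\<kappa> a) < max m1 m2 + 1 \<and> -e/2 < \<tau>' (\<kappa> a) \<and> \<tau>' (\<kappa> a) < max m1 m2 + 1"
          using nn[OF s] m1[OF s] m2[OF s] e by auto
      next
        fix a assume a: "a \<in> I - cball a0 (e/2)"
        then have s: "\<kappa> a \<in> sphere 0 1" using \<kappa>I by blast
        have "r \<le> dist (\<kappa> a) p"
        proof (rule ccontr)
          assume "\<not> r \<le> dist (\<kappa> a) p"
          then obtain a' where a': "a' \<in> ball a0 (e/2)" "\<kappa> a' = \<kappa> a" using cover[OF s] by auto
          then have "a' = a" using a e by (intro \<kappa>inj) (auto simp: I_def)
          then show False using a a' by auto
        qed
        then show "\<tau> (\<kappa> a) = \<tau>' (\<kappa> a)" using eq[OF s] by simp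
      qed
      then show "ambient_isotopic (top_of_set E) (w ` (below B \<tau> \<inter> g ` E)) (w ` (below B \<tau>' \<inter> g ` E))"
        unfolding i1 i2 unfolding E_def .
    qed
  qed
qed

text \<open>Finitely many bumps, one for each ball of a subcover of the circle, are added one at a
  time by local isotopies. Their sum is positive everywhere, and a positive height can be changed to
  the constant \<open>s\<close> within the open collar, by one chart.\<close>

lemma ambient_isotopic_collar_push:
  assumes B: "K \<subseteq> B" "B \<subseteq> topspace F" "(B - K) \<inter> P = {}" and s: "s > 0"
  shows "ambient_isotopic F B (B \<union> {y \<in> U. snd (u y) \<le> s})"
proof -
  let ?good = "\<lambda>p r. r > 0 \<and> (\<forall>\<tau> \<tau>'. continuous_on (sphere 0 1) \<tau> \<longrightarrow> continuous_on (sphere 0 1) \<tau>' \<longrightarrow>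
      (\<forall>q\<in>sphere 0 1. 0 \<le> \<tau> q \<and> 0 \<le> \<tau>' q) \<longrightarrow>
      (\<forall>q\<in>sphere 0 1. r \<le> dist q p \<longrightarrow> \<tau> q = \<tau>' q) \<longrightarrow> ambient_isotopic F (below B \<tau>) (below B \<tau>'))"
  have "\<forall>p\<in>sphere 0 1. \<exists>r. ?good p r"
  proof
    fix p :: "real \<times> real" assume p: "p \<in> sphere 0 1"
    show "\<exists>r. ?good p r"
      by (rule ambient_isotopic_below_local[OF B(1,3) p]) (intro exI conjI allI impI; blast)
  qed
  from bchoice[OF this] obtain r where "\<forall>p\<in>sphere 0 1. ?good p (r p)" by (rule exE)
  then have r: "?good p (r p)" if "p \<in> sphere 0 1" for p using that by (rule bspec)
  have "sphere 0 1 \<subseteq> (\<Union>p\<in>sphere 0 1. ball p (r p))" using r by force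
  then obtain T where T: "finite T" "T \<subseteq> sphere 0 1" "sphere 0 1 \<subseteq> (\<Union>p\<in>T. ball p (r p))"
    using compactE_image[OF compact_sphere[of "0::real \<times> real" 1], of "sphere 0 1" "\<lambda>p. ball p (r p)"]
    by (metis open_ball)
  \<comment> \<open>The bump at \<open>p\<close> vanishes at distance \<open>r p\<close> or more, as
    the local step requires, and is positive on the covering ball.\<close>
  define \<eta> where "\<eta> = (\<lambda>p q. max 0 (r p - dist q p))"
  define \<tau> where "\<tau> = (\<lambda>S q. \<Sum>p\<in>S. \<eta> p q)"
  have \<tau>c: "continuous_on A (\<tau> S)" for A S unfolding \<tau>_def \<eta>_def by (intro continuous_intros)
  have \<tau>0: "0 \<le> \<tau> S q" for S q unfolding \<tau>_def \<eta>_def by (intro sum_nonneg) auto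
  have "ambient_isotopic F B (below B (\<tau> S))" if "finite S" "S \<subseteq> sphere 0 1" for S
    using that
  proof (induction S rule: finite_induct)
    case empty
    have "y \<in> B" if "y \<in> U" "snd (u y) \<le> 0" for y
      using u_nonneg[of y] K_iff[of y] that B(1) by auto
    then have "below B (\<tau> {}) = B" by (auto simp: below_def \<tau>_def)
    then show ?case by (simp add: ambient_isotopic_refl)
  next
    case (insert p S)
    have "ambient_isotopic F (below B (\<tau> S)) (below B (\<tau> (insert p S)))"
    proof -
      have "\<tau> S q = \<tau> (insert p S) q" if "r p \<le> dist q p" for q
        using insert.hyps that by (simp add: \<tau>_def \<eta>_def)
      then show ?thesis using r[of p] insert.prems \<tau>c \<tau>0 by blast
    qed
    then show ?case using insert ambient_isotopic_trans by blast
  qed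
  then have 1: "ambient_isotopic F B (below B (\<tau> T))" using T by blast
  have \<tau>pos: "0 < \<tau> T q" if "q \<in> sphere 0 1" for q
  proof -
    obtain p where p: "p \<in> T" "dist p q < r p" using T(3) \<open>q \<in> sphere 0 1\<close> by force
    have "0 < \<eta> p q" using p by (simp add: \<eta>_def dist_commute)
    also have "\<eta> p q \<le> \<tau> T q" unfolding \<tau>_def
      by (rule member_le_sum[OF p(1) _ T(1)]) (simp add: \<eta>_def)
    finally show ?thesis .
  qed
  have ne: "sphere (0::real \<times> real) 1 \<noteq> {}" by simp
  obtain q0 where q0: "q0 \<in> sphere 0 1" "\<And>q. q \<in> sphere 0 1 \<Longrightarrow> \<tau> T q0 \<le> \<tau> T q"
    using continuous_attains_inf[OF compact_sphere ne \<tau>c] by blast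
  obtain q1 where q1: "q1 \<in> sphere 0 1" "\<And>q. q \<in> sphere 0 1 \<Longrightarrow> \<tau> T q \<le> \<tau> T q1"
    using continuous_attains_sup[OF compact_sphere ne \<tau>c] by blast
  have im: "u ` (below B \<sigma> \<inter> N) = {q \<in> sphere 0 1 \<times> {0<..}. snd q \<le> \<sigma> (fst q)}" for \<sigma>
  proof -
    have "y \<notin> B" if "y \<in> N" for y
      using that B(3) K_iff[of y] UP by auto
    then have "below B \<sigma> \<inter> N = {y \<in> N. snd (u y) \<le> \<sigma> (fst (u y))}" by (auto simp: below_def)
    also have "u ` \<dots> = {q \<in> sphere 0 1 \<times> {0<..}. snd q \<le> \<sigma> (fst q)}"
    proof (intro equalityI subsetI)
      fix q assume "q \<in> u ` {y \<in> N. snd (u y) \<le> \<sigma> (fst (u y))}"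
      then obtain y where "y \<in> U" "0 < snd (u y)" "snd (u y) \<le> \<sigma> (fst (u y))" "q = u y" by blast
      then show "q \<in> {q \<in> sphere 0 1 \<times> {0<..}. snd q \<le> \<sigma> (fst q)}"
        using u_sphere by (auto simp: mem_Times_iff)
    next
      fix q :: "(real \<times> real) \<times> real" assume q: "q \<in> {q \<in> sphere 0 1 \<times> {0<..}. snd q \<le> \<sigma> (fst q)}"
      then have "q \<in> sphere 0 1 \<times> {0..}" by auto
      then have "u (u' q) = q" "u' q \<in> U" using uu' u'_in by blast+
      then show "q \<in> u ` {y \<in> N. snd (u y) \<le> \<sigma> (fst (u y))}"
        using q by (intro image_eqI[of _ _ "u' q"]) auto
    qed
    finally show ?thesis .
  qed
  have diff: "below B \<sigma> - N = B" if "\<And>q. q \<in> sphere 0 1 \<Longrightarrow> 0 \<le> \<sigma> q" for \<sigma>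
  proof -
    have "y \<in> B" if "y \<in> U" "y \<notin> N" for y
      using u_nonneg[of y] K_iff[of y] that B(1) by auto
    moreover have "y \<notin> N" if "y \<in> B" for y
      using that B(3) K_iff[of y] UP by auto
    ultimately show ?thesis by (auto simp: below_def)
  qed
  \<comment> \<open>Both heights have positive lower bounds, so the remaining change has compact
    support in \<open>N\<close> and no longer touches the boundary circle.\<close>
  have 2: "ambient_isotopic F (below B (\<tau> T)) (below B (\<lambda>_. s))"
  proof (rule ambient_isotopic_local[OF haus N_open N_maps])
    show "below B (\<tau> T) - N = below B (\<lambda>_. s) - N"
      using diff[of "\<tau> T"] diff[of "\<lambda>_. s"] \<tau>0 s by simp
    show "ambient_isotopic (top_of_set (sphere 0 1 \<times> {0<..})) (u ` (below B (\<tau> T) \<inter> N)) (u ` (below B (\<lambda>_. s) \<inter> N))"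
      unfolding im
    proof (rule ambient_isotopic_subgraph[where l = "min (\<tau> T q0) s / 2" and m = "max (\<tau> T q1) s + 1"])
      show "compact (sphere (0::real \<times> real) 1)" by (rule compact_sphere)
      show "{min (\<tau> T q0) s / 2..max (\<tau> T q1) s + 1} \<subseteq> {0<..}" using \<tau>pos[OF q0(1)] s by auto
      show "min (\<tau> T q0) s / 2 < \<tau> T q \<and> \<tau> T q < max (\<tau> T q1) s + 1 \<and> min (\<tau> T q0) s / 2 < s \<and> s < max (\<tau> T q1) s + 1"
        if "q \<in> sphere 0 1" for q
        using q0(2)[OF that] q1(2)[OF that] \<tau>pos[OF q0(1)] s by (auto simp: min_def max_def)
    qed (auto intro: \<tau>c)
  qed
  show ?thesis using ambient_isotopic_trans[OF 1 2] by (simp add: below_def)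
qed

end

section \<open>Nyikos decompositions\<close>

lemma connectedin_subset_disjoint_open:
  assumes S: "connectedin X S" "S \<noteq> {}" and cov: "S \<subseteq> (\<Union>i\<in>I. G i)"
    and G: "\<And>i. i \<in> I \<Longrightarrow> openin X (G i)"
    and disj: "\<And>i k. i \<in> I \<Longrightarrow> k \<in> I \<Longrightarrow> i \<noteq> k \<Longrightarrow> G i \<inter> G k = {}"
  shows "\<exists>i\<in>I. S \<subseteq> G i"
proof -
  obtain y i where y: "y \<in> S" "i \<in> I" "y \<in> G i" using S(2) cov by blast
  define R where "R = (\<Union>k\<in>I - {i}. G k)"
  have oR: "openin X R" unfolding R_def using G by blast
  have "S \<subseteq> G i \<union> R" unfolding R_def using cov by blast
  moreover have "G i \<inter> R \<inter> S = {}" unfolding R_def using disj y(2) by blast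
  ultimately have "R \<inter> S = {}"
    using S(1) G[OF y(2)] oR y unfolding connectedin by blast
  then show ?thesis using \<open>S \<subseteq> G i \<union> R\<close> y(2) by blast
qed

text \<open>The inside and the outside of the curve are connected, so each lies wholly in
  \<open>A\<close> or in \<open>B\<close>. The unbounded side meets \<open>B\<close> far out, and
  the point 0 puts the other side into \<open>A\<close>.\<close>

lemma inside_eqI:
  fixes c :: "real \<Rightarrow> complex"
  assumes c: "simple_path c" "pathfinish c = pathstart c"
    and A: "open A" "0 \<in> A" and B: "open B" "\<And>z. t \<le> norm z \<Longrightarrow> z \<in> B"
    and AB: "A \<inter> B = {}" "A \<union> B = - path_image c"
  shows "A = inside (path_image c)"
proof -
  define C where "C = path_image c"
  have J: "open (inside C)" "connected (inside C)" "open (outside C)" "connected (outside C)"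
    "\<not> bounded (outside C)"
    using Jordan_inside_outside[OF c] by (auto simp: C_def)
  have un: "inside C \<union> outside C = - C" by (rule inside_Un_outside)
  have split: "S \<subseteq> A \<or> S \<subseteq> B" if "connected S" "S \<subseteq> - C" for S
  proof -
    have "A \<inter> S = {} \<or> B \<inter> S = {}"
      by (rule connectedD[OF that(1) A(1) B(1)]) (use AB that in \<open>auto simp: C_def\<close>)
    then show ?thesis using that(2) AB(2) by (auto simp: C_def)
  qed
  obtain z where z: "z \<in> outside C" "t < norm z"
    using J(5) unfolding bounded_iff by (meson not_le)
  then have "z \<in> B" using B(2) by simp
  then have outB: "outside C \<subseteq> B" using split[OF J(4)] un z(1) AB(1) by blast
  then have "0 \<notin> outside C" using A(2) AB(1) by blast
  moreover have "0 \<notin> C" using A(2) AB(2) by (auto simp: C_def)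
  ultimately have "0 \<in> inside C" using un by blast
  then have inA: "inside C \<subseteq> A" using split[OF J(2)] un A(2) AB(1) by blast
  have "A \<subseteq> - C" using AB(2) by (auto simp: C_def)
  then have "A \<subseteq> inside C" using un outB AB(1) by blast
  then show ?thesis using inA by (simp add: C_def)
qed

context collar
begin

text \<open>A tube argument: the compact boundary circle has positive distance from the closed
  complement in collar coordinates.\<close>

lemma collar_subset_open:
  assumes G: "openin F G" "D \<subseteq> G"
  obtains \<epsilon> where "\<epsilon> > 0" "\<And>y. y \<in> U \<Longrightarrow> snd (u y) < \<epsilon> \<Longrightarrow> y \<in> G"
proof -
  define C where "C = {q \<in> sphere (0::real \<times> real) 1 \<times> {0::real..}. u' q \<in> G}"
  have "openin (top_of_set (sphere 0 1 \<times> {0..})) C"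
    using openin_continuous_map_preimage[OF cu'F G(1)] by (simp add: C_def)
  then obtain T where T: "open T" "C = (sphere 0 1 \<times> {0..}) \<inter> T" by (auto simp: openin_open)
  have "sphere 0 1 \<times> {0} \<subseteq> T"
  proof
    fix q :: "(real \<times> real) \<times> real" assume q: "q \<in> sphere 0 1 \<times> {0}"
    then have q': "q \<in> sphere 0 1 \<times> {0..}" "snd q = 0" by auto
    then have "u' q \<in> D" using D_iff[OF u'_in[OF q'(1)]] uu'[OF q'(1)] by simp
    then show "q \<in> T" using G(2) q' T(2) by (auto simp: C_def)
  qed
  then have "compact (sphere (0::real \<times> real) 1 \<times> {0::real})" "closed (- T)" "(sphere 0 1 \<times> {0}) \<inter> (- T) = {}"
    using T(1) by (auto intro: compact_Times)
  then obtain \<epsilon> where e: "\<epsilon> > 0" "\<And>p q. p \<in> sphere 0 1 \<times> {0} \<Longrightarrow> q \<in> - T \<Longrightarrow> \<epsilon> \<le> dist p q"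
    using separate_compact_closed by metis
  show thesis
  proof (rule that[OF e(1)])
    fix y assume y: "y \<in> U" "snd (u y) < \<epsilon>"
    have "u y \<in> T"
    proof (rule ccontr)
      assume "u y \<notin> T"
      then have "\<epsilon> \<le> dist (fst (u y), 0) (u y)" using e(2)[of "(fst (u y), 0)" "u y"] u_sphere[OF y(1)] by auto
      also have "\<dots> = snd (u y)" using u_nonneg[OF y(1)] by (cases "u y") (simp add: dist_Pair_Pair)
      finally show False using y by simp
    qed
    then have "u y \<in> C" unfolding T(2) using u_in[OF y(1)] by (intro IntI)
    then show "y \<in> G" using u'u[OF y(1)] by (simp add: C_def)
  qed
qed

end

section \<open>Point-set topology of the core and the pipes\<close>

locale decomposition =
  fixes F :: "'a topology" and K :: "'a set" and n :: nat and P :: "nat \<Rightarrow> 'a set"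
  assumes surf: "surface F" and nyik: "nyikos_decomposition F K n P"
begin

abbreviation "Dp i \<equiv> mboundary (subtopology F (P i))"
abbreviation "Mk \<equiv> mboundary (subtopology F K)"

lemma haus: "Hausdorff_space F"
  using surf by (simp add: surface_def)

lemma planar: "x \<in> topspace F \<Longrightarrow> planar_at F x"
  using surf unfolding surface_def planar_at_def by blast

lemma KF: "K \<subseteq> topspace F" and K_compact: "compactin F K" and K_wb: "surface_wb (subtopology F K)"
  and card_components: "card (connected_components_of (subtopology F Mk)) = n"
  and cover: "topspace F = K \<union> (\<Union>i<n. P i)"
  and PF: "i < n \<Longrightarrow> P i \<subseteq> topspace F" and pipe: "i < n \<Longrightarrow> long_pipe (subtopology F (P i))"
  and PK: "i < n \<Longrightarrow> P i \<inter> K = Dp i"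
  and D_component: "i < n \<Longrightarrow> Dp i \<in> connected_components_of (subtopology F Mk)"
  and disjoint: "i < n \<Longrightarrow> k < n \<Longrightarrow> i \<noteq> k \<Longrightarrow> P i \<inter> P k = {}"
  using nyik unfolding nyikos_decomposition_def by blast+

lemma DP: "i < n \<Longrightarrow> Dp i \<subseteq> P i"
  using PK by blast

lemma MK: "Mk \<subseteq> K"
  by (auto simp: mboundary_def)

lemma P_wb: "i < n \<Longrightarrow> surface_wb (subtopology F (P i))"
  using pipe by (simp add: long_pipe_def)

text \<open>A count: the \<open>n\<close> pipes have distinct boundary circles among exactly
  \<open>n\<close> components, so every component is used. The condition \<open>0 < n\<close> turns
  the cardinality into finiteness, since an infinite set would also have \<open>card\<close> equal
  to 0.\<close>

lemma D_image: "0 < n \<Longrightarrow> Dp ` {..<n} = connected_components_of (subtopology F Mk)"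
  and finite_components: "0 < n \<Longrightarrow> finite (connected_components_of (subtopology F Mk))"
proof -
  assume n: "0 < n"
  have ne: "Dp i \<noteq> {}" if "i < n" for i
    using D_component[OF that] nonempty_connected_components_of by blast
  have "inj_on Dp {..<n}"
  proof (rule inj_onI)
    fix i k assume "i \<in> {..<n}" "k \<in> {..<n}" "Dp i = Dp k"
    then show "i = k" using ne[of i] DP[of i] DP[of k] disjoint[of i k] by (metis Int_greatest bot.extremum_uniqueI lessThan_iff)
  qed
  then have c: "card (Dp ` {..<n}) = n" by (simp add: card_image)
  show fin: "finite (connected_components_of (subtopology F Mk))"
    by (rule card_ge_0_finite) (simp add: card_components n)
  show "Dp ` {..<n} = connected_components_of (subtopology F Mk)"
    by (rule card_subset_eq[OF fin]) (use D_component c card_components in auto)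
qed

lemma D_open: "i < n \<Longrightarrow> openin (subtopology F Mk) (Dp i)"
  using open_in_finite_connected_components[OF finite_components D_component] by simp

lemma M_cover: "i < n \<Longrightarrow> Mk = (\<Union>k<n. Dp k)"
proof -
  assume "i < n"
  then have "(\<Union>k<n. Dp k) = topspace (subtopology F Mk)"
    using D_image Union_connected_components_of[of "subtopology F Mk"] by simp
  then show ?thesis using MK KF by auto
qed

text \<open>The cylinders exhausting a pipe are directed, so a compact set lies in a single one, and
  compactness bounds its height there. From here on a pipe enters through one such cylinder at a
  time.\<close>

lemma pipe_collar:
  assumes i: "i < n" and L: "compactin F L" "L \<subseteq> P i"
  shows "\<exists>U u u' s. collar F K (P i) U u u' \<and> s > 0 \<and> (\<forall>y\<in>L. y \<in> U \<and> snd (u y) < s)"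
proof -
  define X where "X = subtopology F (P i)"
  have tX: "topspace X = P i" using PF[OF i] by (auto simp: X_def)
  have "\<exists>(r :: nat set rel) W. omega1_order r \<and> topspace X = (\<Union>\<alpha>\<in>Field r. W \<alpha>) \<and>
        (\<forall>\<alpha>\<in>Field r. openin X (W \<alpha>) \<and> mboundary X \<subseteq> W \<alpha> \<and>
            subtopology X (W \<alpha>) homeomorphic_space half_cylinder_top) \<and>
        (\<forall>\<alpha> \<beta>. (\<alpha>, \<beta>) \<in> r \<and> \<alpha> \<noteq> \<beta> \<longrightarrow>
            X closure_of (W \<alpha>) \<subseteq> W \<beta> \<and>
            subtopology X (subtopology X (W \<beta>) frontier_of (W \<alpha>)) homeomorphic_space circle_top)"
    using pipe[OF i] unfolding long_pipe_def X_def by (elim conjE)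
  then obtain r :: "nat set rel" and W where rW: "omega1_order r \<and> topspace X = (\<Union>\<alpha>\<in>Field r. W \<alpha>) \<and>
        (\<forall>\<alpha>\<in>Field r. openin X (W \<alpha>) \<and> mboundary X \<subseteq> W \<alpha> \<and>
            subtopology X (W \<alpha>) homeomorphic_space half_cylinder_top) \<and>
        (\<forall>\<alpha> \<beta>. (\<alpha>, \<beta>) \<in> r \<and> \<alpha> \<noteq> \<beta> \<longrightarrow>
            X closure_of (W \<alpha>) \<subseteq> W \<beta> \<and>
            subtopology X (subtopology X (W \<beta>) frontier_of (W \<alpha>)) homeomorphic_space circle_top)"
    by (elim exE)
  then have r: "omega1_order r" and WX: "topspace X = (\<Union>\<alpha>\<in>Field r. W \<alpha>)"
    and W: "\<And>\<alpha>. \<alpha> \<in> Field r \<Longrightarrow> openin X (W \<alpha>) \<and> mboundary X \<subseteq> W \<alpha> \<and>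
            subtopology X (W \<alpha>) homeomorphic_space half_cylinder_top"
    and mono: "\<And>\<alpha> \<beta>. (\<alpha>, \<beta>) \<in> r \<Longrightarrow> \<alpha> \<noteq> \<beta> \<Longrightarrow> X closure_of (W \<alpha>) \<subseteq> W \<beta>"
    by simp_all
  \<comment> \<open>The order is total, and a smaller cylinder lies in its closure and thus in the
    larger one.\<close>
  have dir: "\<exists>\<gamma>\<in>Field r. W \<alpha> \<union> W \<beta> \<subseteq> W \<gamma>" if ab: "\<alpha> \<in> Field r" "\<beta> \<in> Field r" for \<alpha> \<beta>
  proof -
    have tot: "\<alpha> = \<beta> \<or> (\<alpha>, \<beta>) \<in> r \<or> (\<beta>, \<alpha>) \<in> r"
      using r ab unfolding omega1_order_def well_order_on_def linear_order_on_def total_on_def by blast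
    have sub: "W \<gamma> \<subseteq> X closure_of W \<gamma>" if "\<gamma> \<in> Field r" for \<gamma>
      using W[OF that] openin_subset closure_of_subset by metis
    show ?thesis using tot sub[OF ab(1)] sub[OF ab(2)] mono[of \<alpha> \<beta>] mono[of \<beta> \<alpha>] ab by blast
  qed
  have F0: "Field r \<noteq> {}" using r unfolding omega1_order_def by auto
  have fin: "\<exists>\<alpha>\<in>Field r. (\<Union>\<beta>\<in>A. W \<beta>) \<subseteq> W \<alpha>" if "finite A" "A \<subseteq> Field r" for A
    using that
  proof (induction A rule: finite_induct)
    case empty
    then show ?case using F0 by blast
  next
    case (insert \<beta> A)
    then obtain \<alpha> where a: "\<alpha> \<in> Field r" "(\<Union>\<beta>\<in>A. W \<beta>) \<subseteq> W \<alpha>" by blast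
    then obtain \<gamma> where "\<gamma> \<in> Field r" "W \<alpha> \<union> W \<beta> \<subseteq> W \<gamma>" using dir[of \<alpha> \<beta>] insert.prems by blast
    then show ?case using a by (intro bexI[of _ \<gamma>]) auto
  qed
  have LX: "compactin X L" using L by (simp add: X_def compactin_subtopology)
  obtain \<F> where \<F>: "finite \<F>" "\<F> \<subseteq> W ` Field r" "L \<subseteq> \<Union>\<F>"
    using compactinD[OF LX, of "W ` Field r"] W WX compactin_subset_topspace[OF LX] by auto
  obtain A where A: "A \<subseteq> Field r" "finite A" "\<F> = W ` A"
    using finite_subset_image[OF \<F>(1,2)] by blast
  obtain \<alpha> where \<alpha>: "\<alpha> \<in> Field r" "(\<Union>\<beta>\<in>A. W \<beta>) \<subseteq> W \<alpha>" using fin A by blast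
  define U where "U = W \<alpha>"
  have LU: "L \<subseteq> U" using \<alpha>(2) \<F>(3) A(3) by (auto simp: U_def)
  have oU: "openin X U" and DU: "mboundary X \<subseteq> U" and hU: "subtopology X U homeomorphic_space half_cylinder_top"
    using W[OF \<alpha>(1)] by (auto simp: U_def)
  have UP: "U \<subseteq> P i" using oU tX openin_subset by metis
  have sU: "subtopology X U = subtopology F U"
    using UP by (simp add: X_def subtopology_subtopology Int_absorb1)
  obtain u u' where u: "homeomorphic_maps (subtopology F U) half_cylinder_top u u'"
    using hU unfolding sU homeomorphic_space_def by blast
  have col: "collar F K (P i) U u u'"
  proof
    show "openin (subtopology F (P i)) U" "Dp i \<subseteq> U" using oU DU by (simp_all add: X_def)
  qed (use haus planar KF K_wb PF[OF i] P_wb[OF i] PK[OF i] D_open[OF i] u in auto)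
  have "compactin (subtopology F U) L" using L LU by (simp add: compactin_subtopology)
  from image_compactin[OF this collar.cu[OF col]]
  have "compact (u ` L)" by (simp add: compactin_subtopology)
  then have "bounded (u ` L)" by (rule compact_imp_bounded)
  then obtain b where b: "\<And>y. y \<in> L \<Longrightarrow> norm (u y) \<le> b"
    unfolding bounded_iff by blast
  show ?thesis
  proof (intro exI conjI ballI)
    show "collar F K (P i) U u u'" by (rule col)
    show "\<bar>b\<bar> + 1 > 0" by simp
    fix y assume y: "y \<in> L"
    show "y \<in> U" using y LU by blast
    have "\<bar>snd (u y)\<bar> \<le> norm (u y)" using norm_snd_le[of "snd (u y)" "fst (u y)"] by simp
    then show "snd (u y) < \<bar>b\<bar> + 1" using b[OF y] by linarith
  qed
qed

text \<open>Each point off the boundary circle has a cylinder chart reaching it, whose part of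
  positive height is open in the surface; the chart varies with the point.\<close>

lemma pipe_interior_open: "i < n \<Longrightarrow> openin F (P i - Dp i)"
proof (subst openin_subopen, intro ballI)
  fix y assume i: "i < n" and y: "y \<in> P i - Dp i"
  then have "compactin F {y}" using PF by (auto simp: finite_imp_compactin)
  then obtain U u u' s where col: "collar F K (P i) U u u'" and yU: "y \<in> U"
    using pipe_collar[OF i, of "{y}"] y by blast
  interpret collar F K "P i" U u u' by (rule col)
  have "{y \<in> U. 0 < snd (u y)} \<subseteq> P i - Dp i" using UP D_iff by auto
  moreover have "0 < snd (u y)" using u_nonneg[OF yU] D_iff[OF yU] y by auto
  ultimately show "\<exists>T. openin F T \<and> y \<in> T \<and> T \<subseteq> P i - Dp i" using N_open yU by blast
qed

text \<open>An interior chart of \<open>K\<close> is an injective continuous map into the surface,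
  so invariance of domain makes its image open there and not merely in \<open>K\<close>.\<close>

lemma core_interior_open: "openin F (K - Mk)"
proof (subst openin_subopen, intro ballI)
  fix x assume x: "x \<in> K - Mk"
  have tK: "topspace (subtopology F K) = K" using KF by auto
  have "planar_at (subtopology F K) x"
    by (rule not_mboundary_imp_planar[OF K_wb]) (use x tK in blast)+
  then obtain U V k k' where U: "openin (subtopology F K) U" "x \<in> U" "open (V :: (real \<times> real) set)"
    and k: "homeomorphic_maps (subtopology (subtopology F K) U) (top_of_set V) k k'"
    by (rule planar_atE)
  have UK: "U \<subseteq> K" using U(1) tK openin_subset by metis
  have tU: "topspace (subtopology (subtopology F K) U) = U" using UK KF by auto
  have ck': "continuous_map (top_of_set V) (subtopology (subtopology F K) U) k'"
    and kk': "\<And>z. z \<in> V \<Longrightarrow> k (k' z) = z" and k'k: "\<And>y. y \<in> U \<Longrightarrow> k' (k y) = y"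
    and ck: "continuous_map (subtopology (subtopology F K) U) (top_of_set V) k"
    using k unfolding homeomorphic_maps_def tU by auto
  have cF: "continuous_map (top_of_set V) F k'"
    using ck' continuous_map_into_fulltopology by blast
  have inj: "inj_on k' V" by (rule inj_on_inverseI[of _ k]) (rule kk')
  have "k' z \<in> U" if "z \<in> V" for z using ck' that unfolding continuous_map_def tU by auto
  moreover have "k y \<in> V" if "y \<in> U" for y using ck that unfolding continuous_map_def tU by auto
  ultimately have "k' ` V = U" using k'k by (auto simp: image_iff) (metis)
  then have "openin F U"
    using invariance_of_domain_planar(1)[OF _ planar U(3) cF inj] by simp
  moreover have "U \<inter> Mk = {}"
  proof -
    have "planar_at (subtopology F K) y" if "y \<in> U" for y
      unfolding planar_at_def homeomorphic_space_def using U(1,3) k that by blast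
    then have "y \<notin> Mk" if "y \<in> U" for y using planar_at_mboundary that by metis
    then show ?thesis by blast
  qed
  ultimately show "\<exists>T. openin F T \<and> x \<in> T \<and> T \<subseteq> K - Mk" using U(2) UK by blast
qed

lemma boundary_nbhd:
  assumes i: "i < n" and x: "x \<in> Dp i"
  obtains T where "openin F T" "x \<in> T" "T \<subseteq> (K - Mk) \<union> P i"
proof -
  have "compactin F {}" by simp
  then obtain U u u' where col: "collar F K (P i) U u u'"
    using pipe_collar[OF i, of "{}"] by blast
  interpret collar F K "P i" U u u' by (rule col)
  obtain a0 e g \<kappa> where e: "e > 0" and T: "openin F (g ` (ball a0 e \<times> {-e<..}))"
    and "homeomorphic_map (top_of_set (ball a0 e \<times> {-e<..})) (subtopology F (g ` (ball a0 e \<times> {-e<..}))) g"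
    and gx: "g (a0, 0) = x" and "continuous_on (ball (a0::real) e) \<kappa>" and "\<kappa> \<in> ball a0 e \<rightarrow> sphere 0 1"
    and neg: "\<And>a s. a \<in> ball a0 e \<Longrightarrow> s < 0 \<Longrightarrow> -e < s \<Longrightarrow> g (a, s) \<in> K - Mk"
    and pos: "\<And>a s. a \<in> ball a0 e \<Longrightarrow> 0 \<le> s \<Longrightarrow> g (a, s) \<in> U \<and> u (g (a, s)) = (\<kappa> a, s)"
    by (rule glued_chart[OF x]) (rule that; assumption)
  show thesis
  proof (rule that[OF T])
    show "x \<in> g ` (ball a0 e \<times> {-e<..})" using gx e by (intro image_eqI[of _ _ "(a0, 0)"]) auto
    show "g ` (ball a0 e \<times> {-e<..}) \<subseteq> (K - Mk) \<union> P i"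
    proof
      fix y assume "y \<in> g ` (ball a0 e \<times> {-e<..})"
      then obtain a s where as: "a \<in> ball a0 e" "-e < s" "y = g (a, s)" by auto
      show "y \<in> (K - Mk) \<union> P i"
      proof (cases "s < 0")
        case True
        then show ?thesis using neg as by blast
      next
        case False
        then show ?thesis using pos[of a s] as UP by auto
      qed
    qed
  qed
qed

text \<open>The complement is covered by the interior of the core, the interiors of the other pipes,
  and neighbourhoods of the other boundary circles that stay in the core interior and their own
  pipe.\<close>

lemma P_closed:
  assumes j: "j < n"
  shows "closedin F (P j)"
proof -
  have Dj: "Dp j \<subseteq> Mk" using M_cover[OF j] j by blast
  have "openin F (topspace F - P j)"
  proof (subst openin_subopen, intro ballI)
    fix x assume x: "x \<in> topspace F - P j"
    have KM: "(K - Mk) \<inter> P j = {}" using PK[OF j] Dj by blast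
    consider "x \<in> K - Mk" | i where "i < n" "i \<noteq> j" "x \<in> Dp i" | i where "i < n" "i \<noteq> j" "x \<in> P i - Dp i"
    proof (cases "x \<in> K")
      case True
      then show ?thesis using that(1,2) M_cover[OF j] DP[OF j] x by blast
    next
      case False
      then obtain i where "i < n" "x \<in> P i" using x cover by blast
      then show ?thesis using that(3)[of i] False PK[of i] x by blast
    qed
    then show "\<exists>T. openin F T \<and> x \<in> T \<and> T \<subseteq> topspace F - P j"
    proof cases
      case 1
      then show ?thesis using core_interior_open KM KF by (intro exI[of _ "K - Mk"]) auto
    next
      case 2
      obtain T where T: "openin F T" "x \<in> T" "T \<subseteq> (K - Mk) \<union> P i"
        using boundary_nbhd[OF 2(1,3)] by blast
      then show ?thesis using KM disjoint[OF 2(1) j 2(2)] openin_subset[OF T(1)] by (intro exI[of _ T]) blast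
    next
      case 3
      then show ?thesis using pipe_interior_open[of i] disjoint[OF 3(1) j 3(2)] PF[of i]
        by (intro exI[of _ "P i - Dp i"]) blast
    qed
  qed
  then show ?thesis using PF[OF j] by (simp add: closedin_def)
qed

section \<open>Charts on all pipes and the enlarged core\<close>

definition collars :: "(nat \<Rightarrow> 'a set) \<Rightarrow> (nat \<Rightarrow> 'a \<Rightarrow> (real \<times> real) \<times> real) \<Rightarrow> (nat \<Rightarrow> (real \<times> real) \<times> real \<Rightarrow> 'a) \<Rightarrow> bool" where
  "collars U u u' \<longleftrightarrow> (\<forall>i<n. collar F K (P i) (U i) (u i) (u' i))"

text \<open>The set \<open>K'\<close> of the overview: the core with a round collar in each pipe,
  relative to the chosen charts.\<close>

definition extend :: "(nat \<Rightarrow> 'a set) \<Rightarrow> (nat \<Rightarrow> 'a \<Rightarrow> (real \<times> real) \<times> real) \<Rightarrow> (nat \<Rightarrow> real) \<Rightarrow> 'a set" where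
  "extend U u s = K \<union> (\<Union>i<n. {y \<in> U i. snd (u i y) \<le> s i})"

lemma collarsD: "collars U u u' \<Longrightarrow> i < n \<Longrightarrow> collar F K (P i) (U i) (u i) (u' i)"
  by (simp add: collars_def)

lemma collars_exist:
  assumes L: "compactin F L"
  obtains U u u' s where "collars U u u'" "\<And>i. i < n \<Longrightarrow> 0 < s i"
    "\<And>i y. i < n \<Longrightarrow> y \<in> L \<Longrightarrow> y \<in> P i \<Longrightarrow> y \<in> U i \<and> snd (u i y) < s i"
proof -
  have "\<exists>c. collar F K (P i) (fst c) (fst (snd c)) (fst (snd (snd c))) \<and> snd (snd (snd c)) > 0 \<and>
      (\<forall>y\<in>L \<inter> P i. y \<in> fst c \<and> snd (fst (snd c) y) < snd (snd (snd c)))" if i: "i < n" for i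
  proof -
    have "compactin F (L \<inter> P i)" using closed_Int_compactin[OF P_closed[OF i] L] by (simp add: Int_commute)
    from pipe_collar[OF i this] obtain U u u' s where "collar F K (P i) U u u'" "s > 0"
      "\<forall>y\<in>L \<inter> P i. y \<in> U \<and> snd (u y) < s" by blast
    then show ?thesis by (intro exI[of _ "(U, u, u', s)"]) simp
  qed
  then obtain c where c: "\<And>i. i < n \<Longrightarrow> collar F K (P i) (fst (c i)) (fst (snd (c i))) (fst (snd (snd (c i)))) \<and> snd (snd (snd (c i))) > 0 \<and>
      (\<forall>y\<in>L \<inter> P i. y \<in> fst (c i) \<and> snd (fst (snd (c i)) y) < snd (snd (snd (c i))))"
    by metis
  show thesis
    by (rule that[of "\<lambda>i. fst (c i)" "\<lambda>i. fst (snd (c i))" "\<lambda>i. fst (snd (snd (c i)))" "\<lambda>i. snd (snd (snd (c i)))"])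
      (use c in \<open>auto simp: collars_def\<close>)
qed

text \<open>Pipes are treated one after another; collars already attached lie in other pipes and so
  do not disturb the next push.\<close>

lemma ambient_isotopic_extend:
  assumes col: "collars U u u'" and s: "\<And>i. i < n \<Longrightarrow> 0 < s i"
  shows "ambient_isotopic F K (extend U u s)"
proof -
  have "ambient_isotopic F K (K \<union> (\<Union>i<m. {y \<in> U i. snd (u i y) \<le> s i}))" if "m \<le> n" for m
    using that
  proof (induction m)
    case 0
    then show ?case by (simp add: ambient_isotopic_refl)
  next
    case (Suc m)
    then have m: "m < n" by simp
    let ?B = "K \<union> (\<Union>i<m. {y \<in> U i. snd (u i y) \<le> s i})"
    interpret collar F K "P m" "U m" "u m" "u' m" by (rule collarsD[OF col m])
    have UP': "U i \<subseteq> P i" if "i < n" for i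
      using collar.UP[OF collarsD[OF col that]] .
    have "ambient_isotopic F ?B (?B \<union> {y \<in> U m. snd (u m y) \<le> s m})"
    proof (rule ambient_isotopic_collar_push)
      have "U i \<subseteq> topspace F" if "i < m" for i using UP'[of i] PF[of i] that m by auto
      then show "?B \<subseteq> topspace F" using KF by blast
      have "U i \<inter> P m = {}" if "i < m" for i using UP'[of i] disjoint[of i m] that m by auto
      then show "(?B - K) \<inter> P m = {}" by blast
    qed (use s m in auto)
    moreover have "?B \<union> {y \<in> U m. snd (u m y) \<le> s m} = K \<union> (\<Union>i<Suc m. {y \<in> U i. snd (u i y) \<le> s i})"
      by (auto simp: less_Suc_eq)
    ultimately show ?case using ambient_isotopic_trans[OF Suc.IH[OF less_imp_le[OF m]]] by simp
  qed
  then show ?thesis by (simp add: extend_def)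
qed

lemma extend_compact:
  assumes col: "collars U u u'"
  shows "compactin F (extend U u s)"
  unfolding extend_def
proof (rule compactin_Un[OF K_compact], rule compactin_Union)
  show "compactin F S" if "S \<in> (\<lambda>i. {y \<in> U i. snd (u i y) \<le> s i}) ` {..<n}" for S
    using that collar.compactin_collar[OF collarsD[OF col]] by auto
qed simp

text \<open>The complement is a finite union of pipe ends, each closed in its pipe and therefore in
  the surface.\<close>

lemma extend_interior_open:
  assumes col: "collars U u u'" and s: "\<And>i. i < n \<Longrightarrow> 0 < s i"
  shows "openin F (K \<union> (\<Union>i<n. {y \<in> U i. snd (u i y) < s i}))"
proof -
  have UP: "U i \<subseteq> P i" if "i < n" for i
    using collar.UP[OF collarsD[OF col that]] .
  have cl: "closedin F (P i - {y \<in> U i. snd (u i y) < s i})" if i: "i < n" for i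
  proof -
    have "openin (subtopology F (P i)) {y \<in> U i. snd (u i y) < s i}"
      using collar.openin_collar[OF collarsD[OF col i]] .
    then have "closedin (subtopology F (P i)) (P i - {y \<in> U i. snd (u i y) < s i})"
      using PF[OF i] by (metis closedin_diff closedin_topspace topspace_subtopology_subset)
    then show ?thesis using closedin_trans_full P_closed[OF i] by blast
  qed
  have "K \<union> (\<Union>i<n. {y \<in> U i. snd (u i y) < s i}) = topspace F - (\<Union>i<n. P i - {y \<in> U i. snd (u i y) < s i})"
  proof (intro equalityI subsetI)
    fix y assume y: "y \<in> K \<union> (\<Union>i<n. {y \<in> U i. snd (u i y) < s i})"
    have "y \<in> {y \<in> U i. snd (u i y) < s i}" if i: "i < n" "y \<in> P i" for i
    proof (cases "y \<in> K")
      case True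
      note c = collarsD[OF col i(1)]
      have "y \<in> U i" using True i(2) PK[OF i(1)] collar.U(2)[OF c] by blast
      then show ?thesis using True collar.K_iff[OF c] s[OF i(1)] by simp
    next
      case False
      then obtain k where k: "k < n" "y \<in> U k" "snd (u k y) < s k" using y by blast
      then have "k = i" using UP[of k] disjoint[of k i] i by blast
      then show ?thesis using k by blast
    qed
    moreover have "y \<in> topspace F" using y KF UP PF by blast
    ultimately show "y \<in> topspace F - (\<Union>i<n. P i - {y \<in> U i. snd (u i y) < s i})" by blast
  next
    fix y assume "y \<in> topspace F - (\<Union>i<n. P i - {y \<in> U i. snd (u i y) < s i})"
    then show "y \<in> K \<union> (\<Union>i<n. {y \<in> U i. snd (u i y) < s i})" using cover by blast
  qed
  moreover have "closedin F (\<Union>i<n. P i - {y \<in> U i. snd (u i y) < s i})"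
    using cl by (intro closedin_Union) auto
  ultimately show ?thesis by (simp add: openin_diff)
qed

text \<open>The problem in one pipe. Because ends are permuted, exactly one frontier circle of the
  enlarged core is carried into pipe \<open>i\<close>. In polar form it is a Jordan curve around 0
  whose inside, apart from 0, is the interior part of the image.\<close>

lemma ambient_isotopic_core_image_local:
  assumes h: "homeomorphic_map F F h"
    and U: "collars U u u'" "\<And>i. i < n \<Longrightarrow> 0 < s i"
    and Kh: "K \<subseteq> h ` (K \<union> (\<Union>i<n. {y \<in> U i. snd (u i y) < s i}))"
    and V: "collars V v v'" "\<And>i. i < n \<Longrightarrow> 0 < t i"
    and hV: "\<And>i y. i < n \<Longrightarrow> y \<in> h ` extend U u s \<Longrightarrow> y \<in> P i \<Longrightarrow> y \<in> V i \<and> snd (v i y) < t i"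
    and i: "i < n"
  shows "\<exists>\<rho>>0. ambient_isotopic (top_of_set (- {0})) ((\<lambda>y. polar (v i y)) ` (h ` extend U u s \<inter> {y \<in> V i. 0 < snd (v i y)})) (cball 0 \<rho> - {0})"
proof -
  \<comment> \<open>The enlarged core is split into the open part \<open>O0\<close> and the frontier
    circles \<open>R\<close>; beyond them lie the open ends \<open>E\<close>, and \<open>B\<close>
    adds the circle to its end. \<open>B'\<close> is the part of a target pipe beyond the image of
    the enlarged core.\<close>
  define O0 where "O0 = K \<union> (\<Union>i<n. {y \<in> U i. snd (u i y) < s i})"
  define R where "R = (\<lambda>k. {y \<in> U k. snd (u k y) = s k})"
  define E where "E = (\<lambda>k. P k - {y \<in> U k. snd (u k y) \<le> s k})"
  define B where "B = (\<lambda>k. P k - {y \<in> U k. snd (u k y) < s k})"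
  define B' where "B' = (\<lambda>k. P k - {y \<in> V k. snd (v k y) < t k})"
  define A where "A = h ` extend U u s"
  note cU = collarsD[OF U(1)] and cV = collarsD[OF V(1)]
  have hinj: "inj_on h (topspace F)" and himg: "h ` topspace F = topspace F"
    using h homeomorphic_imp_injective_map homeomorphic_imp_surjective_map by blast+
  have UP: "U k \<subseteq> P k" if "k < n" for k using collar.UP[OF cU[OF that]] .
  have VP: "V k \<subseteq> P k" if "k < n" for k using collar.UP[OF cV[OF that]] .
  have DU: "Dp k \<subseteq> U k" if "k < n" for k using collar.U(2)[OF cU[OF that]] .
  have KU: "y \<in> K \<longleftrightarrow> snd (u k y) = 0" if "k < n" "y \<in> U k" for k y
    using collar.K_iff[OF cU[OF that(1)] that(2)] .
  have oO: "openin F O0" unfolding O0_def by (rule extend_interior_open[OF U])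
  have BE: "B k = R k \<union> E k" if "k < n" for k using UP[OF that] by (auto simp: B_def R_def E_def)
  have KB: "K \<inter> B k = {}" if "k < n" for k
  proof -
    have "y \<in> {y \<in> U k. snd (u k y) < s k}" if y: "y \<in> K" "y \<in> P k" for y
    proof -
      have "y \<in> U k" using PK[OF \<open>k < n\<close>] DU[OF \<open>k < n\<close>] y by blast
      then show ?thesis using KU[OF \<open>k < n\<close>] U(2)[OF \<open>k < n\<close>] y by simp
    qed
    then show ?thesis by (auto simp: B_def)
  qed
  have OB: "O0 \<inter> B k = {}" if k: "k < n" for k
  proof -
    have "{y \<in> U j. snd (u j y) < s j} \<inter> B k = {}" if j: "j < n" for j
    proof (cases "j = k")
      case False
      then show ?thesis using UP[OF j] disjoint[OF j k] by (auto simp: B_def)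
    qed (auto simp: B_def)
    then show ?thesis using KB[OF k] by (auto simp: O0_def)
  qed
  have ext: "extend U u s = O0 \<union> (\<Union>k<n. R k)"
    by (auto simp: extend_def O0_def R_def le_less)
  have BF: "B k \<subseteq> topspace F" if "k < n" for k using PF[OF that] by (auto simp: B_def)
  have top: "topspace F = O0 \<union> (\<Union>k<n. B k)"
  proof -
    have "y \<in> O0 \<union> (\<Union>k<n. B k)" if "y \<in> topspace F" for y
      using that unfolding cover O0_def B_def by blast
    then show ?thesis using BF openin_subset[OF oO] by blast
  qed
  have OF: "O0 \<subseteq> topspace F" using openin_subset[OF oO] .
  have hdisj: "h ` S \<inter> h ` T = {}" if "S \<subseteq> topspace F" "T \<subseteq> topspace F" "S \<inter> T = {}" for S T
    using inj_on_image_Int[OF hinj that(1,2)] that(3) by simp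
  have KhO: "K \<subseteq> h ` O0" using Kh by (simp add: O0_def)
  have circ: "(1, 0) \<in> sphere (0::real \<times> real) 1" by (simp add: norm_Pair)
  \<comment> \<open>The image of a closed end is connected and misses \<open>K\<close>, which lies
    in the image of \<open>O0\<close>; hence it stays in a single open pipe, called
    \<open>\<sigma> k\<close>.\<close>
  have hB: "\<exists>i\<in>{..<n}. h ` B k \<subseteq> P i - Dp i" if k: "k < n" for k
  proof (rule connectedin_subset_disjoint_open)
    have "connectedin F (B k)"
      unfolding B_def by (rule collar.connectedin_pipe_end[OF cU[OF k] U(2)[OF k]])
    then show "connectedin F (h ` B k)"
      using connectedin_continuous_map_image h homeomorphic_imp_continuous_map by blast
    have q: "((1::real, 0::real), s k) \<in> sphere 0 1 \<times> {0..}"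
      by (intro SigmaI circ) (use U(2)[OF k] in simp)
    have "u' k ((1, 0), s k) \<in> U k" "u k (u' k ((1, 0), s k)) = ((1, 0), s k)"
      using collar.u'_in[OF cU[OF k] q] collar.uu'[OF cU[OF k] q] .
    then have "u' k ((1, 0), s k) \<in> B k" using UP[OF k] unfolding B_def by auto
    then show "h ` B k \<noteq> {}" by blast
    have "h ` B k \<inter> h ` O0 = {}" by (rule hdisj[OF BF[OF k] OF]) (use OB[OF k] in blast)
    then have "h ` B k \<inter> K = {}" using KhO by blast
    moreover have "h ` B k \<subseteq> topspace F" using BF[OF k] himg by blast
    ultimately have sub: "h ` B k \<subseteq> topspace F - K" by blast
    show "h ` B k \<subseteq> (\<Union>i\<in>{..<n}. P i - Dp i)"
    proof
      fix y assume "y \<in> h ` B k"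
      then have y: "y \<in> topspace F" "y \<notin> K" using sub by auto
      then obtain l where l: "l < n" "y \<in> P l" unfolding cover by blast
      moreover have "y \<notin> Dp l" using PK[OF l(1)] y(2) by blast
      ultimately show "y \<in> (\<Union>i\<in>{..<n}. P i - Dp i)" by blast
    qed
    show "openin F (P i - Dp i)" if "i \<in> {..<n}" for i using pipe_interior_open that by simp
    show "(P i - Dp i) \<inter> (P j - Dp j) = {}" if "i \<in> {..<n}" "j \<in> {..<n}" "i \<noteq> j" for i j
      using disjoint[of i j] that by blast
  qed
  then obtain \<sigma> where \<sigma>: "\<And>k. k < n \<Longrightarrow> \<sigma> k < n \<and> h ` B k \<subseteq> P (\<sigma> k) - Dp (\<sigma> k)"
    by (metis lessThan_iff)
  have oE: "openin F (E k)" if k: "k < n" for k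
  proof -
    have "E k = (P k - Dp k) - {y \<in> U k. snd (u k y) \<le> s k}"
      using DU[OF k] collar.D_iff[OF cU[OF k]] U(2)[OF k] by (fastforce simp: E_def)
    then show ?thesis
      using pipe_interior_open[OF k] collar.closedin_collar[OF cU[OF k]] by (simp add: openin_diff)
  qed
  have ohE: "openin F (h ` E k)" if "k < n" for k
    using oE[OF that] homeomorphic_map_openness_eq[OF h] by blast
  have EF: "E k \<subseteq> topspace F" if "k < n" for k using openin_subset[OF oE[OF that]] .
  have b': "v' k ((1, 0), t k) \<in> B' k" if k: "k < n" for k
  proof -
    have q: "((1::real, 0::real), t k) \<in> sphere 0 1 \<times> {0..}"
      by (intro SigmaI circ) (use V(2)[OF k] in simp)
    have "v' k ((1, 0), t k) \<in> V k" "v k (v' k ((1, 0), t k)) = ((1, 0), t k)"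
      using collar.u'_in[OF cV[OF k] q] collar.uu'[OF cV[OF k] q] .
    then show ?thesis using VP[OF k] unfolding B'_def by auto
  qed
  \<comment> \<open>Conversely a far end of a pipe misses the image of the enlarged core, so it lies
    in the image of a single open end, called \<open>\<tau> k\<close>.\<close>
  have hE: "\<exists>j\<in>{..<n}. B' k \<subseteq> h ` E j" if k: "k < n" for k
  proof (rule connectedin_subset_disjoint_open)
    show "connectedin F (B' k)"
      unfolding B'_def by (rule collar.connectedin_pipe_end[OF cV[OF k] V(2)[OF k]])
    show "B' k \<noteq> {}" using b'[OF k] by blast
    have "B' k \<inter> A = {}" using hV[OF k] by (auto simp: B'_def A_def)
    moreover have "B' k \<subseteq> topspace F" using PF[OF k] by (auto simp: B'_def)
    moreover have "topspace F = A \<union> (\<Union>j<n. h ` E j)"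
    proof -
      have "topspace F = extend U u s \<union> (\<Union>j<n. E j)" unfolding ext top using BE by auto
      then show ?thesis using himg unfolding A_def by (metis image_UN image_Un)
    qed
    ultimately show "B' k \<subseteq> (\<Union>j\<in>{..<n}. h ` E j)" by blast
    show "openin F (h ` E j)" if "j \<in> {..<n}" for j using ohE that by simp
    show "h ` E j \<inter> h ` E l = {}" if "j \<in> {..<n}" "l \<in> {..<n}" "j \<noteq> l" for j l
      using hdisj[OF EF EF, of j l] disjoint[of j l] that by (auto simp: E_def)
  qed
  then obtain \<tau> where \<tau>: "\<And>k. k < n \<Longrightarrow> \<tau> k < n \<and> B' k \<subseteq> h ` E (\<tau> k)"
    by (metis lessThan_iff)
  \<comment> \<open>This makes \<open>\<sigma>\<close> onto a finite set of indices and therefore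
    injective: ends are permuted.\<close>
  have \<sigma>\<tau>: "\<sigma> (\<tau> k) = k" if k: "k < n" for k
  proof (rule ccontr)
    assume ne: "\<sigma> (\<tau> k) \<noteq> k"
    have "E (\<tau> k) \<subseteq> B (\<tau> k)" using BE \<tau>[OF k] by blast
    then have "B' k \<subseteq> P (\<sigma> (\<tau> k))" using \<tau>[OF k] \<sigma>[of "\<tau> k"] by blast
    moreover have "B' k \<subseteq> P k" by (auto simp: B'_def)
    ultimately show False using b'[OF k] disjoint[of "\<sigma> (\<tau> k)" k] ne \<sigma>[of "\<tau> k"] \<tau>[OF k] k by blast
  qed
  have "\<sigma> ` {..<n} = {..<n}"
  proof
    show "\<sigma> ` {..<n} \<subseteq> {..<n}" using \<sigma> by auto
    show "{..<n} \<subseteq> \<sigma> ` {..<n}"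
    proof
      fix k assume "k \<in> {..<n}"
      then have "k = \<sigma> (\<tau> k)" "\<tau> k \<in> {..<n}" using \<sigma>\<tau> \<tau> by auto
      then show "k \<in> \<sigma> ` {..<n}" by (rule image_eqI)
    qed
  qed
  then have \<sigma>inj: "inj_on \<sigma> {..<n}" by (intro eq_card_imp_inj_on) auto
  define j where "j = \<tau> i"
  have j: "j < n" "\<sigma> j = i" "B' i \<subseteq> h ` E j" using \<tau>[OF i] \<sigma>\<tau>[OF i] by (auto simp: j_def)
  interpret W: collar F K "P i" "V i" "v i" "v' i" by (rule cV[OF i])
  define N where "N = {y \<in> V i. 0 < snd (v i y)}"
  define w where "w = (\<lambda>y. polar (v i y))"
  have NP: "N \<subseteq> P i - Dp i" using W.UP W.D_iff by (auto simp: N_def)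
  \<comment> \<open>Injectivity excludes all ends but the \<open>j\<close>-th from pipe
    \<open>i\<close>, so only one frontier curve appears there.\<close>
  have other: "N \<inter> h ` B k = {}" if k: "k < n" "k \<noteq> j" for k
  proof -
    have "\<sigma> k \<noteq> i" using \<sigma>inj k j(1,2) by (auto simp: inj_on_def)
    then show ?thesis using \<sigma>[OF k(1)] NP disjoint[of "\<sigma> k" i] i by blast
  qed
  have RB: "R k \<subseteq> B k" if "k < n" for k using BE[OF that] by blast
  have Ncov: "N \<subseteq> h ` O0 \<union> h ` R j \<union> h ` E j"
  proof
    fix y assume y: "y \<in> N"
    then have "y \<in> h ` topspace F" using himg NP PF[OF i] by blast
    then obtain x where x: "x \<in> topspace F" "y = h x" by blast
    show "y \<in> h ` O0 \<union> h ` R j \<union> h ` E j"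
    proof (cases "x \<in> O0")
      case False
      then obtain k where k: "k < n" "x \<in> B k" using x(1) top by blast
      then have "k = j" using other[of k] y x(2) by blast
      then show ?thesis using k BE[OF k(1)] x(2) by blast
    qed (use x in blast)
  qed
  have RN: "h ` R j \<subseteq> N"
  proof
    fix y assume y: "y \<in> h ` R j"
    then have yP: "y \<in> P i - Dp i" using \<sigma>[OF j(1)] j(2) RB[OF j(1)] by blast
    have "y \<in> h ` extend U u s" using y ext j(1) by blast
    then have "y \<in> V i" using hV[OF i] yP by blast
    moreover have "snd (v i y) \<noteq> 0" using W.D_iff[OF calculation] yP by blast
    ultimately show "y \<in> N" using W.u_nonneg[of y] by (simp add: N_def)
  qed
  have pm: "homeomorphic_maps (top_of_set (sphere 0 1 \<times> {0<..})) (top_of_set (- {0})) polar polar_inv"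
    using polar_homeomorphic_maps by (subst homeomorphic_maps_sym)
  have wm: "homeomorphic_maps (subtopology F N) (top_of_set (- {0})) (polar \<circ> v i) (v' i \<circ> polar_inv)"
    using homeomorphic_maps_compose[OF conjI[OF W.N_maps pm]] by (simp only: N_def)
  have whm: "homeomorphic_map (subtopology F N) (top_of_set (- {0})) w"
    using wm homeomorphic_maps_map unfolding w_def o_def by blast
  have tN: "topspace (subtopology F N) = N" using NP PF[OF i] by auto
  have wN: "w ` N = - {0}" and winj: "inj_on w N"
    using homeomorphic_imp_surjective_map[OF whm] homeomorphic_imp_injective_map[OF whm] tN by auto
  have nw: "norm (w y) = snd (v i y)" if "y \<in> N" for y
  proof -
    have "v i y \<in> sphere 0 1 \<times> {0<..}" using that W.u_in[of y] by (auto simp: N_def mem_Times_iff)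
    then show ?thesis unfolding w_def by (rule norm_polar)
  qed
  have wopen: "open (w ` (N \<inter> S))" if "openin F S" for S
  proof -
    have "openin (subtopology F N) (N \<inter> S)" using that by (auto simp: openin_subtopology)
    then have "openin (top_of_set (- {0})) (w ` (N \<inter> S))" using homeomorphic_map_openness_eq[OF whm] by blast
    then show ?thesis by (simp add: openin_open_eq open_Compl)
  qed
  have ohO: "openin F (h ` O0)" using oO homeomorphic_map_openness_eq[OF h] by blast
  \<comment> \<open>The puncture is filled in. The result is open since the boundary circle of the
    pipe lies in the image of \<open>O0\<close>, and with it a whole collar, that is, a disc about
    0.\<close>
  define Q1 where "Q1 = insert 0 (w ` (N \<inter> h ` O0))"
  define Q2 where "Q2 = w ` (N \<inter> h ` E j)"
  have oQ2: "open Q2" unfolding Q2_def by (rule wopen[OF ohE[OF j(1)]])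
  have "Dp i \<subseteq> h ` O0" using KhO PK[OF i] by blast
  then obtain \<epsilon> where \<epsilon>: "\<epsilon> > 0" "\<And>y. y \<in> V i \<Longrightarrow> snd (v i y) < \<epsilon> \<Longrightarrow> y \<in> h ` O0"
    using W.collar_subset_open[OF ohO] by blast
  have oQ1: "open Q1"
  proof -
    have near: "z \<in> Q1" if "norm z < \<epsilon>" for z
    proof (cases "z = 0")
      case False
      then have "z \<in> w ` N" using wN by blast
      then obtain y where y: "y \<in> N" "z = w y" by blast
      then have "y \<in> h ` O0" using \<epsilon>(2)[of y] nw[of y] that by (auto simp: N_def)
      then show ?thesis using y by (auto simp: Q1_def)
    qed (simp add: Q1_def)
    have "ball 0 \<epsilon> \<subseteq> Q1"
    proof
      fix z :: complex assume "z \<in> ball 0 \<epsilon>"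
      then show "z \<in> Q1" by (intro near) simp
    qed
    moreover have "w ` (N \<inter> h ` O0) \<subseteq> Q1" "Q1 \<subseteq> ball 0 \<epsilon> \<union> w ` (N \<inter> h ` O0)"
      using \<epsilon>(1) by (auto simp: Q1_def)
    ultimately have "Q1 = ball 0 \<epsilon> \<union> w ` (N \<inter> h ` O0)" by blast
    then show ?thesis using wopen[OF ohO] by auto
  qed
  \<comment> \<open>Beyond height \<open>t i\<close> only the image of the end remains, which
    identifies the unbounded side of the curve.\<close>
  have far: "z \<in> Q2" if z: "t i \<le> norm z" for z
  proof -
    have "z \<noteq> 0" using V(2)[OF i] z by auto
    then have "z \<in> w ` N" using wN by blast
    then obtain y where y: "y \<in> N" "z = w y" by blast
    then have "y \<in> B' i" using z nw[of y] VP[OF i] by (auto simp: B'_def N_def)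
    then show ?thesis using j(3) y by (auto simp: Q2_def)
  qed
  \<comment> \<open>The frontier circle of the enlarged core, parametrised by the unit circle,
    mapped by the surface homeomorphism and read in the plane.\<close>
  define f where "f = (\<lambda>z. w (h (u' j ((Re z, Im z), s j))))"
  have qz: "((Re z, Im z), s j) \<in> sphere 0 1 \<times> {0..}" if "norm z = 1" for z
    using that U(2)[OF j(1)] by (simp add: norm_Pair cmod_def)
  have uR: "u' j ((Re z, Im z), s j) \<in> R j" if "norm z = 1" for z
    using collar.u'_in[OF cU[OF j(1)] qz[OF that]] collar.uu'[OF cU[OF j(1)] qz[OF that]] by (simp add: R_def)
  have fimg: "f ` sphere 0 1 = w ` (h ` R j)"
  proof (intro equalityI subsetI)
    fix x assume "x \<in> f ` sphere 0 1"
    then show "x \<in> w ` (h ` R j)" using uR by (auto simp: f_def)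
  next
    fix x assume "x \<in> w ` (h ` R j)"
    then obtain y where y: "y \<in> R j" "x = w (h y)" by blast
    then have yU: "y \<in> U j" "snd (u j y) = s j" by (auto simp: R_def)
    define z where "z = Complex (fst (fst (u j y))) (snd (fst (u j y)))"
    have uy: "u j y = ((Re z, Im z), s j)" using yU by (simp add: z_def prod_eq_iff)
    have "norm z = norm (fst (u j y))" unfolding uy by (simp add: norm_Pair cmod_def)
    then have "norm z = 1" using collar.u_sphere[OF cU[OF j(1)] yU(1)] by simp
    moreover have "y = u' j ((Re z, Im z), s j)" using collar.u'u[OF cU[OF j(1)] yU(1)] uy by simp
    ultimately show "x \<in> f ` sphere 0 1" using y by (auto simp: f_def)
  qed
  have fcont: "continuous_on (sphere 0 1) f"
  proof -
    have 1: "continuous_map (top_of_set (sphere (0::complex) 1)) (top_of_set (sphere 0 1 \<times> {0..})) (\<lambda>z. ((Re z, Im z), s j))"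
      unfolding continuous_map_subtopology_eu using qz by (auto intro!: continuous_intros)
    have 2: "continuous_map (top_of_set (sphere (0::complex) 1)) F (\<lambda>z. h (u' j ((Re z, Im z), s j)))"
      using continuous_map_compose[OF continuous_map_compose[OF 1 collar.cu'F[OF cU[OF j(1)]]] homeomorphic_imp_continuous_map[OF h]]
      by (simp add: o_def)
    have "continuous_map (top_of_set (sphere (0::complex) 1)) (subtopology F N) (\<lambda>z. h (u' j ((Re z, Im z), s j)))"
      unfolding continuous_map_in_subtopology using 2 uR RN by auto
    from continuous_map_compose[OF this homeomorphic_imp_continuous_map[OF whm]]
    show ?thesis unfolding continuous_map_subtopology_eu f_def o_def by blast
  qed
  have RF: "R j \<subseteq> topspace F" using RB[OF j(1)] BF[OF j(1)] by blast
  have finj: "inj_on f (sphere 0 1)"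
  proof (rule inj_onI)
    fix x y :: complex assume xy: "x \<in> sphere 0 1" "y \<in> sphere 0 1" and eq: "f x = f y"
    then have n: "norm x = 1" "norm y = 1" by auto
    have "h (u' j ((Re x, Im x), s j)) = h (u' j ((Re y, Im y), s j))"
      using eq uR[OF n(1)] uR[OF n(2)] RN by (intro inj_onD[OF winj]) (auto simp: f_def)
    then have "u' j ((Re x, Im x), s j) = u' j ((Re y, Im y), s j)"
      by (rule inj_onD[OF hinj _ subsetD[OF RF uR[OF n(1)]] subsetD[OF RF uR[OF n(2)]]])
    then have "((Re x, Im x), s j) = ((Re y, Im y), s j)"
      using collar.uu'[OF cU[OF j(1)] qz[OF n(1)]] collar.uu'[OF cU[OF j(1)] qz[OF n(2)]] by metis
    then show "x = y" by (simp add: complex_eq_iff)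
  qed
  define c where "c = f \<circ> circlepath 0 1"
  have c: "simple_path c" "pathfinish c = pathstart c" and ci: "path_image c = w ` (h ` R j)"
  proof -
    show "simple_path c" unfolding c_def
      by (rule simple_path_continuous_image) (use fcont finj in \<open>auto simp: simple_path_circlepath\<close>)
    show "pathfinish c = pathstart c" by (simp add: c_def pathfinish_compose pathstart_compose)
    show "path_image c = w ` (h ` R j)" by (simp add: c_def path_image_compose fimg)
  qed
  have d1: "h ` O0 \<inter> h ` R j = {}" using hdisj[OF OF RF] OB[OF j(1)] RB[OF j(1)] by blast
  have d2: "h ` O0 \<inter> h ` E j = {}" using hdisj[OF OF EF[OF j(1)]] OB[OF j(1)] BE[OF j(1)] by blast
  have d3: "h ` R j \<inter> h ` E j = {}"
    by (rule hdisj[OF RF EF[OF j(1)]]) (auto simp: R_def E_def)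
  have wdisj: "w ` (N \<inter> S) \<inter> w ` (N \<inter> T) = {}" if "S \<inter> T = {}" for S T
  proof -
    have "w ` (N \<inter> S) \<inter> w ` (N \<inter> T) = w ` ((N \<inter> S) \<inter> (N \<inter> T))"
      by (rule inj_on_image_Int[OF winj, symmetric]) auto
    then show ?thesis using that by auto
  qed
  have w0: "0 \<notin> w ` (N \<inter> S)" for S using wN by auto
  have Rw: "w ` (h ` R j) = w ` (N \<inter> h ` R j)" using RN by (metis Int_absorb1)
  have "Q1 = inside (path_image c)"
  proof (rule inside_eqI[OF c oQ1 _ oQ2 far])
    show "0 \<in> Q1" by (simp add: Q1_def)
    show "Q1 \<inter> Q2 = {}" unfolding Q1_def Q2_def using wdisj[OF d2] w0[of "h ` E j"] by simp
    have "Q1 \<union> Q2 \<union> path_image c = UNIV"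
    proof -
      have "N = (N \<inter> h ` O0) \<union> (N \<inter> h ` R j) \<union> (N \<inter> h ` E j)" using Ncov by blast
      then have "w ` N = w ` ((N \<inter> h ` O0) \<union> (N \<inter> h ` R j) \<union> (N \<inter> h ` E j))" by (rule arg_cong)
      then have "- {0} = w ` (N \<inter> h ` O0) \<union> w ` (N \<inter> h ` R j) \<union> w ` (N \<inter> h ` E j)"
        unfolding image_Un wN .
      then have eq: "- {0} = w ` (N \<inter> h ` O0) \<union> w ` (N \<inter> h ` R j) \<union> w ` (N \<inter> h ` E j)" .
      have "insert 0 a \<union> d \<union> b = UNIV" if "- {0} = a \<union> b \<union> d" for a b d :: "complex set"
        using that by blast
      from this[OF eq] show ?thesis unfolding Q1_def Q2_def ci Rw .
    qed
    moreover have "(Q1 \<union> Q2) \<inter> path_image c = {}"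
    proof -
      have "(insert 0 a \<union> d) \<inter> b = {}" if "a \<inter> b = {}" "b \<inter> d = {}" "0 \<notin> b" for a b d :: "complex set"
        using that by blast
      from this[OF wdisj[OF d1] wdisj[OF d3] w0] show ?thesis unfolding Q1_def Q2_def ci Rw .
    qed
    ultimately show "Q1 \<union> Q2 = - path_image c" by blast
  qed
  then have "0 \<in> inside (path_image c)" by (auto simp: Q1_def)
  then obtain \<rho> where \<rho>: "0 < \<rho>"
    "ambient_isotopic (top_of_set (- {0})) (inside (path_image c) \<union> path_image c - {0}) (cball 0 \<rho> - {0})"
    by (rule ambient_isotopic_Jordan_domain[OF c])
  have "w ` (A \<inter> N) = inside (path_image c) \<union> path_image c - {0}"
  proof -
    have "A \<inter> N = (N \<inter> h ` O0) \<union> (N \<inter> h ` R j)"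
    proof -
      have "N \<inter> h ` R k \<subseteq> N \<inter> h ` R j" if "k < n" for k
        using other[OF that] RB[OF that] by (cases "k = j") auto
      moreover have "A = h ` O0 \<union> (\<Union>k<n. h ` R k)" unfolding A_def ext by blast
      ultimately show ?thesis using j(1) by blast
    qed
    then have "w ` (A \<inter> N) = w ` (N \<inter> h ` O0) \<union> w ` (N \<inter> h ` R j)" by (simp only: image_Un)
    also have "\<dots> = Q1 \<union> path_image c - {0}"
    proof -
      have "a \<union> b = insert 0 a \<union> b - {0}" if "0 \<notin> a" "0 \<notin> b" for a b :: "complex set"
        using that by blast
      from this[OF w0 w0] show ?thesis unfolding Q1_def ci Rw .
    qed
    finally show ?thesis using \<open>Q1 = inside (path_image c)\<close> by simp
  qed
  then show ?thesis using \<rho> unfolding A_def N_def w_def by auto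
qed

end

text \<open>The chain of isotopic sets is: the image of \<open>K\<close>, the image \<open>A\<close>
  of the enlarged core, the round set \<open>B\<close>, and \<open>K\<close>. The outer links are
  collar pushes; the middle one is settled pipe by pipe.\<close>

lemma (in decomposition) ambient_isotopic_core_image:
  assumes h: "homeomorphic_map F F h"
  shows "ambient_isotopic F (h ` K) K"
proof -
  obtain k where hk: "homeomorphic_maps F F h k" using h by (auto simp: homeomorphic_map_maps)
  then have ck: "continuous_map F F k" and hkx: "\<And>x. x \<in> topspace F \<Longrightarrow> h (k x) = x"
    by (auto simp: homeomorphic_maps_def)
  have kF: "k x \<in> topspace F" if "x \<in> topspace F" for x
    using ck that by (auto simp: continuous_map_def)
  \<comment> \<open>The collars are chosen to swallow the preimage of \<open>K\<close>, so that
    \<open>K\<close> falls into the image of the interior of the enlarged core.\<close>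
  obtain U u u' s where U: "collars U u u'" and s: "\<And>i. i < n \<Longrightarrow> 0 < s i"
    and kU: "\<And>i y. i < n \<Longrightarrow> y \<in> k ` K \<Longrightarrow> y \<in> P i \<Longrightarrow> y \<in> U i \<and> snd (u i y) < s i"
    using collars_exist[OF image_compactin[OF K_compact ck]] by metis
  define A where "A = h ` extend U u s"
  have AF: "A \<subseteq> topspace F" and exF: "extend U u s \<subseteq> topspace F"
    using compactin_subset_topspace[OF extend_compact[OF U]] homeomorphic_imp_surjective_map[OF h]
    unfolding A_def by blast+
  have Kh: "K \<subseteq> h ` (K \<union> (\<Union>i<n. {y \<in> U i. snd (u i y) < s i}))"
  proof
    fix x assume x: "x \<in> K"
    then have xF: "x \<in> topspace F" using KF by blast
    have "k x \<in> K \<union> (\<Union>i<n. {y \<in> U i. snd (u i y) < s i})"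
    proof (cases "k x \<in> K")
      case False
      then obtain i where i: "i < n" "k x \<in> P i" using kF[OF xF] unfolding cover by blast
      then show ?thesis using kU[OF i(1) imageI[OF x] i(2)] by blast
    qed simp
    then show "x \<in> h ` (K \<union> (\<Union>i<n. {y \<in> U i. snd (u i y) < s i}))"
      using hkx[OF xF] by (intro image_eqI[of x h "k x"]) simp_all
  qed
  \<comment> \<open>New charts, large enough for \<open>A\<close>, which need not fit into the first
    ones.\<close>
  obtain V v v' t where V: "collars V v v'" and t: "\<And>i. i < n \<Longrightarrow> 0 < t i"
    and AV: "\<And>i y. i < n \<Longrightarrow> y \<in> A \<Longrightarrow> y \<in> P i \<Longrightarrow> y \<in> V i \<and> snd (v i y) < t i"
    using collars_exist[OF image_compactin[OF extend_compact[OF U] homeomorphic_imp_continuous_map[OF h]]]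
    unfolding A_def by metis
  define N where "N = (\<lambda>i. {y \<in> V i. 0 < snd (v i y)})"
  define w where "w = (\<lambda>i y. polar (v i y))"
  have "\<exists>\<rho>. \<rho> > 0 \<and> ambient_isotopic (top_of_set (- {0})) (w i ` (A \<inter> N i)) (cball 0 \<rho> - {0})" if i: "i < n" for i
    unfolding A_def N_def w_def
    by (rule ambient_isotopic_core_image_local[OF h U s Kh V t AV[unfolded A_def] i])
  then obtain \<rho> where \<rho>: "\<And>i. i < n \<Longrightarrow> \<rho> i > 0 \<and> ambient_isotopic (top_of_set (- {0})) (w i ` (A \<inter> N i)) (cball 0 (\<rho> i) - {0})"
    by metis
  \<comment> \<open>The heights are whatever radii the planar isotopies return; any such round set
    is isotopic to \<open>K\<close>.\<close>
  define B where "B = extend V v \<rho>"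
  note cV = collarsD[OF V]
  have VP: "V i \<subseteq> P i" if "i < n" for i using collar.UP[OF cV[OF that]] .
  have NP: "N i \<subseteq> P i" if "i < n" for i using VP[OF that] by (auto simp: N_def)
  have KN: "K \<inter> N i = {}" if "i < n" for i using collar.K_iff[OF cV[OF that]] by (auto simp: N_def)
  have VK: "y \<in> K" if "i < n" "y \<in> V i" "y \<notin> N i" for i y
    using collar.u_nonneg[OF cV[OF that(1)] that(2)] collar.K_iff[OF cV[OF that(1)] that(2)] that(2,3)
    by (auto simp: N_def)
  have KA: "K \<subseteq> A"
  proof -
    have "K \<union> (\<Union>i<n. {y \<in> U i. snd (u i y) < s i}) \<subseteq> extend U u s" by (auto simp: extend_def)
    then show ?thesis using Kh unfolding A_def by (meson image_mono subset_trans)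
  qed
  \<comment> \<open>Off the open collars both \<open>A\<close> and \<open>B\<close> reduce to
    \<open>K\<close>, so they differ only inside the disjoint charts.\<close>
  have A_out: "A - (\<Union>i<n. N i) = K"
  proof (intro equalityI subsetI)
    fix y assume y: "y \<in> A - (\<Union>i<n. N i)"
    show "y \<in> K"
    proof (rule ccontr)
      assume nK: "y \<notin> K"
      have "y \<in> topspace F" using y AF by blast
      then obtain i where i: "i < n" "y \<in> P i" using nK unfolding cover by blast
      have "y \<in> V i" using AV[OF i(1) _ i(2)] y by blast
      then show False using VK[OF i(1)] nK y i(1) by blast
    qed
  next
    fix y assume "y \<in> K"
    then show "y \<in> A - (\<Union>i<n. N i)" using KA KN by blast
  qed
  have B_out: "B - (\<Union>i<n. N i) = K"
  proof (intro equalityI subsetI)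
    fix y assume y: "y \<in> B - (\<Union>i<n. N i)"
    then consider "y \<in> K" | i where "i < n" "y \<in> V i" by (auto simp: B_def extend_def)
    then show "y \<in> K" using VK y by cases blast+
  next
    fix y assume "y \<in> K"
    then show "y \<in> B - (\<Union>i<n. N i)" using KN by (auto simp: B_def extend_def)
  qed
  have Ndisj: "N i \<inter> N j = {}" if "i < n" "j < n" "i \<noteq> j" for i j
    using NP[OF that(1)] NP[OF that(2)] disjoint[OF that] by blast
  have wB: "w i ` (B \<inter> N i) = cball 0 (\<rho> i) - {0}" if i: "i < n" for i
  proof -
    have "y \<in> V i \<and> snd (v i y) \<le> \<rho> i" if yB: "y \<in> B" and yN: "y \<in> N i" for y
    proof -
      have "y \<notin> K" using KN[OF i] yN by blast
      then obtain k where k: "k < n" "y \<in> V k" "snd (v k y) \<le> \<rho> k" using yB by (auto simp: B_def extend_def)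
      have "k = i" using VP[OF k(1)] NP[OF i] disjoint[OF k(1) i] k(2) yN by blast
      then show ?thesis using k by simp
    qed
    then have BN: "B \<inter> N i = {y \<in> N i. snd (v i y) \<le> \<rho> i}"
      using i by (auto simp: N_def B_def extend_def)
    have vin: "v i y \<in> sphere 0 1 \<times> {0<..}" if "y \<in> N i" for y
      using that collar.u_in[OF cV[OF i]] by (auto simp: N_def mem_Times_iff)
    show ?thesis
    proof (intro equalityI subsetI)
      fix z assume "z \<in> w i ` (B \<inter> N i)"
      then obtain y where y: "y \<in> N i" "snd (v i y) \<le> \<rho> i" "z = polar (v i y)" unfolding BN w_def by blast
      have "norm z = snd (v i y)" using norm_polar[OF vin[OF y(1)]] y(3) by simp
      then show "z \<in> cball 0 (\<rho> i) - {0}" using y by (auto simp: N_def)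
    next
      fix z :: complex assume z: "z \<in> cball 0 (\<rho> i) - {0}"
      then have p: "polar_inv z \<in> sphere 0 1 \<times> {0<..}" "polar (polar_inv z) = z"
        using polar_homeomorphic_maps unfolding homeomorphic_maps_def continuous_map_subtopology_eu by auto
      then have p': "polar_inv z \<in> sphere 0 1 \<times> {0..}" by (auto simp: mem_Times_iff)
      define y where "y = v' i (polar_inv z)"
      have y: "y \<in> V i" "v i y = polar_inv z"
        using collar.u'_in[OF cV[OF i] p'] collar.uu'[OF cV[OF i] p'] by (simp_all add: y_def)
      have "snd (polar_inv z) = norm z" by (simp add: polar_inv_def)
      then have "y \<in> B \<inter> N i" using y z unfolding BN by (simp add: N_def)
      then show "z \<in> w i ` (B \<inter> N i)" using y(2) p(2) by (intro image_eqI[of _ _ y]) (simp_all add: w_def)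
    qed
  qed
  \<comment> \<open>\<open>A\<close> is exchanged for \<open>B\<close> in the first \<open>m\<close>
    pipes; consecutive sets differ in one chart only.\<close>
  define S where "S = (\<lambda>m. (A - (\<Union>i<m. N i)) \<union> (B \<inter> (\<Union>i<m. N i)))"
  have "ambient_isotopic F A (S m)" if "m \<le> n" for m
    using that
  proof (induction m)
    case 0
    then show ?case by (simp add: S_def ambient_isotopic_refl)
  next
    case (Suc m)
    then have m: "m < n" by simp
    have dm: "N i \<inter> N m = {}" if "i < m" for i using Ndisj[of i m] that m by simp
    have "ambient_isotopic F (S m) (S (Suc m))"
    proof (rule ambient_isotopic_local[OF haus])
      show "openin F (N m)" unfolding N_def by (rule collar.N_open[OF cV[OF m]])
      have pm: "homeomorphic_maps (top_of_set (sphere 0 1 \<times> {0<..})) (top_of_set (- {0})) polar polar_inv"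
        using polar_homeomorphic_maps by (subst homeomorphic_maps_sym)
      show "homeomorphic_maps (subtopology F (N m)) (top_of_set (- {0})) (w m) (v' m \<circ> polar_inv)"
        using homeomorphic_maps_compose[OF conjI[OF collar.N_maps[OF cV[OF m]] pm]]
        unfolding N_def w_def o_def .
      have U: "(\<Union>i<Suc m. N i) = (\<Union>i<m. N i) \<union> N m" by (auto simp: less_Suc_eq)
      show "S m - N m = S (Suc m) - N m" unfolding S_def U by blast
      have 1: "S m \<inter> N m = A \<inter> N m" using dm unfolding S_def by blast
      have 2: "S (Suc m) \<inter> N m = B \<inter> N m" unfolding S_def U by blast
      show "ambient_isotopic (top_of_set (- {0})) (w m ` (S m \<inter> N m)) (w m ` (S (Suc m) \<inter> N m))"
        unfolding 1 2 wB[OF m] using \<rho>[OF m] by blast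
    qed
    then show ?case using ambient_isotopic_trans[OF Suc.IH[OF less_imp_le[OF m]]] by blast
  qed
  then have "ambient_isotopic F A (S n)" by simp
  moreover have "S n = B" unfolding S_def A_out using B_out by blast
  ultimately have AB: "ambient_isotopic F A B" by simp
  have KB: "ambient_isotopic F K B" unfolding B_def by (rule ambient_isotopic_extend[OF V]) (use \<rho> in blast)
  have "ambient_isotopic F K (extend U u s)" by (rule ambient_isotopic_extend[OF U s])
  then have "ambient_isotopic F (h ` K) A"
    unfolding A_def by (rule ambient_isotopic_homeomorphic_image[OF haus h KF exF])
  then show ?thesis
    using ambient_isotopic_trans AB ambient_isotopic_sym[OF KB KF] by blast
qed

theorem theorem3p6:
  fixes F :: "'a topology" and K :: "'a set" and n :: nat and P :: "nat \<Rightarrow> 'a set"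
    and h :: "'a \<Rightarrow> 'a"
  assumes "surface F" and "omega_bounded F"
    and "nyikos_decomposition F K n P"
    and "homeomorphic_map F F h"
  shows "\<exists>H. continuous_map (prod_topology F (top_of_set {0..1::real})) F H \<and>
             (\<forall>t\<in>{0..1}. homeomorphic_map F F (\<lambda>x. H (x, t))) \<and>
             (\<forall>x\<in>topspace F. H (x, 0) = h x) \<and>
             (\<lambda>x. H (x, 1)) ` K = K"
proof -
  interpret decomposition F K n P using assms by unfold_locales
  have ch: "continuous_map F F h" using assms(4) homeomorphic_imp_continuous_map by blast
  obtain G C where "compactin F C"
    and cG: "continuous_map (prod_topology F (top_of_set {0..1::real})) F G"
    and hG: "\<And>t. t \<in> {0..1} \<Longrightarrow> homeomorphic_map F F (\<lambda>x. G (x, t))"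
    and G0: "\<And>x. x \<in> topspace F \<Longrightarrow> G (x, 0) = x"
    and "\<And>x t. t \<in> {0..1} \<Longrightarrow> x \<in> topspace F - C \<Longrightarrow> G (x, t) = x"
    and G1: "(\<lambda>x. G (x, 1)) ` (h ` K) = K"
    using ambient_isotopic_core_image[OF assms(4)] by (rule ambient_isotopicE) (rule that)
  show ?thesis
  \<comment> \<open>The ambient isotopy carries the image of \<open>K\<close> to \<open>K\<close>
    and starts at the identity; composed after \<open>h\<close> it starts at
    \<open>h\<close>.\<close>
  proof (intro exI[of _ "\<lambda>p. G (h (fst p), snd p)"] conjI ballI)
    have "continuous_map (prod_topology F (top_of_set {0..1::real})) F (\<lambda>p. h (fst p))"
      using continuous_map_compose[OF continuous_map_fst ch] by (simp add: o_def)
    from continuous_map_compose[OF continuous_map_pairedI[OF this continuous_map_snd] cG]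
    show "continuous_map (prod_topology F (top_of_set {0..1::real})) F (\<lambda>p. G (h (fst p), snd p))"
      by (simp add: o_def)
    show "homeomorphic_map F F (\<lambda>x. G (h (fst (x, t)), snd (x, t)))" if "t \<in> {0..1}" for t
      using homeomorphic_map_compose[OF assms(4) hG[OF that]] by (simp add: o_def)
    show "G (h (fst (x, 0)), snd (x, 0)) = h x" if "x \<in> topspace F" for x
      using G0 ch that by (simp add: continuous_map_def Pi_iff)
    show "(\<lambda>x. G (h (fst (x, 1)), snd (x, 1))) ` K = K"
      using G1 by (simp add: image_image)
  qed
qed

end
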